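(* Let $\mathcal T$ be a triangulation of a convex $(n+3)$-gon, let $a\in\mathcal T$ be a diagonal, and let $M$ be an indecomposable object of $\mathcal C_f$. Then the frieze difference $\delta_a(M)$ is given as follows. If $M\in(\mathcal B\cap\mathcal C)\cup(\mathcal D\cap\mathcal E)$, then $$\delta_a(M)=\big(s(\pi_1^+(M))-s(\pi_2^+(M))\big)\big(s(\pi_1^-(M))-s(\pi_2^-(M))\big).$$ If $M\in(\mathcal B\cap\mathcal E)\cup(\mathcal C\cap\mathcal D)$, then $$\delta_a(M)=-\big(s(\pi_2^+(M))-2s(\pi_1^+(M))\big)\big(s(\pi_2^-(M))-2s(\pi_1^-(M))\big).$$ If $M\in\overline{\mathcal C\cap\mathcal E}\cup\overline{\mathcal B\cap\mathcal D}$, then $$\delta_a(M)=s(\pi_s^{\downarrow}(M))\,s(\pi_p^{\downarrow}(M))+s(\pi_s^{\uparrow}(M))\,s(\pi_p^{\uparrow}(M))-3\,s(\pi_p^{\downarrow}(M))\,s(\pi_p^{\uparrow}(M)).$$ If $M\in\mathcal F$, then $\delta_a(M)=0$.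
   Context: Category and coordinates. Label the vertices of a convex $(n+3)$-gon clockwise by $1,\ldots,n+3$, taken modulo $n+3$. Let $\mathcal C$ denote the (generalized) cluster category of type $A_n$ (below, the letters $\mathcal B,\mathcal C,\mathcal D,\mathcal E$ inside intersections denote sets of modules, defined below). Its indecomposables are in bijection with the diagonals $[i,j]=[j,i]$ of the polygon; the Auslander–Reiten (AR) quiver has arrows $[i,j]\to[i,j-1]$ and $[i,j]\to[i-1,j]$ and translation $\tau[i,j]=[i+1,j+1]$ (and $\tau=[1]$). $\mathcal C_f$ is the Frobenius category (of maximal Cohen–Macaulay modules, categorifying the coordinate ring of the Grassmannian of $2$-planes in $(n+3)$-space) with stable category $\mathcal C$, obtained by adding one indecomposable projective-injective object for each boundary segment $[i,i+1]$, with irreducible maps $[i-1,i+1]\to[i,i+1]\to[i,i+2]$. So indecomposables of $\mathcal C_f$ correspond to all diagonals and boundary segments. Modules. For $x\in\mathcal T$, let $P_x$ be the indecomposable of $\mathcal C$ with $P_x[1]$ at the position of the diagonal $x$. Then $T=\bigoplus_{x\in\mathcal T}P_x$ is cluster-tilting, $B=\operatorname{End}_{\mathcal C}(T)$ is the cluster-tilted algebra, and $\operatorname{Hom}_{\mathcal C}(T,-)$ identifies the indecomposables of $\mathcal C$ other than the $P_x[1]$ with the indecomposable $B$-modules; the $P_x$ are the indecomposable projective $B$-modules, $S_x=P_x/\operatorname{rad}P_x$. (The $B$-module at the diagonal $\gamma$ has $S_x$ as a composition factor, with multiplicity one, iff $\gamma$ crosses $x$.) If $x$ is a boundary segment, write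 $P_x[1]$ for the corresponding projective-injective object of $\mathcal C_f$. Frieze and frieze difference. For an indecomposable object $M$ of $\mathcal C_f$, put $\rho_{\mathcal T}(M)=s(M)$, where $s(M)$ is the number of submodules of $M$ if $M$ is a $B$-module, and $s(M)=1$ if $M=P_x[1]$ with $x\in\mathcal T$ or $x$ a boundary segment. Let $\mathcal T'=\mu_a(\mathcal T)$ be the triangulation obtained by flipping $a$, with cluster-tilted algebra $B'$ and map $\rho_{\mathcal T'}$ defined in the same way from $\mathcal T'$. For $M$ indecomposable in $\mathcal C_f$, let $M'$ be its mutation at $a$, i.e. the object at the same position (the same diagonal or boundary segment) of the AR quiver, now regarded as an object relative to $\mathcal T'$. The frieze difference is $\delta_a(M)=\rho_{\mathcal T}(M)-\rho_{\mathcal T'}(M')\in\mathbb Z$. Quadrilateral around $a$. Write $a=[k,l]$. The two triangles of $\mathcal T$ (with boundary segments as possible sides) adjacent to $a$ have third vertices $p$ (strictly between $k$ and $l$ going clockwise from $k$) and $q$ (strictly between $l$ and $k$ going clockwise from $l$). Put $d=[k,p]$, $c=[p,l]$, $b=[l,q]$, $e=[q,k]$ (diagonals of $\mathcal T$ or boundary segments). In the quiver of $\mathcal T$ the arrows among these are $b\to a$, $d\to a$, $a\to c$, $a\to e$, $e\to b$, $c\to d$ (whenever the vertices exist). The module $S_a$ is at the position $[p,q]$ and $P_a[1]$ at $[k,l]$. Regions. For $x\in\{a,b,c,d,e\}$ let $\mathcal X$ (i.e. $\mathcal A,\mathcal B,\mathcal C,\mathcal D,\mathcal E$ respectively) be the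 set of indecomposable $B$-modules $M$ with $\operatorname{Hom}(P_x,M)\neq0$ (equivalently $S_x$ is a composition factor of $M$); $\mathcal X=\emptyset$ if $x$ is a boundary segment. $\mathcal F$ is the set of indecomposable objects of $\mathcal C_f$ not in $\mathcal A\cup\mathcal B\cup\mathcal C\cup\mathcal D\cup\mathcal E\cup\{P_a[1]\}$. The closure $\overline{\mathcal C\cap\mathcal E}$ is the rectangle (Hom-hammock) in the AR quiver of $\mathcal C_f$ starting at $P_a[1]$ and ending at $S_a$, i.e. the objects $[i,j]$ with $i\in\{p,p+1,\ldots,l\}$ and $j\in\{q,q+1,\ldots,k\}$; $\overline{\mathcal B\cap\mathcal D}$ is the rectangle starting at $S_a$ and ending at $P_a[1]$, i.e. the objects $[i,j]$ with $i\in\{l,\ldots,q\}$ and $j\in\{k,\ldots,p\}$ (all ranges taken clockwise). Sectional paths (rays) in the AR quiver of $\mathcal C_f$: $\mathfrak e$ from $P_a[1]$ to $P_b[1]$, $\mathfrak c$ from $P_a[1]$ to $P_d[1]$, $\mathfrak b$ from $P_e[1]$ to $P_a[1]$, $\mathfrak d$ from $P_c[1]$ to $P_a[1]$, $\mathfrak c^a$ from $P_b[1]$ to $S_a$, $\mathfrak e^a$ from $P_d[1]$ to $S_a$, $\mathfrak d_a$ from $S_a$ to $P_e[1]$, $\mathfrak b_a$ from $S_a$ to $P_c[1]$. Projections of $M$ are taken along the two sectional paths (lines of the AR quiver) through $M$. Projections for the first four regions. For $M$ in $\mathcal B\cap\mathcal C$, $\mathcal D\cap\mathcal E$, $\mathcal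 B\cap\mathcal E$ or $\mathcal C\cap\mathcal D$, going backwards from $M$ along a sectional path one meets a first ray on the boundary of the region, and then a second ray further back; $\pi_1^-(M)$ and $\pi_2^-(M)$ are the objects met on the first and second one. Likewise $\pi_1^+(M),\pi_2^+(M)$ going forwards. Explicitly: - $M=[i,j]\in\mathcal B\cap\mathcal C$ with $i$ strictly between $l$ and $q$, $j$ strictly between $p$ and $l$: $\pi_1^-(M)=[j,q]\in\mathfrak c^a$, $\pi_2^-(M)=[j,k]\in\mathfrak c$, $\pi_1^+(M)=[i,p]\in\mathfrak b_a$, $\pi_2^+(M)=[i,k]\in\mathfrak b$. - $M=[i,j]\in\mathcal D\cap\mathcal E$ with $i$ strictly between $k$ and $p$, $j$ strictly between $q$ and $k$: $\pi_1^-(M)=[j,p]\in\mathfrak e^a$, $\pi_2^-(M)=[j,l]\in\mathfrak e$, $\pi_1^+(M)=[i,q]\in\mathfrak d_a$, $\pi_2^+(M)=[i,l]\in\mathfrak d$. - $M=[i,j]\in\mathcal B\cap\mathcal E$ with $i$ strictly between $l$ and $q$, $j$ strictly between $q$ and $k$: $\pi_1^-(M)=[i,k]\in\mathfrak b$, $\pi_2^-(M)=[i,p]\in\mathfrak b_a$, $\pi_1^+(M)=[j,l]\in\mathfrak e$, $\pi_2^+(M)=[j,p]\in\mathfrak e^a$. - $M=[i,j]\in\mathcal C\cap\mathcal D$ with $i$ strictly between $p$ and $l$, $j$ strictly between $k$ and $p$: $\pi_1^-(M)=[j,l]\in\mathfrak d$, $\pi_2^-(M)=[j,q]\in\mathfrak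 d_a$, $\pi_1^+(M)=[i,k]\in\mathfrak c$, $\pi_2^+(M)=[i,q]\in\mathfrak c^a$. Projections for the closures. $\pi_p^{\uparrow},\pi_p^{\downarrow}$ are the projections onto the two edges of the rectangle adjacent to $P_a[1]$, and $\pi_s^{\uparrow},\pi_s^{\downarrow}$ those onto the two edges adjacent to $S_a$; $\uparrow$ refers to the edges meeting at $P_b[1]$ (resp. $P_c[1]$), $\downarrow$ to the edges meeting at $P_d[1]$ (resp. $P_e[1]$). Explicitly: - $M=[i,j]\in\overline{\mathcal C\cap\mathcal E}$ with $i\in\{p,\ldots,l\}$, $j\in\{q,\ldots,k\}$: $\pi_p^{\uparrow}(M)=[j,l]$, $\pi_s^{\uparrow}(M)=[i,q]$, $\pi_p^{\downarrow}(M)=[i,k]$, $\pi_s^{\downarrow}(M)=[j,p]$. - $M=[i,j]\in\overline{\mathcal B\cap\mathcal D}$ with $i\in\{l,\ldots,q\}$, $j\in\{k,\ldots,p\}$: $\pi_p^{\uparrow}(M)=[j,l]$, $\pi_s^{\uparrow}(M)=[i,p]$, $\pi_p^{\downarrow}(M)=[i,k]$, $\pi_s^{\downarrow}(M)=[j,q]$. The objects $P_a[1]$ and $S_a$ lie in both closures; either choice may be used. *)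

theory Defs
  imports "HOL-Algebra.QuotRing" "HOL-Library.FuncSet"
begin

section \<open>Segments of the polygon and triangulations\<close>

text \<open>
  The vertices of the \<open>(n+3)\<close>-gon are the residues \<open>0, \<dots>, n+2\<close> modulo \<open>n+3\<close> in clockwise order
  (the label \<open>n+3\<close> is represented by \<open>0\<close>). The segment \<open>[i,j] = [j,i]\<close> is the two-element set \<open>{i,j}\<close>.
\<close>

type_synonym seg = "nat set"

definition segments :: "nat \<Rightarrow> seg set" where
  "segments n = {{i, j} | i j. i < n + 3 \<and> j < n + 3 \<and> i \<noteq> j}"

definition boundary :: "nat \<Rightarrow> seg set" where
  "boundary n = {{i, (i + 1) mod (n + 3)} | i. i < n + 3}"

definition diagonals :: "nat \<Rightarrow> seg set" where
  "diagonals n = segments n - boundary n"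

definition crosses :: "seg \<Rightarrow> seg \<Rightarrow> bool" where
  "crosses x y \<longleftrightarrow> (\<exists>i u j v. i < u \<and> u < j \<and> j < v \<and>
      (x = {i, j} \<and> y = {u, v} \<or> x = {u, v} \<and> y = {i, j}))"

definition triangulation :: "nat \<Rightarrow> seg set \<Rightarrow> bool" where
  "triangulation n T \<longleftrightarrow>
     T \<subseteq> diagonals n \<and> (\<forall>x\<in>T. \<forall>y\<in>T. \<not> crosses x y) \<and>
     (\<forall>y \<in> diagonals n - T. \<exists>x\<in>T. crosses x y)"

text \<open>Number of clockwise steps from \<open>i\<close> to \<open>j\<close>.\<close>

definition cw :: "nat \<Rightarrow> nat \<Rightarrow> nat \<Rightarrow> nat" where
  "cw n i j = (j + (n + 3) - i) mod (n + 3)"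

definition open_arc :: "nat \<Rightarrow> nat \<Rightarrow> nat \<Rightarrow> nat set" where
  "open_arc n i j = {v. v < n + 3 \<and> 0 < cw n i v \<and> cw n i v < cw n i j}"

definition closed_arc :: "nat \<Rightarrow> nat \<Rightarrow> nat \<Rightarrow> nat set" where
  "closed_arc n i j = {v. v < n + 3 \<and> cw n i v \<le> cw n i j}"

text \<open>\<open>k, p, l, q\<close> are, in clockwise order, the vertices of the two triangles of \<open>T\<close> adjacent to
  its diagonal \<open>[k,l]\<close>.\<close>

definition quadrilateral :: "nat \<Rightarrow> seg set \<Rightarrow> nat \<Rightarrow> nat \<Rightarrow> nat \<Rightarrow> nat \<Rightarrow> bool" where
  "quadrilateral n T k l p q \<longleftrightarrow>
     k < n + 3 \<and> l < n + 3 \<and> {k, l} \<in> T \<and>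
     p \<in> open_arc n k l \<and> {k, p} \<in> T \<union> boundary n \<and> {p, l} \<in> T \<union> boundary n \<and>
     q \<in> open_arc n l k \<and> {l, q} \<in> T \<union> boundary n \<and> {q, k} \<in> T \<union> boundary n"

text \<open>The flip of \<open>[k,l]\<close>: it is replaced by the other diagonal of its quadrilateral.\<close>

definition flip :: "seg set \<Rightarrow> nat \<Rightarrow> nat \<Rightarrow> nat \<Rightarrow> nat \<Rightarrow> seg set" where
  "flip T k l p q = insert {p, q} (T - {{k, l}})"

section \<open>The cluster category of type \<open>A_n\<close>\<close>

text \<open>
  Morphisms are the elements of the mesh algebra: the path algebra of the Auslander-Reiten quiver
  modulo the ideal generated by the mesh relations. A path is the nonempty list of diagonals it
  visits (there are no multiple arrows), and an element of the path algebra is its finitely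
  supported coefficient function.
\<close>

definition pred_v :: "nat \<Rightarrow> nat \<Rightarrow> nat" where
  "pred_v n i = (i + (n + 2)) mod (n + 3)"

text \<open>The inverse of the translation \<open>\<tau>[i,j] = [i+1,j+1]\<close>.\<close>

definition tau_inv :: "nat \<Rightarrow> seg \<Rightarrow> seg" where
  "tau_inv n x = pred_v n ` x"

text \<open>Since \<open>[i,j] = [j,i]\<close>, this clause covers both \<open>[i,j] \<rightarrow> [i,j-1]\<close> and \<open>[i,j] \<rightarrow> [i-1,j]\<close>.\<close>

definition arrow :: "nat \<Rightarrow> seg \<Rightarrow> seg \<Rightarrow> bool" where
  "arrow n x y \<longleftrightarrow> x \<in> diagonals n \<and> y \<in> diagonals n \<and>
     (\<exists>i j. x = {i, j} \<and> y = {i, pred_v n j})"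

definition is_path :: "nat \<Rightarrow> seg list \<Rightarrow> bool" where
  "is_path n r \<longleftrightarrow> r \<noteq> [] \<and> set r \<subseteq> diagonals n \<and>
     (\<forall>m. Suc m < length r \<longrightarrow> arrow n (r ! m) (r ! Suc m))"

text \<open>The bilinear extension of concatenation: \<open>f\<close> is traversed first, and the two factors of
  \<open>r\<close> share the vertex \<open>r ! m\<close>. So \<open>path_mult f g\<close> is the composite \<open>g \<circ> f\<close>.\<close>

definition path_mult :: "(seg list \<Rightarrow> 'k::field) \<Rightarrow> (seg list \<Rightarrow> 'k) \<Rightarrow> seg list \<Rightarrow> 'k" where
  "path_mult f g r = (\<Sum>m<length r. f (take (Suc m) r) * g (drop m r))"

definition path_algebra :: "nat \<Rightarrow> (seg list \<Rightarrow> 'k::field) ring" where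
  "path_algebra n =
     \<lparr> carrier = {f. finite {r. f r \<noteq> 0} \<and> (\<forall>r. f r \<noteq> 0 \<longrightarrow> is_path n r)},
       monoid.mult = path_mult,
       one = (\<lambda>r. if \<exists>x\<in>diagonals n. r = [x] then 1 else 0),
       zero = (\<lambda>r. 0),
       add = (\<lambda>f g r. f r + g r) \<rparr>"

text \<open>The sum of all paths \<open>x \<rightarrow> y \<rightarrow> \<tau>\<^sup>-\<^sup>1 x\<close> (one or two of them if \<open>n \<ge> 2\<close>, none if \<open>n = 1\<close>).\<close>

definition mesh :: "nat \<Rightarrow> seg \<Rightarrow> seg list \<Rightarrow> 'k::field" where
  "mesh n x = (\<lambda>r. if \<exists>y. arrow n x y \<and> r = [x, y, tau_inv n x] then 1 else 0)"

definition mesh_ideal :: "nat \<Rightarrow> (seg list \<Rightarrow> 'k::field) set" where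
  "mesh_ideal n = genideal (path_algebra n) (mesh n ` diagonals n)"

definition mesh_algebra :: "nat \<Rightarrow> (seg list \<Rightarrow> 'k::field) set ring" where
  "mesh_algebra n = path_algebra n Quot mesh_ideal n"

text \<open>For sets \<open>X\<close>, \<open>Y\<close> of diagonals, the space of morphisms from \<open>\<Oplus>X\<close> to \<open>\<Oplus>Y\<close>: the classes of
  linear combinations of paths from elements of \<open>X\<close> to elements of \<open>Y\<close>. Composition is the
  multiplication of the mesh algebra.\<close>

definition hom_C :: "nat \<Rightarrow> seg set \<Rightarrow> seg set \<Rightarrow> (seg list \<Rightarrow> 'k::field) set set" where
  "hom_C n X Y = (\<lambda>f. mesh_ideal n +>\<^bsub>path_algebra n\<^esub> f) `
     {f \<in> carrier (path_algebra n). \<forall>r. f r \<noteq> 0 \<longrightarrow> hd r \<in> X \<and> last r \<in> Y}"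

section \<open>Modules over the cluster-tilted algebra\<close>

text \<open>The position of \<open>P_x\<close>; as \<open>[1] = \<tau>\<close>, the object \<open>P_x[1]\<close> is at \<open>x\<close>.\<close>

definition pos_P :: "nat \<Rightarrow> seg \<Rightarrow> seg" where
  "pos_P n x = tau_inv n x"

definition cluster_tilted :: "nat \<Rightarrow> seg set \<Rightarrow> (seg list \<Rightarrow> 'k::field) set set" where
  "cluster_tilted n T = hom_C n (pos_P n ` T) (pos_P n ` T)"

definition module_at :: "nat \<Rightarrow> seg set \<Rightarrow> seg \<Rightarrow> (seg list \<Rightarrow> 'k::field) set set" where
  "module_at n T x = hom_C n (pos_P n ` T) {x}"

text \<open>An endomorphism \<open>b\<close> of \<open>\<Oplus>P_x\<close> acts by \<open>u \<mapsto> u \<circ> b\<close>, which in the mesh algebra is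
  \<open>b \<otimes> u\<close>. Closure under scalars is part of the last condition, as scalar multiples of the
  identity belong to the cluster-tilted algebra.\<close>

definition submodules :: "nat \<Rightarrow> seg set \<Rightarrow> seg \<Rightarrow> (seg list \<Rightarrow> 'k::field) set set set" where
  "submodules n T x =
     {U. U \<subseteq> module_at n T x \<and> additive_subgroup U (mesh_algebra n) \<and>
         (\<forall>b\<in>cluster_tilted n T. \<forall>u\<in>U. b \<otimes>\<^bsub>mesh_algebra n\<^esub> u \<in> U)}"

definition module_homs ::
    "nat \<Rightarrow> seg set \<Rightarrow> seg \<Rightarrow> seg \<Rightarrow> ((seg list \<Rightarrow> 'k::field) set \<Rightarrow> (seg list \<Rightarrow> 'k) set) set" where
  "module_homs n T x y =
     {h \<in> module_at n T x \<rightarrow>\<^sub>E module_at n T y.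
        (\<forall>u\<in>module_at n T x. \<forall>v\<in>module_at n T x.
           h (u \<oplus>\<^bsub>mesh_algebra n\<^esub> v) = h u \<oplus>\<^bsub>mesh_algebra n\<^esub> h v) \<and>
        (\<forall>b\<in>cluster_tilted n T. \<forall>u\<in>module_at n T x.
           h (b \<otimes>\<^bsub>mesh_algebra n\<^esub> u) = b \<otimes>\<^bsub>mesh_algebra n\<^esub> h u)}"

text \<open>The diagonals carrying an indecomposable module \<open>M\<close> with \<open>Hom(P_x, M) \<noteq> 0\<close>. The base field
  is passed as a type argument.\<close>

definition region :: "'k::field itself \<Rightarrow> nat \<Rightarrow> seg set \<Rightarrow> seg \<Rightarrow> seg set" where
  "region K n T x =
     (if x \<in> boundary n then {}
      else {M \<in> diagonals n - T.
              \<exists>h \<in> module_homs n T (pos_P n x) M. \<exists>u \<in> module_at n T (pos_P n x).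
                h u \<noteq> \<zero>\<^bsub>mesh_algebra n :: (seg list \<Rightarrow> 'k) set ring\<^esub>})"

section \<open>Friezes\<close>

definition rho :: "'k::field itself \<Rightarrow> nat \<Rightarrow> seg set \<Rightarrow> seg \<Rightarrow> int" where
  "rho K n T M =
     (if M \<in> T \<union> boundary n then 1
      else int (card (submodules n T M :: (seg list \<Rightarrow> 'k) set set set)))"

definition frieze_difference ::
    "'k::field itself \<Rightarrow> nat \<Rightarrow> seg set \<Rightarrow> nat \<Rightarrow> nat \<Rightarrow> nat \<Rightarrow> nat \<Rightarrow> seg \<Rightarrow> int" where
  "frieze_difference K n T k l p q M = rho K n T M - rho K n (flip T k l p q) M"

section \<open>Regions and projections around the quadrilateral\<close>

text \<open>With \<open>a = [k,l]\<close>, \<open>b = [l,q]\<close>, \<open>c = [p,l]\<close>, \<open>d = [k,p]\<close>, \<open>e = [q,k]\<close>, the names below stand for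
  the intersections of the regions of \<open>b\<close> and \<open>c\<close>, of \<open>d\<close> and \<open>e\<close>, of \<open>b\<close> and \<open>e\<close>, of \<open>c\<close> and \<open>d\<close>.\<close>

datatype overlap = BC | DE | BE | CD

fun overlap_region ::
    "'k::field itself \<Rightarrow> nat \<Rightarrow> seg set \<Rightarrow> nat \<Rightarrow> nat \<Rightarrow> nat \<Rightarrow> nat \<Rightarrow> overlap \<Rightarrow> seg set" where
  "overlap_region K n T k l p q BC = region K n T {l, q} \<inter> region K n T {p, l}"
| "overlap_region K n T k l p q DE = region K n T {k, p} \<inter> region K n T {q, k}"
| "overlap_region K n T k l p q BE = region K n T {l, q} \<inter> region K n T {q, k}"
| "overlap_region K n T k l p q CD = region K n T {p, l} \<inter> region K n T {k, p}"

datatype rect = CE | BD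

fun rect_closure :: "nat \<Rightarrow> nat \<Rightarrow> nat \<Rightarrow> nat \<Rightarrow> nat \<Rightarrow> rect \<Rightarrow> seg set" where
  "rect_closure n k l p q CE = {{i, j} | i j. i \<in> closed_arc n p l \<and> j \<in> closed_arc n q k}"
| "rect_closure n k l p q BD = {{i, j} | i j. i \<in> closed_arc n l q \<and> j \<in> closed_arc n k p}"

definition region_F ::
    "'k::field itself \<Rightarrow> nat \<Rightarrow> seg set \<Rightarrow> nat \<Rightarrow> nat \<Rightarrow> nat \<Rightarrow> nat \<Rightarrow> seg set" where
  "region_F K n T k l p q =
     segments n - (region K n T {k, l} \<union> region K n T {l, q} \<union> region K n T {p, l} \<union>
                   region K n T {k, p} \<union> region K n T {q, k} \<union> {{k, l}})"

text \<open>Projection of \<open>M\<close> along the sectional path that fixes its (unique) endpoint in the arc \<open>A\<close>,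
  onto the ray of segments ending at the vertex \<open>v\<close>.\<close>

definition proj :: "nat set \<Rightarrow> nat \<Rightarrow> seg \<Rightarrow> seg" where
  "proj A v M = {THE i. i \<in> M \<and> i \<in> A, v}"

fun pi1_minus :: "nat \<Rightarrow> nat \<Rightarrow> nat \<Rightarrow> nat \<Rightarrow> nat \<Rightarrow> overlap \<Rightarrow> seg \<Rightarrow> seg" where
  "pi1_minus n k l p q BC M = proj (open_arc n p l) q M"
| "pi1_minus n k l p q DE M = proj (open_arc n q k) p M"
| "pi1_minus n k l p q BE M = proj (open_arc n l q) k M"
| "pi1_minus n k l p q CD M = proj (open_arc n k p) l M"

fun pi2_minus :: "nat \<Rightarrow> nat \<Rightarrow> nat \<Rightarrow> nat \<Rightarrow> nat \<Rightarrow> overlap \<Rightarrow> seg \<Rightarrow> seg" where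
  "pi2_minus n k l p q BC M = proj (open_arc n p l) k M"
| "pi2_minus n k l p q DE M = proj (open_arc n q k) l M"
| "pi2_minus n k l p q BE M = proj (open_arc n l q) p M"
| "pi2_minus n k l p q CD M = proj (open_arc n k p) q M"

fun pi1_plus :: "nat \<Rightarrow> nat \<Rightarrow> nat \<Rightarrow> nat \<Rightarrow> nat \<Rightarrow> overlap \<Rightarrow> seg \<Rightarrow> seg" where
  "pi1_plus n k l p q BC M = proj (open_arc n l q) p M"
| "pi1_plus n k l p q DE M = proj (open_arc n k p) q M"
| "pi1_plus n k l p q BE M = proj (open_arc n q k) l M"
| "pi1_plus n k l p q CD M = proj (open_arc n p l) k M"

fun pi2_plus :: "nat \<Rightarrow> nat \<Rightarrow> nat \<Rightarrow> nat \<Rightarrow> nat \<Rightarrow> overlap \<Rightarrow> seg \<Rightarrow> seg" where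
  "pi2_plus n k l p q BC M = proj (open_arc n l q) k M"
| "pi2_plus n k l p q DE M = proj (open_arc n k p) l M"
| "pi2_plus n k l p q BE M = proj (open_arc n q k) p M"
| "pi2_plus n k l p q CD M = proj (open_arc n p l) q M"

fun pip_up :: "nat \<Rightarrow> nat \<Rightarrow> nat \<Rightarrow> nat \<Rightarrow> nat \<Rightarrow> rect \<Rightarrow> seg \<Rightarrow> seg" where
  "pip_up n k l p q CE M = proj (closed_arc n q k) l M"
| "pip_up n k l p q BD M = proj (closed_arc n k p) l M"

fun pis_up :: "nat \<Rightarrow> nat \<Rightarrow> nat \<Rightarrow> nat \<Rightarrow> nat \<Rightarrow> rect \<Rightarrow> seg \<Rightarrow> seg" where
  "pis_up n k l p q CE M = proj (closed_arc n p l) q M"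
| "pis_up n k l p q BD M = proj (closed_arc n l q) p M"

fun pip_down :: "nat \<Rightarrow> nat \<Rightarrow> nat \<Rightarrow> nat \<Rightarrow> nat \<Rightarrow> rect \<Rightarrow> seg \<Rightarrow> seg" where
  "pip_down n k l p q CE M = proj (closed_arc n p l) k M"
| "pip_down n k l p q BD M = proj (closed_arc n l q) k M"

fun pis_down :: "nat \<Rightarrow> nat \<Rightarrow> nat \<Rightarrow> nat \<Rightarrow> nat \<Rightarrow> rect \<Rightarrow> seg \<Rightarrow> seg" where
  "pis_down n k l p q CE M = proj (closed_arc n q k) p M"
| "pis_down n k l p q BD M = proj (closed_arc n k p) q M"

end

theory Submission
  imports Defs
begin

text \<open>
  Every space of morphisms of the mesh algebra is at most one-dimensional: mesh relations rewrite
  every path out of \<open>P_x\<close> to a multiple of a standard one in the rectangle of diagonals crossing \<open>x\<close>,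
  or to zero, while a signed count of the paths that stay inside this rectangle vanishes on the mesh
  ideal and so detects the nonzero ones. Hence a submodule of the module at \<open>M\<close> is determined by the
  diagonals of \<open>T\<close> on which it lives, and the sets that occur are the lower sets, for rotation about
  common endpoints, of the chain of diagonals of \<open>T\<close> crossing \<open>M\<close>. Sorting these lower sets by whether
  they contain a given diagonal \<open>[k,l]\<close> of \<open>T\<close> crossing \<open>[i,j]\<close> gives the Ptolemy relation
  \<open>s[i,j] = s[i,k] s[j,l] + s[i,l] s[j,k]\<close>. It expresses the values of both friezes by those on
  segments lying in one of the four arcs cut out by the quadrilateral, where the two friezes agree,
  and each formula becomes a polynomial identity.
\<close>

section \<open>The path algebra\<close>

text \<open>A submodule is here a set of classes in a quotient ring, so even finiteness of the count
  needs proof over an infinite field; it rests on the fact that no simple occurs twice in a module.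
  Rewriting bounds the morphism spaces from above but cannot show that a class is nonzero. For that
  a representation killing the meshes is needed, and since a mesh is a sum and not a difference, its
  squares anticommute: letting every arrow act by 1 works only in characteristic 2. This is where
  the signs come from. A nonzero map between projectives is not yet enough for lower sets. Its
  composite with the map into M must be nonzero too, so the paths are chosen to stay inside the
  rectangle of the first projective. The constants 2 and 3 in the formulas come from the two
  triangles at [k,l]. A vertex of the arc from l to q with counts u to l and w to q has count u + w
  to k, behind one triangle, but 2u + w to p, behind both. The flip exchanges the roles of k and p:
  it gives u + w to p and u + 2w to k.\<close>

definition single :: "seg list \<Rightarrow> 'k::field \<Rightarrow> seg list \<Rightarrow> 'k" where
  "single r c = (\<lambda>r'. if r' = r then c else 0)"

lemma path_mult_assoc: "path_mult (path_mult f g) h = path_mult f (path_mult g h)"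
proof
  fix r
  let ?t = "\<lambda>l m. f (take (Suc l) r) * g (drop l (take (Suc m) r)) * h (drop m r)"
  have "path_mult (path_mult f g) h r = (\<Sum>m<length r. \<Sum>l<Suc m. ?t l m)"
  proof (unfold path_mult_def, intro sum.cong refl)
    fix m assume "m \<in> {..<length r}"
    then have "length (take (Suc m) r) = Suc m" and "min (Suc l) (Suc m) = Suc l" if "l < Suc m" for l
      using that by auto
    then show "(\<Sum>l<length (take (Suc m) r). f (take (Suc l) (take (Suc m) r)) *
        g (drop l (take (Suc m) r))) * h (drop m r) = (\<Sum>l<Suc m. ?t l m)"
      unfolding sum_distrib_right by (intro sum.cong) auto
  qed
  also have "\<dots> = (\<Sum>(m, l) \<in> (SIGMA m:{..<length r}. {..<Suc m}). ?t l m)"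
    by (rule sum.Sigma) auto
  \<comment> \<open>A triple factorisation is a pair of cut points; the second one is now measured
    from the first, as in the product \<open>path_mult g h\<close>.\<close>
  also have "\<dots> = (\<Sum>(l, m) \<in> (SIGMA l:{..<length r}. {..<length r - l}). ?t l (m + l))"
    by (rule sum.reindex_bij_witness[of _ "\<lambda>(l, m). (m + l, l)" "\<lambda>(m, l). (l, m - l)"]) auto
  also have "\<dots> = (\<Sum>l<length r. \<Sum>m<length r - l. ?t l (m + l))"
    by (rule sum.Sigma[symmetric]) auto
  also have "\<dots> = path_mult f (path_mult g h) r"
    unfolding path_mult_def
    by (intro sum.cong refl)
      (auto simp: sum_distrib_left drop_take mult.assoc Suc_diff_le add.commute intro!: sum.cong)
  finally show "path_mult (path_mult f g) h r = path_mult f (path_mult g h) r" .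
qed

lemma path_mult_add_left: "path_mult (\<lambda>r. f r + g r) h = (\<lambda>r. path_mult f h r + path_mult g h r)"
  by (auto simp: path_mult_def algebra_simps sum.distrib)

lemma path_mult_add_right: "path_mult h (\<lambda>r. f r + g r) = (\<lambda>r. path_mult h f r + path_mult h g r)"
  by (auto simp: path_mult_def algebra_simps sum.distrib)

lemma path_mult_scale_left: "path_mult (\<lambda>r. c * f r) g = (\<lambda>r. c * path_mult f g r)"
  by (auto simp: path_mult_def sum_distrib_left mult.assoc)

lemma path_mult_nonzeroE:
  assumes "path_mult f g r \<noteq> 0"
  obtains m where "m < length r" "f (take (Suc m) r) \<noteq> 0" "g (drop m r) \<noteq> 0"
proof -
  from assms obtain m where "m \<in> {..<length r}" "f (take (Suc m) r) * g (drop m r) \<noteq> 0"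
    unfolding path_mult_def by (rule sum.not_neutral_contains_not_neutral)
  then show ?thesis using that by auto
qed

text \<open>Both factors of a cut contain the vertex \<open>r ! m\<close>, so regluing drops the
  head of the second one. The form \<open>r @ tl r'\<close> for concatenation recurs
  throughout.\<close>

lemma take_Suc_append_tl_drop: "m < length r \<Longrightarrow> take (Suc m) r @ tl (drop m r) = r"
  by (metis append_take_drop_id drop_Suc tl_drop)

lemma last_take_Suc: "m < length r \<Longrightarrow> last (take (Suc m) r) = r ! m"
  by (simp add: take_Suc_conv_app_nth)

lemma is_path_append:
  assumes "is_path n r" "is_path n r'" "last r = hd r'"
  shows "is_path n (r @ tl r')"
proof (cases "tl r' = []")
  case True
  then show ?thesis using assms by simp
next
  case False
  have ne: "r \<noteq> []" "r' \<noteq> []" using assms by (auto simp: is_path_def)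
  have tl: "tl r' ! i = r' ! Suc i" if "i < length (tl r')" for i
    using that by (simp add: nth_tl)
  show ?thesis
    unfolding is_path_def
  proof (intro conjI allI impI)
    show "r @ tl r' \<noteq> []" using ne by simp
    show "set (r @ tl r') \<subseteq> diagonals n"
      using assms ne by (auto simp: is_path_def dest: list.set_sel(2))
    fix m assume m: "Suc m < length (r @ tl r')"
    show "arrow n ((r @ tl r') ! m) ((r @ tl r') ! Suc m)"
    proof (cases "Suc m < length r")
      case True
      then show ?thesis using assms(1) by (auto simp: is_path_def nth_append)
    next
      case False
      show ?thesis
      proof (cases "Suc m = length r")
        case True
        then have "(r @ tl r') ! m = r' ! 0"
          using assms(3) ne by (simp add: nth_append last_conv_nth hd_conv_nth flip: True)
        moreover have "(r @ tl r') ! Suc m = r' ! Suc 0"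
          using True m ne tl[of 0] by (simp add: nth_append)
        ultimately show ?thesis
          using assms(2) m True by (auto simp: is_path_def)
      next
        case F: False
        then have "(r @ tl r') ! m = r' ! Suc (m - length r)"
            "(r @ tl r') ! Suc m = r' ! Suc (Suc (m - length r))"
          using False m tl by (auto simp: nth_append Suc_diff_le nth_tl)
        then show ?thesis
          using assms(2) m F False by (auto simp: is_path_def)
      qed
    qed
  qed
qed

lemma finite_diagonals: "finite (diagonals n)"
proof -
  have "diagonals n \<subseteq> Pow {..<n + 3}"
    by (auto simp: diagonals_def segments_def)
  then show ?thesis by (rule finite_subset) simp
qed

lemma path_mult_carrier:
  assumes "f \<in> carrier (path_algebra n)" "g \<in> carrier (path_algebra n)"
  shows "path_mult f g \<in> carrier (path_algebra n)"
proof -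
  have sub: "\<exists>r1 r2. r = r1 @ tl r2 \<and> f r1 \<noteq> 0 \<and> g r2 \<noteq> 0 \<and> last r1 = hd r2"
    if "path_mult f g r \<noteq> 0" for r
  proof -
    from that obtain m where m: "m < length r" "f (take (Suc m) r) \<noteq> 0" "g (drop m r) \<noteq> 0"
      by (rule path_mult_nonzeroE)
    then show ?thesis
      by (intro exI[of _ "take (Suc m) r"] exI[of _ "drop m r"])
        (simp add: take_Suc_append_tl_drop last_take_Suc hd_drop_conv_nth)
  qed
  have "{r. path_mult f g r \<noteq> 0} \<subseteq> (\<lambda>(r1, r2). r1 @ tl r2) ` ({r. f r \<noteq> 0} \<times> {r. g r \<noteq> 0})"
    using sub by force
  moreover have "is_path n r" if "path_mult f g r \<noteq> 0" for r
    using sub[OF that] assms by (auto simp: path_algebra_def intro: is_path_append)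
  ultimately show ?thesis
    using assms by (auto simp: path_algebra_def intro: finite_subset)
qed

lemma one_path_mult:
  assumes "f \<in> carrier (path_algebra n)"
  shows "path_mult \<one>\<^bsub>path_algebra n\<^esub> f = f"
proof
  fix r
  show "path_mult \<one>\<^bsub>path_algebra n\<^esub> f r = f r"
  proof (cases r)
    case Nil
    then show ?thesis using assms by (auto simp: path_mult_def path_algebra_def is_path_def)
  next
    case (Cons x xs)
    have "path_mult \<one>\<^bsub>path_algebra n\<^esub> f r
        = (\<Sum>m<length r. if m = 0 then \<one>\<^bsub>path_algebra n\<^esub> [x] * f r else 0)"
      unfolding path_mult_def
      by (intro sum.cong) (auto simp: path_algebra_def Cons)
    also have "\<dots> = \<one>\<^bsub>path_algebra n\<^esub> [x] * f r"
      using Cons by simp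
    also have "\<dots> = f r"
      using assms Cons by (auto simp: path_algebra_def is_path_def)
    finally show ?thesis .
  qed
qed

lemma path_mult_one:
  assumes "f \<in> carrier (path_algebra n)"
  shows "path_mult f \<one>\<^bsub>path_algebra n\<^esub> = f"
proof
  fix r
  show "path_mult f \<one>\<^bsub>path_algebra n\<^esub> r = f r"
  proof (cases r rule: rev_cases)
    case Nil
    then show ?thesis using assms by (auto simp: path_mult_def path_algebra_def is_path_def)
  next
    case (snoc xs x)
    have eq: "drop m xs = [] \<longleftrightarrow> m = length xs" if "m < length r" for m
      using that by (auto simp: snoc)
    have "path_mult f \<one>\<^bsub>path_algebra n\<^esub> r
        = (\<Sum>m<length r. if m = length xs then f r * \<one>\<^bsub>path_algebra n\<^esub> [x] else 0)"
      unfolding path_mult_def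
      by (intro sum.cong) (auto simp: path_algebra_def snoc append_eq_Cons_conv)
    also have "\<dots> = f r * \<one>\<^bsub>path_algebra n\<^esub> [x]"
      using snoc by simp
    also have "\<dots> = f r"
      using assms snoc by (auto simp: path_algebra_def is_path_def)
    finally show ?thesis .
  qed
qed

lemma path_algebra_simps [simp]:
  "\<zero>\<^bsub>path_algebra n\<^esub> = (\<lambda>r. 0)"
  "f \<oplus>\<^bsub>path_algebra n\<^esub> g = (\<lambda>r. f r + g r)"
  "f \<otimes>\<^bsub>path_algebra n\<^esub> g = path_mult f g"
  by (simp_all add: path_algebra_def)

lemma one_carrier: "\<one>\<^bsub>path_algebra n\<^esub> \<in> carrier (path_algebra n)"
proof -
  have "{r. \<exists>x\<in>diagonals n. r = [x]} = (\<lambda>x. [x]) ` diagonals n" by blast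
  then have "finite {r. \<exists>x\<in>diagonals n. r = [x]}" by (simp add: finite_diagonals)
  moreover have "is_path n [x]" if "x \<in> diagonals n" for x
    using that by (simp add: is_path_def)
  ultimately show ?thesis by (auto simp: path_algebra_def)
qed

lemma add_carrier:
  assumes "f \<in> carrier (path_algebra n)" "g \<in> carrier (path_algebra n)"
  shows "(\<lambda>r. f r + g r) \<in> carrier (path_algebra n)"
proof -
  have "{r. f r + g r \<noteq> 0} \<subseteq> {r. f r \<noteq> 0} \<union> {r. g r \<noteq> 0}" by auto
  then have "finite {r. f r + g r \<noteq> 0}"
    by (rule finite_subset) (use assms in \<open>auto simp: path_algebra_def\<close>)
  moreover have "is_path n r" if "f r + g r \<noteq> 0" for r
    using that assms by (cases "f r = 0") (auto simp: path_algebra_def)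
  ultimately show ?thesis by (auto simp: path_algebra_def)
qed

lemma scale_carrier:
  assumes "f \<in> carrier (path_algebra n)"
  shows "(\<lambda>r. c * f r) \<in> carrier (path_algebra n)"
  using assms by (cases "c = 0") (auto simp: path_algebra_def)

lemma ring_path_algebra: "ring (path_algebra n :: (seg list \<Rightarrow> 'k::field) ring)"
proof (rule ringI)
  show "abelian_group (path_algebra n :: (seg list \<Rightarrow> 'k) ring)"
  proof (rule abelian_groupI)
    fix f :: "seg list \<Rightarrow> 'k" assume f: "f \<in> carrier (path_algebra n)"
    show "\<exists>y\<in>carrier (path_algebra n). y \<oplus>\<^bsub>path_algebra n\<^esub> f = \<zero>\<^bsub>path_algebra n\<^esub>"
      using scale_carrier[OF f, of "-1"] by (auto intro!: bexI[of _ "\<lambda>r. -1 * f r"])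
  qed (auto simp: add_carrier algebra_simps, auto simp: path_algebra_def)
  show "Group.monoid (path_algebra n :: (seg list \<Rightarrow> 'k) ring)"
    by (rule monoidI)
      (simp_all add: path_mult_carrier one_carrier path_mult_assoc one_path_mult path_mult_one)
qed (simp_all add: path_mult_add_left path_mult_add_right)

section \<open>Elements of the path algebra as sums of scaled paths\<close>

lemma single_carrier: "is_path n r \<Longrightarrow> single r c \<in> carrier (path_algebra n)"
  by (auto simp: single_def path_algebra_def)

lemma path_mult_single:
  assumes "r \<noteq> []" "r' \<noteq> []"
  shows "path_mult (single r c) (single r' d) =
    (if last r = hd r' then single (r @ tl r') (c * d) else (\<lambda>_. 0))"
proof
  fix s
  have *: "take (Suc m) s = r \<and> drop m s = r' \<longleftrightarrow>
      last r = hd r' \<and> s = r @ tl r' \<and> m = length r - 1" if "m < length s" for m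
  proof
    assume "take (Suc m) s = r \<and> drop m s = r'"
    then have "r = take (Suc m) s" "r' = drop m s" by auto
    then show "last r = hd r' \<and> s = r @ tl r' \<and> m = length r - 1"
      using that by (simp add: last_take_Suc hd_drop_conv_nth take_Suc_append_tl_drop)
  next
    assume "last r = hd r' \<and> s = r @ tl r' \<and> m = length r - 1"
    moreover obtain a as where "r' = a # as" using assms by (cases r') auto
    moreover obtain bs b where "r = bs @ [b]" using assms by (cases r rule: rev_cases) auto
    ultimately show "take (Suc m) s = r \<and> drop m s = r'" by simp
  qed
  have "path_mult (single r c) (single r' d) s =
     (\<Sum>m<length s. if last r = hd r' \<and> s = r @ tl r' \<and> m = length r - 1 then c * d else 0)"
    unfolding path_mult_def single_def
  proof (intro sum.cong refl)
    fix m assume "m \<in> {..<length s}"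
    then show "(if take (Suc m) s = r then c else 0) * (if drop m s = r' then d else 0) =
        (if last r = hd r' \<and> s = r @ tl r' \<and> m = length r - 1 then c * d else 0)"
      using *[of m] by (cases "take (Suc m) s = r"; cases "drop m s = r'") auto
  qed
  also have "\<dots> = (if last r = hd r' then single (r @ tl r') (c * d) else (\<lambda>_. 0)) s"
  proof (cases "last r = hd r' \<and> s = r @ tl r'")
    case True
    then have "length r - 1 < length s" using assms by (cases r) auto
    with True show ?thesis by (simp add: single_def)
  qed (auto simp: single_def)
  finally show "path_mult (single r c) (single r' d) s =
    (if last r = hd r' then single (r @ tl r') (c * d) else (\<lambda>_. 0)) s" .
qed

text \<open>Supports are finite, so an element is built by adding one scaled path at a time. The
  predicate \<open>Q\<close> passes knowledge about the support, such as the endpoints of its paths,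
  on to the step.\<close>

lemma carrier_induct [consumes 1, case_names zero single]:
  assumes "f \<in> carrier (path_algebra n)"
    and "P (\<lambda>_. 0)"
    and "\<And>f r c. f \<in> carrier (path_algebra n) \<Longrightarrow> is_path n r \<Longrightarrow> P f \<Longrightarrow> Q r
            \<Longrightarrow> P (\<lambda>s. single r c s + f s)"
    and "\<And>r. f r \<noteq> 0 \<Longrightarrow> Q r"
  shows "P f"
proof -
  have "finite {r. f r \<noteq> 0}" using assms(1) by (simp add: path_algebra_def)
  then show ?thesis using assms(1,4)
  proof (induction "{r. f r \<noteq> 0}" arbitrary: f rule: finite_induct)
    case empty
    then have "f = (\<lambda>_. 0)" by (auto simp: fun_eq_iff)
    then show ?case using assms(2) by simp
  next
    case (insert r F)
    let ?g = "f(r := 0)"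
    have F: "F = {s. ?g s \<noteq> 0}" using insert.hyps(2,4) by auto
    have g: "?g \<in> carrier (path_algebra n)"
      using insert.prems(1) insert.hyps(1) F by (auto simp: path_algebra_def split: if_splits)
    have "P ?g"
      by (rule insert.hyps(3)[OF F g]) (auto intro: insert.prems(2) split: if_splits)
    moreover have r: "f r \<noteq> 0" using insert.hyps(4) by auto
    ultimately have "P (\<lambda>s. single r (f r) s + ?g s)"
      using insert.prems(1) g
      by (intro assms(3) insert.prems(2)) (simp_all add: path_algebra_def del: fun_upd_apply)
    also have "(\<lambda>s. single r (f r) s + ?g s) = f" by (auto simp: single_def)
    finally show ?case .
  qed
qed

section \<open>A representation that detects paths\<close>

definition cyc :: "nat \<Rightarrow> nat \<Rightarrow> nat \<Rightarrow> bool" where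
  "cyc a b c \<longleftrightarrow> a < b \<and> b < c \<or> b < c \<and> c < a \<or> c < a \<and> a < b"

text \<open>The linear inequalities defining \<open>crosses\<close> depend on where the label 0
  sits; cyclic order does not, and it separates the two sides of [a,b].\<close>

lemma crosses_pair:
  "crosses {a, b} {c, d} \<longleftrightarrow> cyc a c b \<and> cyc b d a \<or> cyc a d b \<and> cyc b c a"
proof
  assume "crosses {a, b} {c, d}"
  then show "cyc a c b \<and> cyc b d a \<or> cyc a d b \<and> cyc b c a"
    by (auto simp: crosses_def cyc_def doubleton_eq_iff)
next
  have *: "crosses {i, j} {u, v}" "crosses {u, v} {i, j}" "crosses {j, i} {u, v}"
    "crosses {u, v} {j, i}" "crosses {i, j} {v, u}" "crosses {v, u} {i, j}"
    "crosses {j, i} {v, u}" "crosses {v, u} {j, i}"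
    if "i < u" "u < j" "j < v" for i u j v
    using that by (auto simp: crosses_def insert_commute)
  assume "cyc a c b \<and> cyc b d a \<or> cyc a d b \<and> cyc b c a"
  then show "crosses {a, b} {c, d}"
    unfolding cyc_def by (elim disjE conjE) (simp_all add: *)
qed

lemma crosses_commute: "crosses x y \<longleftrightarrow> crosses y x"
  unfolding crosses_def by blast

lemma segmentE:
  assumes "x \<in> segments n"
  obtains i j where "x = {i, j}" "i < n + 3" "j < n + 3" "i \<noteq> j"
  using assms by (auto simp: segments_def)

lemma pred_v_eq: "i < n + 3 \<Longrightarrow> pred_v n i = (if i = 0 then n + 2 else i - 1)"
proof (cases i)
  case (Suc m)
  assume "i < n + 3"
  then have "i + (n + 2) = m + (n + 3)" "m < n + 3" using Suc by auto
  then show ?thesis using Suc unfolding pred_v_def by (simp only: mod_add_self2) simp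
qed (simp add: pred_v_def)

lemma pred_v_less [simp]: "pred_v n i < n + 3"
  by (simp add: pred_v_def)

lemma boundary_pair:
  assumes "i < n + 3" "j < n + 3"
  shows "{i, j} \<in> boundary n \<longleftrightarrow> pred_v n i = j \<or> pred_v n j = i"
proof -
  have *: "(i + 1) mod (n + 3) = (if i = n + 2 then 0 else i + 1)" if "i < n + 3" for i
  proof (cases "i = n + 2")
    case True
    then have "i + 1 = n + 3" by simp
    then show ?thesis using True by (simp only: mod_self simp_thms if_True)
  next
    case False
    then have "i + 1 < n + 3" using that by simp
    then show ?thesis using False by (simp only: mod_less simp_thms if_False)
  qed
  show ?thesis
  proof
    assume "{i, j} \<in> boundary n"
    then obtain m where m: "m < n + 3" "{i, j} = {m, (m + 1) mod (n + 3)}"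
      by (auto simp: boundary_def)
    show "pred_v n i = j \<or> pred_v n j = i"
      using assms m unfolding *[OF m(1)]
      by (auto simp: pred_v_eq doubleton_eq_iff split: if_splits)
  next
    assume "pred_v n i = j \<or> pred_v n j = i"
    then have "j = (i + 1) mod (n + 3) \<or> i = (j + 1) mod (n + 3)"
      unfolding *[OF assms(1)] *[OF assms(2)]
      using assms by (auto simp: pred_v_eq split: if_splits)
    then show "{i, j} \<in> boundary n"
      using assms unfolding boundary_def by (auto simp: insert_commute)
  qed
qed

lemma segments_pair: "{i, j} \<in> segments n \<longleftrightarrow> i < n + 3 \<and> j < n + 3 \<and> i \<noteq> j"
  by (auto simp: segments_def doubleton_eq_iff)

lemma diagonals_pair: "{i, j} \<in> diagonals n \<longleftrightarrow>
    i < n + 3 \<and> j < n + 3 \<and> i \<noteq> j \<and> pred_v n i \<noteq> j \<and> pred_v n j \<noteq> i"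
  using boundary_pair[of i n j] by (auto simp: diagonals_def segments_pair)

lemma diagonalE:
  assumes "x \<in> diagonals n"
  obtains i j where "x = {i, j}" "i < n + 3" "j < n + 3" "i \<noteq> j"
    "pred_v n i \<noteq> j" "pred_v n j \<noteq> i"
  using assms by (auto simp: diagonals_def elim!: segmentE intro: that dest: diagonals_pair[THEN iffD1])
    (metis DiffI assms diagonals_pair)

lemma pred_v_neq: "i < n + 3 \<Longrightarrow> pred_v n i \<noteq> i"
  by (auto simp: pred_v_eq)

text \<open>Two neighbouring vertices have no vertex strictly between them on one side, so nothing
  crosses a boundary segment.\<close>

lemma crosses_imp_diagonal:
  assumes "crosses x y" "x \<in> segments n" "y \<in> segments n"
  shows "y \<in> diagonals n"
proof -
  obtain a b where x: "x = {a, b}" "a < n + 3" "b < n + 3" "a \<noteq> b"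
    using assms(2) by (rule segmentE)
  obtain c d where y: "y = {c, d}" "c < n + 3" "d < n + 3" "c \<noteq> d"
    using assms(3) by (rule segmentE)
  show ?thesis
    using assms(1) x y by (auto simp: crosses_pair diagonals_pair cyc_def pred_v_eq split: if_splits)
qed

lemma tau_inv_pair [simp]: "tau_inv n {i, j} = {pred_v n i, pred_v n j}"
  by (simp add: tau_inv_def)

lemma tau_inv_diagonal: "x \<in> diagonals n \<Longrightarrow> tau_inv n x \<in> diagonals n"
  by (erule diagonalE) (auto simp: diagonals_pair pred_v_eq split: if_splits)

lemma arrow_pair:
  assumes "{i, j} \<in> diagonals n" "{pred_v n i, j} \<in> diagonals n"
  shows "arrow n {i, j} {pred_v n i, j}"
  using assms unfolding arrow_def by (metis insert_commute)

lemma arrowE: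
  assumes "arrow n x y"
  obtains i j where "x = {i, j}" "y = {pred_v n i, j}"
    "{i, j} \<in> diagonals n" "{pred_v n i, j} \<in> diagonals n"
  using assms unfolding arrow_def by (metis insert_commute)

text \<open>Moving the endpoint that the first arrow left fixed completes the mesh.\<close>

lemma arrow_tau_inv:
  assumes "arrow n x y"
  shows "arrow n y (tau_inv n x)"
  using assms
proof (rule arrowE)
  fix i j
  assume *: "x = {i, j}" "y = {pred_v n i, j}"
    "{i, j} \<in> diagonals n" "{pred_v n i, j} \<in> diagonals n"
  then have "{pred_v n j, pred_v n i} \<in> diagonals n"
    using tau_inv_diagonal[of x n] by (simp add: insert_commute)
  then show ?thesis
    using * arrow_pair[of j "pred_v n i" n] by (simp add: insert_commute)
qed

lemma mesh_carrier:
  assumes "x \<in> diagonals n"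
  shows "(mesh n x :: seg list \<Rightarrow> 'k::field) \<in> carrier (path_algebra n)"
proof -
  have "{r. mesh n x r \<noteq> (0::'k)} \<subseteq> (\<lambda>y. [x, y, tau_inv n x]) ` diagonals n"
    by (auto simp: mesh_def arrow_def)
  then have "finite {r. mesh n x r \<noteq> (0::'k)}"
    by (rule finite_subset) (simp add: finite_diagonals)
  moreover have "is_path n [x, y, tau_inv n x]" if "arrow n x y" for y
    using that arrow_tau_inv[OF that]
    by (auto simp: is_path_def less_Suc_eq nth_Cons') (auto simp: arrow_def)
  ultimately show ?thesis
    by (auto simp: path_algebra_def mesh_def)
qed

lemma ideal_mesh_ideal: "ideal (mesh_ideal n) (path_algebra n :: (seg list \<Rightarrow> 'k::field) ring)"
  unfolding mesh_ideal_def
  by (rule ring.genideal_ideal[OF ring_path_algebra]) (auto intro: mesh_carrier)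

text \<open>The sign of the arrow that moves the endpoint \<open>i\<close> of \<open>[i,j]\<close>. It makes every mesh anticommute;
  moving across the label \<open>0\<close> interchanges the order of the endpoints, which forces the clause
  for \<open>i = 0\<close>.\<close>

definition move_sign :: "nat \<Rightarrow> nat \<Rightarrow> nat \<Rightarrow> 'k::field" where
  "move_sign n i j = (if i = 0 then (-1) ^ (j * (n + 3)) else if i < j then (-1) ^ j else 1)"

definition arrow_sign :: "nat \<Rightarrow> seg \<Rightarrow> seg \<Rightarrow> 'k::field" where
  "arrow_sign n x y = move_sign n (the_elem (x - y)) (the_elem (x \<inter> y))"

lemma arrow_sign_pair:
  assumes "{i, j} \<in> diagonals n"
  shows "arrow_sign n {i, j} {pred_v n i, j} = move_sign n i j"
proof -
  have "{i, j} - {pred_v n i, j} = {i}" "{i, j} \<inter> {pred_v n i, j} = {j}"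
    using assms pred_v_neq[of i n] by (auto simp: diagonals_pair)
  then show ?thesis by (simp add: arrow_sign_def)
qed

section \<open>Signs around a mesh and the weight of a path\<close>

lemma move_sign_mesh_less:
  assumes "{i, j} \<in> diagonals n" "i < j" "{pred_v n i, j} \<in> diagonals n" "{i, pred_v n j} \<in> diagonals n"
  shows "move_sign n i j * move_sign n j (pred_v n i) =
     - (move_sign n j i * move_sign n i (pred_v n j) :: 'k::field)"
proof -
  obtain m where j: "j = Suc m" using assms(2) by (cases j) auto
  have m: "pred_v n j = m" "i < m" "j < n + 3"
    using assms j by (auto simp: diagonals_pair pred_v_eq)
  show ?thesis
  proof (cases "i = 0")
    \<comment> \<open>The exponents to compare are j(n+3) + (n+2) and (j-1)(n+3) + 1; they differ by
      the even number 2n + 4.\<close>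
    case True
    then have "pred_v n i = n + 2" by (simp add: pred_v_eq)
    moreover from this have "j < n + 2"
      using assms(3) m(3) by (auto simp: diagonals_pair)
    ultimately show ?thesis
      using True m j by (simp add: move_sign_def power_add)
  next
    \<comment> \<open>Moving the larger endpoint has sign 1, but doing it first lowers the exponent
      attached to the smaller endpoint from j to j - 1.\<close>
    case False
    moreover have "i < n + 3" using m j by simp
    ultimately have "pred_v n i = i - 1" by (simp add: pred_v_eq)
    then show ?thesis
      using False m j by (simp add: move_sign_def)
  qed
qed

lemma move_sign_mesh:
  assumes "{i, j} \<in> diagonals n" "{pred_v n i, j} \<in> diagonals n" "{i, pred_v n j} \<in> diagonals n"
  shows "move_sign n i j * move_sign n j (pred_v n i) =
     - (move_sign n j i * move_sign n i (pred_v n j) :: 'k::field)"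
proof (cases "i < j")
  case True
  then show ?thesis using assms move_sign_mesh_less by blast
next
  case False
  then have "j < i" using assms by (auto simp: diagonals_pair)
  then show ?thesis
    using assms move_sign_mesh_less[of j i n, where 'k='k] by (simp add: insert_commute)
qed

text \<open>This is the scalar by which a path acts in the representation that has the ground field
  at every diagonal crossing g and 0 elsewhere, with each arrow inside acting by its sign.\<close>

fun weight :: "nat \<Rightarrow> seg \<Rightarrow> seg list \<Rightarrow> 'k::field" where
  "weight n g [] = 1"
| "weight n g [x] = of_bool (crosses g x)"
| "weight n g (x # y # r) = of_bool (crosses g x) * arrow_sign n x y * weight n g (y # r)"

lemma weight_hd:
  "r \<noteq> [] \<Longrightarrow> of_bool (crosses g (hd r)) * weight n g r = (weight n g r :: 'k::field)"
  by (cases "(n, g, r)" rule: weight.cases) auto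

lemma last_append_tl: "s \<noteq> [] \<Longrightarrow> last r = hd s \<Longrightarrow> last (r @ tl s) = last s"
  by (cases s) (simp_all add: last_append)

lemma weight_append:
  assumes "r \<noteq> []" "r' \<noteq> []" "last r = hd r'"
  shows "weight n g (r @ tl r') = weight n g r * (weight n g r' :: 'k::field)"
  using assms
proof (induction r rule: induct_list012)
  case (2 x)
  then have "r' = x # tl r'" by (cases r') auto
  then show ?case using weight_hd[of r' g n, where 'k='k] 2 by simp
qed (auto simp: mult.assoc)

text \<open>The signs are powers of -1, hence units in every characteristic.\<close>

lemma weight_nonzero:
  assumes "\<forall>z\<in>set r. crosses g z"
  shows "weight n g r \<noteq> (0 :: 'k::field)"
  using assms by (induction r rule: induct_list012) (auto simp: arrow_sign_def move_sign_def)

text \<open>The matrix entry between the positions y and z of the operator by which f acts in the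
  representation given by \<open>weight\<close>.\<close>

definition weight_sum :: "nat \<Rightarrow> seg \<Rightarrow> (seg list \<Rightarrow> 'k::field) \<Rightarrow> seg \<Rightarrow> seg \<Rightarrow> 'k" where
  "weight_sum n g f y z = (\<Sum>r | f r \<noteq> 0 \<and> hd r = y \<and> last r = z. f r * weight n g r)"

lemma weight_sum_superset:
  assumes "finite S" "{r. f r \<noteq> 0} \<subseteq> S"
  shows "weight_sum n g f y z = (\<Sum>r\<in>{r\<in>S. hd r = y \<and> last r = z}. f r * weight n g r)"
  unfolding weight_sum_def using assms by (intro sum.mono_neutral_left) auto

lemma weight_sum_add:
  assumes "f \<in> carrier (path_algebra n)" "h \<in> carrier (path_algebra n)"
  shows "weight_sum n g (\<lambda>r. f r + h r) y z = weight_sum n g f y z + weight_sum n g h y z"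
proof -
  let ?S = "{r. f r \<noteq> 0} \<union> {r. h r \<noteq> 0}"
  have "finite ?S" using assms by (auto simp: path_algebra_def)
  then show ?thesis
    by (subst (1 2 3) weight_sum_superset[of ?S])
      (auto simp: sum.distrib[symmetric] algebra_simps intro!: sum.cong)
qed

lemma weight_sum_zero [simp]: "weight_sum n g (\<lambda>_. 0) y z = 0"
  by (simp add: weight_sum_def)

lemma weight_sum_uminus: "weight_sum n g (\<lambda>r. - f r) y z = - weight_sum n g f y z"
  by (simp add: weight_sum_def sum_negf)

lemma weight_sum_single: "weight_sum n g (single r c) y z =
    (if hd r = y \<and> last r = z then c * weight n g r else 0)"
proof -
  have "{s \<in> {r}. hd s = y \<and> last s = z} = (if hd r = y \<and> last r = z then {r} else {})" by auto
  then show ?thesis by (subst weight_sum_superset[of "{r}"]) (auto simp: single_def)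
qed

text \<open>Matrix entries of a product: going along s first replaces the row at \<open>hd s\<close>
  by a multiple of the row of f at \<open>last s\<close>, because weights are
  multiplicative.\<close>

lemma weight_sum_single_mult:
  assumes "f \<in> carrier (path_algebra n)" "is_path n s"
  shows "weight_sum n g (path_mult (single s c) f) y z =
    (if hd s = y then c * weight n g s * weight_sum n g f (last s) z else 0)"
  using assms(1)
proof (induction rule: carrier_induct[where Q="\<lambda>_. True"])
  case (single f r d)
  have ne: "r \<noteq> []" "s \<noteq> []" using single assms by (auto simp: is_path_def)
  have hl: "hd (s @ tl r) = hd s" "last s = hd r \<Longrightarrow> last (s @ tl r) = last r"
    using ne by (simp_all add: last_append_tl)
  have "weight_sum n g (path_mult (single s c) (\<lambda>r'. single r d r' + f r')) y z =
     weight_sum n g (path_mult (single s c) (single r d)) y z +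
     weight_sum n g (path_mult (single s c) f) y z"
    using single assms unfolding path_mult_add_right
    by (intro weight_sum_add path_mult_carrier single_carrier)
  also have "weight_sum n g (path_mult (single s c) (single r d)) y z =
     (if hd s = y then c * weight n g s * weight_sum n g (single r d) (last s) z else 0)"
    using ne by (simp add: path_mult_single weight_sum_single hl weight_append)
  finally show ?case
    using single by (simp add: weight_sum_add single_carrier algebra_simps)
qed (auto simp: path_mult_def)

lemma weight_sum_mult_single:
  assumes "f \<in> carrier (path_algebra n)" "is_path n s"
  shows "weight_sum n g (path_mult f (single s c)) y z =
    (if last s = z then weight_sum n g f y (hd s) * (c * weight n g s) else 0)"
  using assms(1)
proof (induction rule: carrier_induct[where Q="\<lambda>_. True"])
  case (single f r d)
  have ne: "r \<noteq> []" "s \<noteq> []" using single assms by (auto simp: is_path_def)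
  have hl: "hd (r @ tl s) = hd r" "last r = hd s \<Longrightarrow> last (r @ tl s) = last s"
    using ne by (simp_all add: last_append_tl)
  have "weight_sum n g (path_mult (\<lambda>r'. single r d r' + f r') (single s c)) y z =
     weight_sum n g (path_mult (single r d) (single s c)) y z +
     weight_sum n g (path_mult f (single s c)) y z"
    using single assms unfolding path_mult_add_left
    by (intro weight_sum_add path_mult_carrier single_carrier)
  also have "weight_sum n g (path_mult (single r d) (single s c)) y z =
     (if last s = z then weight_sum n g (single r d) y (hd s) * (c * weight n g s) else 0)"
    using ne by (simp add: path_mult_single weight_sum_single hl weight_append)
  finally show ?case
    using single by (simp add: weight_sum_add single_carrier algebra_simps)
qed (auto simp: path_mult_def)

text \<open>This is the kernel of a representation. Closure under multiplication is checked for one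
  path at a time, where the product formulas for matrix entries apply.\<close>

lemma ideal_weight_kernel:
  "ideal {f \<in> carrier (path_algebra n). \<forall>y z. weight_sum n g f y z = 0}
     (path_algebra n :: (seg list \<Rightarrow> 'k::field) ring)" (is "ideal ?J ?A")
proof (rule idealI[OF ring_path_algebra])
  interpret ring ?A by (rule ring_path_algebra)
  have minus: "\<ominus>\<^bsub>?A\<^esub> f = (\<lambda>r. - f r)" "(\<lambda>r. - f r) \<in> carrier ?A" if "f \<in> carrier ?A" for f
  proof -
    show c: "(\<lambda>r. - f r) \<in> carrier ?A" using scale_carrier[OF that, of "-1"] by simp
    show "\<ominus>\<^bsub>?A\<^esub> f = (\<lambda>r. - f r)" using that c by (intro minus_equality) auto
  qed
  show "subgroup ?J (add_monoid ?A)"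
  proof (rule subgroup.intro)
    fix f assume "f \<in> ?J"
    then show "inv\<^bsub>add_monoid ?A\<^esub> f \<in> ?J"
      unfolding a_inv_def[symmetric] using minus[of f] by (simp add: weight_sum_uminus)
  next
    have "\<zero>\<^bsub>?A\<^esub> \<in> carrier ?A" by (rule zero_closed)
    then show "\<one>\<^bsub>add_monoid ?A\<^esub> \<in> ?J" by simp
  qed (auto simp: weight_sum_add add_carrier)
  fix f h assume f: "f \<in> ?J" and h: "h \<in> carrier ?A"
  have f': "f \<in> carrier ?A" using f by simp
  have "\<forall>y z. weight_sum n g (path_mult h f) y z = 0"
    using h
  proof (induction rule: carrier_induct[where Q="\<lambda>_. True"])
    case (single h r c)
    then show ?case using f
      by (simp add: path_mult_add_left weight_sum_add path_mult_carrier single_carrier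
          weight_sum_single_mult)
  qed (auto simp: path_mult_def)
  then show "h \<otimes>\<^bsub>?A\<^esub> f \<in> ?J" using f' h by (simp add: path_mult_carrier)
  have "\<forall>y z. weight_sum n g (path_mult f h) y z = 0"
    using h
  proof (induction rule: carrier_induct[where Q="\<lambda>_. True"])
    case (single h r c)
    then show ?case using f
      by (simp add: path_mult_add_right weight_sum_add path_mult_carrier single_carrier
          weight_sum_mult_single)
  qed (auto simp: path_mult_def)
  then show "f \<otimes>\<^bsub>?A\<^esub> h \<in> ?J" using f' h by (simp add: path_mult_carrier)
qed

text \<open>A middle position of the mesh may be a boundary segment, which is no object of the
  cluster category; the guards drop its summand.\<close>

lemma mesh_eq:
  assumes "{i, j} \<in> diagonals n"
  shows "mesh n {i, j} = (\<lambda>r.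
     (if {pred_v n i, j} \<in> diagonals n
      then single [{i, j}, {pred_v n i, j}, {pred_v n i, pred_v n j}] 1 r else 0) +
     (if {i, pred_v n j} \<in> diagonals n
      then single [{i, j}, {i, pred_v n j}, {pred_v n i, pred_v n j}] 1 r else 0))"
proof -
  have "{pred_v n i, j} \<noteq> {i, pred_v n j}"
    using assms pred_v_neq[of i n] by (auto simp: diagonals_pair doubleton_eq_iff)
  moreover have "arrow n {i, j} y \<longleftrightarrow> {pred_v n i, j} \<in> diagonals n \<and> y = {pred_v n i, j} \<or>
      {i, pred_v n j} \<in> diagonals n \<and> y = {i, pred_v n j}" for y
    using assms by (auto simp: arrow_def doubleton_eq_iff insert_commute)
  ultimately show ?thesis
    by (auto simp: mesh_def single_def fun_eq_iff)
qed

lemma cyc_pred_v: "i < n + 3 \<Longrightarrow> cyc a i b \<Longrightarrow> a < n + 3 \<Longrightarrow> b < n + 3 \<Longrightarrow> \<not> cyc b (pred_v n i) a"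
  by (cases "i = 0") (auto simp: cyc_def pred_v_eq)

text \<open>A single step cannot carry an endpoint across an endpoint of g to the other side. So
  each endpoint of [i,j] stays in its open arc, and mixing old and new endpoints still gives a
  segment crossing g.\<close>

lemma crosses_middle:
  assumes g: "g \<in> segments n" and x: "{i, j} \<in> diagonals n"
    and "crosses g {i, j}" "crosses g {pred_v n i, pred_v n j}"
  shows "crosses g {pred_v n i, j}" "crosses g {i, pred_v n j}"
proof -
  obtain a b where g: "g = {a, b}" "a < n + 3" "b < n + 3" using g by (rule segmentE)
  have ij: "i < n + 3" "j < n + 3" using x by (auto simp: diagonals_pair)
  show "crosses g {pred_v n i, j}" "crosses g {i, pred_v n j}"
    using assms(3,4) cyc_pred_v[OF ij(1) _ g(2,3)] cyc_pred_v[OF ij(1) _ g(3,2)]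
      cyc_pred_v[OF ij(2) _ g(2,3)] cyc_pred_v[OF ij(2) _ g(3,2)] unfolding g(1) crosses_pair by blast+
qed

lemma weight_sum_mesh:
  assumes g: "g \<in> segments n" and x: "x \<in> diagonals n"
  shows "weight_sum n g (mesh n x) y z = (0 :: 'k::field)"
proof -
  obtain i j where ij: "x = {i, j}" using x by (rule diagonalE)
  let ?t = "{pred_v n i, pred_v n j}"
  let ?P = "[x, {pred_v n i, j}, ?t]" and ?Q = "[x, {i, pred_v n j}, ?t]"
  have t: "?t \<in> diagonals n" using tau_inv_diagonal[OF x] ij by simp
  have path: "is_path n [x, u, ?t]" if "arrow n x u" for u
    using that arrow_tau_inv[OF that] x t ij
    by (auto simp: is_path_def less_Suc_eq nth_Cons') (auto simp: arrow_def)
  have paths: "{pred_v n i, j} \<in> diagonals n \<Longrightarrow> is_path n ?P"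
    "{i, pred_v n j} \<in> diagonals n \<Longrightarrow> is_path n ?Q"
    using path arrow_pair[of i j n] arrow_pair[of j i n] x ij by (simp_all add: insert_commute)
  have c: "(\<lambda>r. if P then single s 1 r else (0::'k)) \<in> carrier (path_algebra n)"
    if "P \<Longrightarrow> is_path n s" for P s
    using single_carrier[of n s "1::'k"] that scale_carrier[OF one_carrier, of "0::'k" n]
    by (cases P) auto
  have ws: "weight_sum n g (\<lambda>r. if P then single s 1 r else (0::'k)) y z =
      (if P \<and> hd s = y \<and> last s = z then weight n g s else 0)" for P s
    by (cases P) (simp_all add: weight_sum_single)
  have "weight_sum n g (mesh n x) y z =
      weight_sum n g (\<lambda>r. if {pred_v n i, j} \<in> diagonals n then single ?P 1 r else (0::'k)) y z +
      weight_sum n g (\<lambda>r. if {i, pred_v n j} \<in> diagonals n then single ?Q 1 r else (0::'k)) y z"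
    unfolding ij mesh_eq[OF x[unfolded ij]]
    by (rule weight_sum_add; rule c; use paths ij in simp)
  then have sum: "weight_sum n g (mesh n x) y z =
      (if {pred_v n i, j} \<in> diagonals n \<and> x = y \<and> ?t = z then weight n g ?P else 0) +
      (if {i, pred_v n j} \<in> diagonals n \<and> x = y \<and> ?t = z then weight n g ?Q else (0::'k))"
    by (simp add: ws)
  \<comment> \<open>The two legs have common ends, so an end not crossing g makes both weights
    vanish.\<close>
  show ?thesis
  proof (cases "crosses g x \<and> crosses g ?t")
    case False
    then show ?thesis unfolding sum by auto
  next
    case True
    have mid: "crosses g {pred_v n i, j}" "crosses g {i, pred_v n j}"
      using crosses_middle[OF g, of i j] True x ij by auto
    have "{pred_v n i, j} \<in> segments n" "{i, pred_v n j} \<in> segments n"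
      using x ij by (auto simp: segments_pair diagonals_pair)
    \<comment> \<open>A mesh whose ends both cross g has both of its legs, so the two weights can
      cancel and no single summand is left over.\<close>
    then have dg: "{pred_v n i, j} \<in> diagonals n" "{i, pred_v n j} \<in> diagonals n"
      using crosses_imp_diagonal[OF _ g] mid by auto
    have s: "arrow_sign n x {pred_v n i, j} = (move_sign n i j :: 'k)"
      "arrow_sign n {pred_v n i, j} ?t = (move_sign n j (pred_v n i) :: 'k)"
      "arrow_sign n x {i, pred_v n j} = (move_sign n j i :: 'k)"
      "arrow_sign n {i, pred_v n j} ?t = (move_sign n i (pred_v n j) :: 'k)"
      using arrow_sign_pair[of i j n] arrow_sign_pair[of j "pred_v n i" n]
        arrow_sign_pair[of j i n] arrow_sign_pair[of i "pred_v n j" n] dg x ij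
      by (auto simp: insert_commute)
    have "weight n g ?P + weight n g ?Q = (0 :: 'k)"
      using mid True move_sign_mesh[OF x[unfolded ij] dg, where 'k='k] by (simp add: s)
    then show ?thesis unfolding sum using dg by auto
  qed
qed

text \<open>The kernel of the representation contains the meshes and hence the ideal generated by
  them, while a path whose vertices all cross g acts by a sign.\<close>

lemma path_not_in_mesh_ideal:
  assumes "g \<in> segments n" "r \<noteq> []" "\<forall>z\<in>set r. crosses g z"
  shows "single r (1::'k::field) \<notin> mesh_ideal n"
proof
  assume *: "single r (1::'k) \<in> mesh_ideal n"
  have "mesh_ideal n \<subseteq> {f \<in> carrier (path_algebra n). \<forall>y z. weight_sum n g f y z = (0::'k)}"
    unfolding mesh_ideal_def
    by (rule ring.genideal_minimal[OF ring_path_algebra ideal_weight_kernel])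
      (auto simp: mesh_carrier weight_sum_mesh assms)
  then have "weight_sum n g (single r (1::'k)) (hd r) (last r) = 0" using * by blast
  then show False using weight_nonzero[OF assms(3), of n, where 'k='k] by (simp add: weight_sum_single)
qed

section \<open>The mesh algebra\<close>

definition cls :: "nat \<Rightarrow> (seg list \<Rightarrow> 'k::field) \<Rightarrow> (seg list \<Rightarrow> 'k) set" where
  "cls n f = mesh_ideal n +>\<^bsub>path_algebra n\<^esub> f"

lemma ring_mesh_algebra: "ring (mesh_algebra n :: (seg list \<Rightarrow> 'k::field) set ring)"
  unfolding mesh_algebra_def by (rule ideal.quotient_is_ring[OF ideal_mesh_ideal])

lemma cls_hom: "cls n \<in> ring_hom (path_algebra n) (mesh_algebra n :: (seg list \<Rightarrow> 'k::field) set ring)"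
  using ideal.rcos_ring_hom[OF ideal_mesh_ideal, of n]
  unfolding mesh_algebra_def cls_def[abs_def] by simp

lemma carrier_mesh_algebra: "carrier (mesh_algebra n) = cls n ` carrier (path_algebra n)"
  by (auto simp: mesh_algebra_def FactRing_def A_RCOSETS_def' cls_def)

lemma cls_carrier: "f \<in> carrier (path_algebra n) \<Longrightarrow> cls n f \<in> carrier (mesh_algebra n)"
  by (simp add: carrier_mesh_algebra)

lemma cls_mult:
  "f \<in> carrier (path_algebra n) \<Longrightarrow> g \<in> carrier (path_algebra n) \<Longrightarrow>
    cls n f \<otimes>\<^bsub>mesh_algebra n\<^esub> cls n g = cls n (path_mult f g)"
  using ring_hom_mult[OF cls_hom, of f n g] by simp

lemma cls_add:
  "f \<in> carrier (path_algebra n) \<Longrightarrow> g \<in> carrier (path_algebra n) \<Longrightarrow>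
    cls n f \<oplus>\<^bsub>mesh_algebra n\<^esub> cls n g = cls n (\<lambda>r. f r + g r)"
  using ring_hom_add[OF cls_hom, of f n g] by simp

lemma zero_carrier: "(\<lambda>_. 0) \<in> carrier (path_algebra n)"
  by (simp add: path_algebra_def)

lemma cls_zero: "cls n (\<lambda>_. 0 :: 'k::field) = \<zero>\<^bsub>mesh_algebra n\<^esub>"
  using ring_hom_zero[OF cls_hom[where 'k='k] ring_path_algebra ring_mesh_algebra] by simp

lemma cls_eq_zero:
  assumes "f \<in> carrier (path_algebra n)"
  shows "cls n f = \<zero>\<^bsub>mesh_algebra n\<^esub> \<longleftrightarrow> f \<in> mesh_ideal n"
proof -
  interpret ideal "mesh_ideal n" "path_algebra n :: (seg list \<Rightarrow> 'a) ring"
    by (rule ideal_mesh_ideal)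
  have "\<zero>\<^bsub>mesh_algebra n\<^esub> = mesh_ideal n"
    by (simp add: mesh_algebra_def FactRing_def)
  then show ?thesis
    using a_rcos_const[of f] a_rcos_self[OF assms] by (auto simp: cls_def)
qed

text \<open>The mesh algebra is given as a ring only, so scalars act through the multiples of its
  unit.\<close>

definition smul :: "nat \<Rightarrow> 'k::field \<Rightarrow> (seg list \<Rightarrow> 'k) set \<Rightarrow> (seg list \<Rightarrow> 'k) set" where
  "smul n c u = cls n (\<lambda>r. c * \<one>\<^bsub>path_algebra n\<^esub> r) \<otimes>\<^bsub>mesh_algebra n\<^esub> u"

lemma smul_cls:
  assumes "f \<in> carrier (path_algebra n)"
  shows "smul n c (cls n f) = cls n (\<lambda>r. c * f r)"
  unfolding smul_def
  by (subst cls_mult) (simp_all add: assms scale_carrier one_carrier path_mult_scale_left one_path_mult)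

lemma mesh_carrierE:
  assumes "u \<in> carrier (mesh_algebra n)"
  obtains f where "u = cls n f" "f \<in> carrier (path_algebra n)"
  using assms by (auto simp: carrier_mesh_algebra)

lemma smul_carrier: "u \<in> carrier (mesh_algebra n) \<Longrightarrow> smul n c u \<in> carrier (mesh_algebra n)"
  by (erule mesh_carrierE) (simp add: smul_cls cls_carrier scale_carrier)

lemma smul_smul: "u \<in> carrier (mesh_algebra n) \<Longrightarrow> smul n c (smul n d u) = smul n (c * d) u"
  by (erule mesh_carrierE) (simp add: smul_cls scale_carrier mult.assoc)

lemma smul_1: "u \<in> carrier (mesh_algebra n) \<Longrightarrow> smul n 1 u = u"
  by (erule mesh_carrierE) (simp add: smul_cls)

lemma smul_0: "u \<in> carrier (mesh_algebra n) \<Longrightarrow> smul n 0 u = \<zero>\<^bsub>mesh_algebra n\<^esub>"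
  by (erule mesh_carrierE) (simp add: smul_cls cls_zero)

lemma smul_zero: "smul n c \<zero>\<^bsub>mesh_algebra n\<^esub> = \<zero>\<^bsub>mesh_algebra n\<^esub>"
  using smul_cls[OF zero_carrier, of n c] by (simp add: cls_zero)

lemma smul_add_left:
  "u \<in> carrier (mesh_algebra n) \<Longrightarrow> smul n c u \<oplus>\<^bsub>mesh_algebra n\<^esub> smul n d u = smul n (c + d) u"
  by (erule mesh_carrierE) (simp add: smul_cls cls_add scale_carrier algebra_simps)

lemma smul_mult_left:
  "u \<in> carrier (mesh_algebra n) \<Longrightarrow> v \<in> carrier (mesh_algebra n) \<Longrightarrow>
    smul n c u \<otimes>\<^bsub>mesh_algebra n\<^esub> v = smul n c (u \<otimes>\<^bsub>mesh_algebra n\<^esub> v)"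
  by (erule mesh_carrierE, erule mesh_carrierE)
    (simp add: smul_cls cls_mult scale_carrier path_mult_carrier path_mult_scale_left)

lemma path_mult_scale_right: "path_mult f (\<lambda>r. c * g r) = (\<lambda>r. c * path_mult f g r)"
  by (auto simp: path_mult_def sum_distrib_left algebra_simps)

lemma smul_mult_right:
  "u \<in> carrier (mesh_algebra n) \<Longrightarrow> v \<in> carrier (mesh_algebra n) \<Longrightarrow>
    u \<otimes>\<^bsub>mesh_algebra n\<^esub> smul n c v = smul n c (u \<otimes>\<^bsub>mesh_algebra n\<^esub> v)"
  by (erule mesh_carrierE, erule mesh_carrierE)
    (simp add: smul_cls cls_mult scale_carrier path_mult_carrier path_mult_scale_right)

text \<open>This converts the mesh relation, which says that a sum is zero, into an equation that
  can be used for rewriting.\<close>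

lemma smul_minus_one:
  fixes u :: "(seg list \<Rightarrow> 'k::field) set"
  assumes "u \<in> carrier (mesh_algebra n)" "v \<in> carrier (mesh_algebra n)"
    "u \<oplus>\<^bsub>mesh_algebra n\<^esub> v = \<zero>\<^bsub>mesh_algebra n\<^esub>"
  shows "u = smul n (-1) v"
proof -
  interpret ring "mesh_algebra n :: (seg list \<Rightarrow> 'k) set ring" by (rule ring_mesh_algebra)
  have "smul n (-1) v \<oplus>\<^bsub>mesh_algebra n\<^esub> smul n 1 v = \<zero>\<^bsub>mesh_algebra n\<^esub>"
    using assms(2) by (simp only: smul_add_left smul_0 add.left_inverse)
  then have "smul n (-1) v = \<ominus>\<^bsub>mesh_algebra n\<^esub> v"
    using assms(2) by (intro minus_equality[symmetric]) (simp_all add: smul_1 smul_carrier)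
  moreover have "u = \<ominus>\<^bsub>mesh_algebra n\<^esub> v"
    using assms by (intro minus_equality[symmetric]) simp_all
  ultimately show ?thesis by simp
qed

section \<open>Idempotents and arrows in the mesh algebra\<close>

definition idem :: "nat \<Rightarrow> seg \<Rightarrow> (seg list \<Rightarrow> 'k::field) set" where
  "idem n x = cls n (single [x] 1)"

text \<open>The value is zero where there is no arrow. A mesh with a missing leg then obeys the same
  equation as a full one.\<close>

definition arr :: "nat \<Rightarrow> seg \<Rightarrow> seg \<Rightarrow> (seg list \<Rightarrow> 'k::field) set" where
  "arr n x y = cls n (if arrow n x y then single [x, y] 1 else (\<lambda>_. 0))"

lemma is_path_singleton: "x \<in> diagonals n \<Longrightarrow> is_path n [x]"
  by (simp add: is_path_def)

lemma is_path_pair: "arrow n x y \<Longrightarrow> is_path n [x, y]"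
  by (auto simp: is_path_def) (auto simp: arrow_def)

lemma arr_carrier: "arr n x y \<in> carrier (mesh_algebra n)"
  by (auto simp: arr_def intro!: cls_carrier single_carrier is_path_pair zero_carrier)

lemma idem_carrier: "x \<in> diagonals n \<Longrightarrow> idem n x \<in> carrier (mesh_algebra n)"
  by (auto simp: idem_def intro!: cls_carrier single_carrier is_path_singleton)

lemma arr_eq_zero: "y \<notin> diagonals n \<Longrightarrow> arr n x y = \<zero>\<^bsub>mesh_algebra n\<^esub>"
  by (simp add: arr_def arrow_def cls_zero)

lemma is_path_snoc:
  assumes "r \<noteq> []"
  shows "is_path n (r @ [z]) \<longleftrightarrow> is_path n r \<and> arrow n (last r) z"
proof
  assume *: "is_path n (r @ [z])"
  then have "arrow n ((r @ [z]) ! (length r - 1)) ((r @ [z]) ! Suc (length r - 1))"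
    unfolding is_path_def using assms by (metis Suc_pred' length_append_singleton length_greater_0_conv lessI)
  then have "arrow n (last r) z"
    using assms by (simp add: nth_append last_conv_nth)
  moreover have "arrow n (r ! m) (r ! Suc m)" if "Suc m < length r" for m
    using * that unfolding is_path_def
    by (metis Suc_lessD length_append_singleton less_SucI nth_append)
  ultimately show "is_path n r \<and> arrow n (last r) z"
    using * assms by (auto simp: is_path_def)
next
  assume "is_path n r \<and> arrow n (last r) z"
  then show "is_path n (r @ [z])"
    using is_path_append[of n r "[last r, z]"] is_path_pair by auto
qed

lemma cls_snoc:
  assumes "is_path n (r @ [z])" "r \<noteq> []"
  shows "cls n (single (r @ [z]) c) = cls n (single r c) \<otimes>\<^bsub>mesh_algebra n\<^esub> arr n (last r) z"
proof -
  have *: "is_path n r" "arrow n (last r) z" using assms by (simp_all add: is_path_snoc)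
  then show ?thesis
    using assms(2) by (simp add: arr_def cls_mult single_carrier is_path_pair path_mult_single)
qed

lemma arr_mult_arr:
  assumes "x \<in> diagonals n" "y \<in> diagonals n \<Longrightarrow> arrow n x y \<and> arrow n y z"
  shows "arr n x y \<otimes>\<^bsub>mesh_algebra n\<^esub> arr n y z =
    cls n (\<lambda>r. if y \<in> diagonals n then single [x, y, z] 1 r else 0)"
proof (cases "y \<in> diagonals n")
  case True
  then show ?thesis
    using assms by (simp add: arr_def cls_mult single_carrier is_path_pair path_mult_single)
next
  case False
  have "arr n x y \<otimes>\<^bsub>mesh_algebra n\<^esub> arr n y z = \<zero>\<^bsub>mesh_algebra n\<^esub>"
    using False by (simp add: arr_eq_zero ring.ring_simprules(24)[OF ring_mesh_algebra] arr_carrier)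
  then show ?thesis using False by (simp add: cls_zero)
qed

text \<open>The class of the mesh is zero, so its two legs are negatives of each other. If a leg
  passes through a boundary segment it is zero, and the equation says that the other leg is zero as
  well.\<close>

lemma arr_mesh:
  assumes "{i, j} \<in> diagonals n"
  shows "arr n {i, j} {pred_v n i, j} \<otimes>\<^bsub>mesh_algebra n\<^esub> arr n {pred_v n i, j} {pred_v n i, pred_v n j}
    = smul n (-1) (arr n {i, j} {i, pred_v n j} \<otimes>\<^bsub>mesh_algebra n\<^esub>
                   arr n {i, pred_v n j} {pred_v n i, pred_v n j} :: (seg list \<Rightarrow> 'k::field) set)"
proof (rule smul_minus_one)
  interpret ring "mesh_algebra n :: (seg list \<Rightarrow> 'k) set ring" by (rule ring_mesh_algebra)
  have a: "{pred_v n i, j} \<in> diagonals n \<Longrightarrow> arrow n {i, j} {pred_v n i, j} \<and>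
        arrow n {pred_v n i, j} {pred_v n i, pred_v n j}"
      "{i, pred_v n j} \<in> diagonals n \<Longrightarrow> arrow n {i, j} {i, pred_v n j} \<and>
        arrow n {i, pred_v n j} {pred_v n i, pred_v n j}"
    using arrow_pair[OF assms] arrow_pair[of j i n] arrow_tau_inv[of n "{i, j}"] assms
    by (simp_all add: insert_commute)
  have c: "(\<lambda>r. if y \<in> diagonals n then single [{i, j}, y, z] 1 r else (0::'k))
      \<in> carrier (path_algebra n)"
    if "y \<in> diagonals n \<Longrightarrow> arrow n {i, j} y \<and> arrow n y z" for y z
    using that is_path_snoc[of "[{i, j}, y]" n z] is_path_pair[of n "{i, j}" y]
    by (cases "y \<in> diagonals n") (auto intro: single_carrier zero_carrier)
  have "mesh n {i, j} \<in> (mesh_ideal n :: (seg list \<Rightarrow> 'k) set)"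
    unfolding mesh_ideal_def
    by (rule subsetD[OF ring.genideal_self[OF ring_path_algebra]]) (auto simp: mesh_carrier assms)
  then have "cls n (mesh n {i, j} :: seg list \<Rightarrow> 'k) = \<zero>\<^bsub>mesh_algebra n\<^esub>"
    using mesh_carrier[OF assms, where 'k='k] by (simp add: cls_eq_zero)
  then show "arr n {i, j} {pred_v n i, j} \<otimes>\<^bsub>mesh_algebra n\<^esub>
        arr n {pred_v n i, j} {pred_v n i, pred_v n j} \<oplus>\<^bsub>mesh_algebra n\<^esub>
      arr n {i, j} {i, pred_v n j} \<otimes>\<^bsub>mesh_algebra n\<^esub>
        arr n {i, pred_v n j} {pred_v n i, pred_v n j} = (\<zero>\<^bsub>mesh_algebra n\<^esub> :: (seg list \<Rightarrow> 'k) set)"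
    using a by (simp add: arr_mult_arr assms cls_add c mesh_eq)
qed (auto intro!: monoid.m_closed[OF ring.is_monoid[OF ring_mesh_algebra]] arr_carrier)

section \<open>Morphisms out of a fixed diagonal\<close>

lemma cw_eq: "i < n + 3 \<Longrightarrow> j < n + 3 \<Longrightarrow> cw n i j = (if i \<le> j then j - i else j + (n + 3) - i)"
proof (cases "i \<le> j")
  case True
  assume "j < n + 3"
  moreover have "j + (n + 3) - i = (j - i) + (n + 3)" using True by simp
  ultimately show ?thesis using True by (simp only: cw_def mod_add_self2) simp
next
  case False
  assume "i < n + 3"
  then have "j + (n + 3) - i < n + 3" using False by simp
  then show ?thesis using False by (simp only: cw_def mod_less if_False)
qed

lemma funpow_pred_v:
  assumes "i < n + 3" "m < n + 3"
  shows "(pred_v n ^^ m) i = (if m \<le> i then i - m else i + (n + 3) - m)"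
  using assms(2)
proof (induction m)
  case (Suc m)
  then have "(pred_v n ^^ m) i = (if m \<le> i then i - m else i + (n + 3) - m)"
      "(if m \<le> i then i - m else i + (n + 3) - m) < n + 3"
    using assms(1) by auto
  then show ?case using assms(1) Suc.prems by (auto simp: pred_v_eq)
qed simp

lemma funpow_pred_v_less [simp]: "i < n + 3 \<Longrightarrow> (pred_v n ^^ m) i < n + 3"
  by (cases m) simp_all

lemma funpow_pred_v_inj:
  assumes "i < n + 3" "s < n + 3" "t < n + 3" "(pred_v n ^^ s) i = (pred_v n ^^ t) i"
  shows "s = t"
  using assms by (auto simp: funpow_pred_v split: if_splits)

lemma funpow_pred_v_cw:
  assumes "a < n + 3" "b < n + 3"
  shows "(pred_v n ^^ cw n a b) b = a"
  using assms by (subst funpow_pred_v) (auto simp: cw_eq)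

lemma cyc_funpow_pred_v:
  assumes "a < n + 3" "b < n + 3" "Suc s < cw n a b"
  shows "cyc a ((pred_v n ^^ Suc s) b) b"
  using assms by (subst funpow_pred_v) (auto simp: cw_eq cyc_def split: if_splits)

lemma cyc_funpow_pred_vE:
  assumes "cyc a i b" "a < n + 3" "b < n + 3" "i < n + 3"
  obtains s where "Suc s < cw n a b" "i = (pred_v n ^^ Suc s) b"
proof -
  have "0 < cw n i b" "cw n i b < cw n a b"
    using assms by (auto simp: cw_eq cyc_def split: if_splits)
  then show ?thesis
    using that[of "cw n i b - 1"] funpow_pred_v_cw[of i n b] assms by simp
qed

lemma cw_less: "cw n a b < n + 3"
  by (simp add: cw_def)

lemma cw_diagonal:
  assumes "{a, b} \<in> diagonals n"
  shows "1 < cw n a b" "1 < cw n b a"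
  using assms by (auto simp: diagonals_pair cw_eq pred_v_eq split: if_splits)

text \<open>Coordinates on the rectangle of diagonals crossing [a,b]. The corner (0,0) is the
  position of the projective, and \<open>Suc s < cw n a b\<close> and
  \<open>Suc t < cw n b a\<close> keep the two endpoints strictly inside their arcs.\<close>

definition vtx :: "nat \<Rightarrow> nat \<Rightarrow> nat \<Rightarrow> nat \<Rightarrow> nat \<Rightarrow> seg" where
  "vtx n a b s t = {(pred_v n ^^ Suc s) b, (pred_v n ^^ Suc t) a}"

lemma vtx_0_0: "vtx n a b 0 0 = tau_inv n {a, b}"
  by (simp add: vtx_def insert_commute)

lemma crosses_vtx:
  assumes "a < n + 3" "b < n + 3" "Suc s < cw n a b" "Suc t < cw n b a"
  shows "crosses {a, b} (vtx n a b s t)"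
  using cyc_funpow_pred_v[OF assms(1-3)] cyc_funpow_pred_v[OF assms(2,1,4)]
  unfolding vtx_def crosses_pair by blast

lemma vtx_diagonal:
  assumes "{a, b} \<in> diagonals n" "Suc s < cw n a b" "Suc t < cw n b a"
  shows "vtx n a b s t \<in> diagonals n"
proof -
  have ab: "a < n + 3" "b < n + 3" using assms(1) by (auto simp: diagonals_pair)
  have "vtx n a b s t \<in> segments n"
    using cyc_funpow_pred_v[OF ab assms(2)] cyc_funpow_pred_v[OF ab(2,1) assms(3)] ab
    by (auto simp: vtx_def segments_pair cyc_def simp del: funpow.simps)
  then show ?thesis
    using crosses_imp_diagonal[OF crosses_vtx[OF ab assms(2,3)]] assms(1)
    by (auto simp: diagonals_def)
qed

lemma crosses_vtxE:
  assumes "{a, b} \<in> diagonals n" "y \<in> segments n" "crosses {a, b} y"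
  obtains s t where "Suc s < cw n a b" "Suc t < cw n b a" "y = vtx n a b s t"
proof -
  have ab: "a < n + 3" "b < n + 3" using assms(1) by (auto simp: diagonals_pair)
  obtain i j where y: "y = {i, j}" "i < n + 3" "j < n + 3"
    using assms(2) by (rule segmentE)
  note result = that
  have *: thesis if ij: "cyc a i b" "cyc b j a" "y = {i, j}" "i < n + 3" "j < n + 3" for i j
  proof -
    obtain s where "Suc s < cw n a b" "i = (pred_v n ^^ Suc s) b"
      using cyc_funpow_pred_vE[OF ij(1) ab ij(4)] .
    moreover obtain t where "Suc t < cw n b a" "j = (pred_v n ^^ Suc t) a"
      using cyc_funpow_pred_vE[OF ij(2) ab(2,1) ij(5)] .
    ultimately show thesis using result[of s t] ij(3) by (simp add: vtx_def)
  qed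
  show ?thesis
    using assms(3) *[of i j] *[of j i] y unfolding y(1) crosses_pair by (auto simp: insert_commute)
qed

text \<open>The endpoints lie in disjoint open arcs and cannot be confused, and fewer than n + 3
  backward steps are determined by where they end.\<close>

lemma vtx_inj:
  assumes "{a, b} \<in> diagonals n" "Suc s < cw n a b" "Suc t < cw n b a"
    "Suc s' < cw n a b" "Suc t' < cw n b a" "vtx n a b s t = vtx n a b s' t'"
  shows "s = s' \<and> t = t'"
proof -
  have ab: "a < n + 3" "b < n + 3" using assms(1) by (auto simp: diagonals_pair)
  have "\<not> (cyc a i b \<and> cyc b i a)" for i by (auto simp: cyc_def)
  then have "(pred_v n ^^ Suc s) b = (pred_v n ^^ Suc s') b"
      "(pred_v n ^^ Suc t) a = (pred_v n ^^ Suc t') a"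
    using assms(6) cyc_funpow_pred_v[OF ab assms(2)] cyc_funpow_pred_v[OF ab(2,1) assms(3)]
     cyc_funpow_pred_v[OF ab assms(4)] cyc_funpow_pred_v[OF ab(2,1) assms(5)]
    unfolding vtx_def doubleton_eq_iff by metis+
  then show ?thesis
    using funpow_pred_v_inj[OF ab(2), of "Suc s" "Suc s'"] funpow_pred_v_inj[OF ab(1), of "Suc t" "Suc t'"]
      assms(2-5) cw_less[of n a b] cw_less[of n b a] by (auto simp del: funpow.simps)
qed

text \<open>The normal form for paths out of the projective: every s-step precedes every t-step.
  Steps out of the rectangle are allowed, and the class is shown to vanish there.\<close>

fun grid :: "nat \<Rightarrow> nat \<Rightarrow> nat \<Rightarrow> nat \<Rightarrow> nat \<Rightarrow> (seg list \<Rightarrow> 'k::field) set" where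
  "grid n a b 0 0 = idem n (vtx n a b 0 0)"
| "grid n a b (Suc s) 0 =
     grid n a b s 0 \<otimes>\<^bsub>mesh_algebra n\<^esub> arr n (vtx n a b s 0) (vtx n a b (Suc s) 0)"
| "grid n a b s (Suc t) =
     grid n a b s t \<otimes>\<^bsub>mesh_algebra n\<^esub> arr n (vtx n a b s t) (vtx n a b s (Suc t))"

lemma vtx_Suc_s: "vtx n a b (Suc s) t = {pred_v n ((pred_v n ^^ Suc s) b), (pred_v n ^^ Suc t) a}"
  and vtx_Suc_t: "vtx n a b s (Suc t) = {(pred_v n ^^ Suc s) b, pred_v n ((pred_v n ^^ Suc t) a)}"
  by (simp_all add: vtx_def)

lemma mesh_algebra_m_closed:
  "u \<in> carrier (mesh_algebra n) \<Longrightarrow> v \<in> carrier (mesh_algebra n) \<Longrightarrow>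
    u \<otimes>\<^bsub>mesh_algebra n\<^esub> v \<in> carrier (mesh_algebra n)"
  by (rule monoid.m_closed[OF ring.is_monoid[OF ring_mesh_algebra]])

lemma mesh_algebra_m_assoc:
  "u \<in> carrier (mesh_algebra n) \<Longrightarrow> v \<in> carrier (mesh_algebra n) \<Longrightarrow> w \<in> carrier (mesh_algebra n) \<Longrightarrow>
    u \<otimes>\<^bsub>mesh_algebra n\<^esub> v \<otimes>\<^bsub>mesh_algebra n\<^esub> w =
    u \<otimes>\<^bsub>mesh_algebra n\<^esub> (v \<otimes>\<^bsub>mesh_algebra n\<^esub> w)"
  by (rule monoid.m_assoc[OF ring.is_monoid[OF ring_mesh_algebra]])

lemma mesh_algebra_null [simp]:
  fixes u :: "(seg list \<Rightarrow> 'k::field) set"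
  shows "u \<in> carrier (mesh_algebra n) \<Longrightarrow> u \<otimes>\<^bsub>mesh_algebra n\<^esub> \<zero>\<^bsub>mesh_algebra n\<^esub> = \<zero>\<^bsub>mesh_algebra n\<^esub>"
  "u \<in> carrier (mesh_algebra n) \<Longrightarrow> \<zero>\<^bsub>mesh_algebra n\<^esub> \<otimes>\<^bsub>mesh_algebra n\<^esub> u = \<zero>\<^bsub>mesh_algebra n\<^esub>"
proof -
  interpret ring "mesh_algebra n :: (seg list \<Rightarrow> 'k) set ring" by (rule ring_mesh_algebra)
  assume "u \<in> carrier (mesh_algebra n)"
  then show "u \<otimes>\<^bsub>mesh_algebra n\<^esub> \<zero>\<^bsub>mesh_algebra n\<^esub> = \<zero>\<^bsub>mesh_algebra n\<^esub>"
    "\<zero>\<^bsub>mesh_algebra n\<^esub> \<otimes>\<^bsub>mesh_algebra n\<^esub> u = \<zero>\<^bsub>mesh_algebra n\<^esub>" by simp_all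
qed

section \<open>Reduction of paths to normal form\<close>

context
  fixes n a b :: nat
  assumes ab: "{a, b} \<in> diagonals n"
begin

lemma ab_less: "a < n + 3" "b < n + 3"
  using ab by (auto simp: diagonals_pair)

lemma grid_carrier: "grid n a b s t \<in> carrier (mesh_algebra n)"
proof (induction t)
  case 0
  show ?case
    by (induction s)
      (simp_all add: vtx_0_0 mesh_algebra_m_closed arr_carrier idem_carrier tau_inv_diagonal ab
        del: tau_inv_pair)
qed (simp add: mesh_algebra_m_closed arr_carrier)

lemma mesh_vtx:
  assumes "Suc s < cw n a b" "Suc t < cw n b a"
  shows "arr n (vtx n a b s t) (vtx n a b (Suc s) t) \<otimes>\<^bsub>mesh_algebra n\<^esub>
      arr n (vtx n a b (Suc s) t) (vtx n a b (Suc s) (Suc t)) =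
    smul n (-1) (arr n (vtx n a b s t) (vtx n a b s (Suc t)) \<otimes>\<^bsub>mesh_algebra n\<^esub>
      arr n (vtx n a b s (Suc t)) (vtx n a b (Suc s) (Suc t)))"
  using arr_mesh[of "(pred_v n ^^ Suc s) b" "(pred_v n ^^ Suc t) a" n] vtx_diagonal[OF ab assms]
  by (simp add: vtx_def)

text \<open>An s-step appended to the normal form has to be moved in front of t many t-steps, and
  each exchange by a mesh relation contributes a factor -1.\<close>

lemma grid_Suc:
  assumes "Suc s < cw n a b" "Suc t < cw n b a"
  shows "grid n a b s t \<otimes>\<^bsub>mesh_algebra n\<^esub> arr n (vtx n a b s t) (vtx n a b (Suc s) t) =
    smul n ((-1) ^ t) (grid n a b (Suc s) t :: (seg list \<Rightarrow> 'k::field) set)"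
  using assms(2)
proof (induction t)
  case 0
  show ?case by (simp add: smul_1 grid_carrier arr_carrier mesh_algebra_m_closed)
next
  case (Suc t)
  let ?g = "grid n a b :: _ \<Rightarrow> _ \<Rightarrow> (seg list \<Rightarrow> 'k) set" and ?v = "vtx n a b"
  note c = grid_carrier arr_carrier mesh_algebra_m_closed
  \<comment> \<open>Two cancelling signs are inserted so that the induction hypothesis can be
    applied from right to left.\<close>
  have "?g (Suc s) (Suc t) =
      smul n ((-1) ^ t) (smul n ((-1) ^ t) (?g (Suc s) t)) \<otimes>\<^bsub>mesh_algebra n\<^esub>
        arr n (?v (Suc s) t) (?v (Suc s) (Suc t))"
    by (simp add: smul_smul smul_1 c flip: power_add mult_2)
  also have "\<dots> = smul n ((-1) ^ t) (?g s t \<otimes>\<^bsub>mesh_algebra n\<^esub>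
      (arr n (?v s t) (?v (Suc s) t) \<otimes>\<^bsub>mesh_algebra n\<^esub> arr n (?v (Suc s) t) (?v (Suc s) (Suc t))))"
    using Suc.prems by (subst Suc.IH[symmetric]) (simp_all add: smul_mult_left mesh_algebra_m_assoc c)
  also have "\<dots> = smul n ((-1) ^ Suc t) (?g s (Suc t) \<otimes>\<^bsub>mesh_algebra n\<^esub>
      arr n (?v s (Suc t)) (?v (Suc s) (Suc t)))"
    using Suc.prems assms(1)
    by (simp add: mesh_vtx smul_mult_right mesh_algebra_m_assoc smul_smul c)
  finally have "smul n ((-1) ^ Suc t) (?g (Suc s) (Suc t)) =
      smul n ((-1) ^ Suc t * (-1) ^ Suc t) (?g s (Suc t) \<otimes>\<^bsub>mesh_algebra n\<^esub>
      arr n (?v s (Suc t)) (?v (Suc s) (Suc t)))"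
    by (simp only: smul_smul c)
  then show ?case
    by (simp add: smul_1 c flip: power_add mult_2 del: grid.simps power_Suc)
qed

text \<open>The moving endpoint has reached a. Since s-steps come first, the normal form passes
  through [a, a-1], a boundary segment, and is zero from there on.\<close>

lemma grid_right:
  assumes "Suc s = cw n a b"
  shows "grid n a b s t = \<zero>\<^bsub>mesh_algebra n\<^esub>"
proof (induction t)
  case 0
  obtain s' where s: "s = Suc s'" using assms cw_diagonal[OF ab] by (cases s) auto
  have "vtx n a b s 0 = {a, pred_v n a}"
    using funpow_pred_v_cw[OF ab_less] unfolding vtx_def assms by simp
  then have "vtx n a b s 0 \<notin> diagonals n" by (simp add: diagonals_pair)
  then show ?case unfolding s by (simp add: arr_eq_zero grid_carrier)
qed (simp add: arr_carrier)

text \<open>The normal form does not make this edge evident: for s > 0 its last vertex is a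
  diagonal, merely one not crossing [a,b]. Mesh relations slide the path back to s = 0, where it
  would enter the boundary segment [b-1, b].\<close>

lemma grid_top:
  assumes "Suc s < cw n a b" "Suc t = cw n b a"
  shows "grid n a b s t = (\<zero>\<^bsub>mesh_algebra n\<^esub> :: (seg list \<Rightarrow> 'k::field) set)"
  using assms(1)
proof (induction s)
  case 0
  obtain t' where t: "t = Suc t'" using assms cw_diagonal[OF ab] by (cases t) auto
  have "vtx n a b 0 t = {pred_v n b, b}"
    using funpow_pred_v_cw[OF ab_less(2,1)] unfolding vtx_def assms by simp
  then have "vtx n a b 0 t \<notin> diagonals n" by (simp add: diagonals_pair)
  then show ?case unfolding t by (simp add: arr_eq_zero grid_carrier)
next
  case (Suc s)
  obtain t' where t: "t = Suc t'" using assms cw_diagonal[OF ab] by (cases t) auto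
  let ?g = "grid n a b :: _ \<Rightarrow> _ \<Rightarrow> (seg list \<Rightarrow> 'k) set" and ?v = "vtx n a b"
  note c = grid_carrier arr_carrier mesh_algebra_m_closed
  have st: "Suc s < cw n a b" "Suc t' < cw n b a" using Suc.prems assms t by auto
  have "smul n ((-1) ^ t') (?g (Suc s) t) =
     smul n ((-1) ^ t') (?g (Suc s) t') \<otimes>\<^bsub>mesh_algebra n\<^esub>
       arr n (?v (Suc s) t') (?v (Suc s) t)"
    by (simp add: t smul_mult_left c)
  also have "\<dots> = ?g s t' \<otimes>\<^bsub>mesh_algebra n\<^esub> (arr n (?v s t') (?v (Suc s) t') \<otimes>\<^bsub>mesh_algebra n\<^esub>
       arr n (?v (Suc s) t') (?v (Suc s) t))"
    by (simp add: mesh_algebra_m_assoc c flip: grid_Suc[OF st])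
  also have "\<dots> = smul n (-1) (?g s t \<otimes>\<^bsub>mesh_algebra n\<^esub> arr n (?v s t) (?v (Suc s) t))"
    unfolding t mesh_vtx[OF st] by (simp add: smul_mult_right mesh_algebra_m_assoc c)
  also have "\<dots> = \<zero>\<^bsub>mesh_algebra n\<^esub>"
    using Suc by (simp add: arr_carrier smul_zero)
  finally have "smul n ((-1) ^ t') (smul n ((-1) ^ t') (?g (Suc s) t)) = \<zero>\<^bsub>mesh_algebra n\<^esub>"
    by (simp only: smul_zero)
  then show ?case
    by (simp add: smul_smul smul_1 c flip: power_add mult_2 del: grid.simps)
qed

lemma cls_path_grid:
  assumes "is_path n r" "hd r = tau_inv n {a, b}"
  shows "cls n (single r (1::'k::field)) = \<zero>\<^bsub>mesh_algebra n\<^esub> \<or>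
    (\<exists>s t c. Suc s < cw n a b \<and> Suc t < cw n b a \<and> last r = vtx n a b s t \<and>
       cls n (single r (1::'k)) = smul n c (grid n a b s t))"
  using assms
proof (induction r rule: rev_induct)
  case Nil
  then show ?case by (simp add: is_path_def)
next
  case (snoc z r)
  note c = grid_carrier arr_carrier mesh_algebra_m_closed
  show ?case
  proof (cases "r = []")
    case True
    then have "z = vtx n a b 0 0" using snoc.prems by (simp add: vtx_0_0)
    moreover have "cls n (single [z] (1::'k)) = smul n 1 (grid n a b 0 0)"
      using smul_1[OF grid_carrier[of 0 0, where 'a='k]] calculation by (simp add: idem_def)
    ultimately show ?thesis
      using cw_diagonal[OF ab] True
      by (intro disjI2 exI[of _ 0] exI[of _ "1::'k"]) (simp del: grid.simps)
  next
    case False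
    then have r: "is_path n r" "arrow n (last r) z" "hd r = tau_inv n {a, b}"
      using snoc.prems by (auto simp: is_path_snoc)
    have eq: "cls n (single (r @ [z]) (1::'k)) =
        cls n (single r 1) \<otimes>\<^bsub>mesh_algebra n\<^esub> arr n (last r) z"
      using snoc.prems(1) False by (rule cls_snoc)
    from snoc.IH[OF r(1,3)] show ?thesis
    proof (elim disjE exE conjE)
      fix s t c
      assume st: "Suc s < cw n a b" "Suc t < cw n b a" and l: "last r = vtx n a b s t"
        and cr: "cls n (single r (1::'k)) = smul n c (grid n a b s t)"
      from r(2) obtain i j where ij: "last r = {i, j}" "z = {pred_v n i, j}" by (rule arrowE)
      \<comment> \<open>An arrow moves the endpoint in one of the two arcs, hence raises exactly one
        coordinate.\<close>
      then have "z = vtx n a b (Suc s) t \<or> z = vtx n a b s (Suc t)"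
        unfolding l vtx_Suc_s vtx_Suc_t unfolding vtx_def doubleton_eq_iff
        by (elim disjE conjE) (simp_all add: insert_commute del: funpow.simps)
      then show ?thesis
      proof
        assume z: "z = vtx n a b (Suc s) t"
        have "cls n (single (r @ [z]) (1::'k)) = smul n (c * (-1) ^ t) (grid n a b (Suc s) t)"
          unfolding eq cr l unfolding z using grid_Suc[OF st, where 'k='k]
          by (simp add: smul_mult_left c smul_smul del: grid.simps)
        moreover have "Suc (Suc s) = cw n a b \<or> Suc (Suc s) < cw n a b" using st by auto
        ultimately show ?thesis
          using grid_right[of "Suc s" t, where 'a='k] st z by (elim disjE) (simp add: smul_zero del: grid.simps, metis last_snoc)
      next
        assume z: "z = vtx n a b s (Suc t)"
        have "cls n (single (r @ [z]) (1::'k)) = smul n c (grid n a b s (Suc t))"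
          unfolding eq cr l unfolding z by (simp add: smul_mult_left c)
        moreover have "Suc (Suc t) = cw n b a \<or> Suc (Suc t) < cw n b a" using st by auto
        ultimately show ?thesis
          using grid_top[of s "Suc t", where 'k='k] st z by (elim disjE) (simp add: smul_zero del: grid.simps, metis last_snoc)
      qed
    qed (simp add: eq arr_carrier)
  qed
qed

end

section \<open>Spaces of morphisms out of a projective\<close>

lemma hom_CE:
  assumes "u \<in> hom_C n X Y"
  obtains f where "u = cls n f" "f \<in> carrier (path_algebra n)"
    "\<And>r. f r \<noteq> 0 \<Longrightarrow> hd r \<in> X \<and> last r \<in> Y"
  using assms by (auto simp: hom_C_def cls_def)

lemma hom_CI:
  assumes "f \<in> carrier (path_algebra n)" "\<And>r. f r \<noteq> 0 \<Longrightarrow> hd r \<in> X \<and> last r \<in> Y"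
  shows "cls n f \<in> hom_C n X Y"
  using assms by (auto simp: hom_C_def cls_def)

text \<open>The target determines the coordinates in the rectangle, so all paths to it reduce to
  multiples of the same normal form; outside the rectangle they all vanish.\<close>

lemma hom_spanned:
  assumes g: "g \<in> diagonals n" and y: "y \<in> diagonals n"
  obtains m :: "(seg list \<Rightarrow> 'k::field) set" where "m \<in> carrier (mesh_algebra n)"
    "\<not> crosses g y \<Longrightarrow> m = \<zero>\<^bsub>mesh_algebra n\<^esub>"
    "\<And>h. h \<in> hom_C n {tau_inv n g} {y} \<Longrightarrow> \<exists>c. h = smul n c m"
proof -
  obtain a b where ab: "g = {a, b}" using g by (rule diagonalE)
  note d = g[unfolded ab]
  have ab_less: "a < n + 3" "b < n + 3" using d by (auto simp: diagonals_pair)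
  have ys: "y \<in> segments n" using y by (simp add: diagonals_def)
  obtain m :: "(seg list \<Rightarrow> 'k) set" where m: "m \<in> carrier (mesh_algebra n)"
    "\<not> crosses g y \<Longrightarrow> m = \<zero>\<^bsub>mesh_algebra n\<^esub>"
    "\<And>r. is_path n r \<Longrightarrow> hd r = tau_inv n g \<Longrightarrow> last r = y \<Longrightarrow> \<exists>c. cls n (single r 1) = smul n c m"
  proof (cases "crosses g y")
    case True
    then obtain s t where st: "Suc s < cw n a b" "Suc t < cw n b a" "y = vtx n a b s t"
      using crosses_vtxE[OF d ys] ab by auto
    have "\<exists>c. cls n (single r (1::'k)) = smul n c (grid n a b s t)"
      if "is_path n r" "hd r = tau_inv n g" "last r = y" for r
    proof -
      from cls_path_grid[OF d that(1) that(2)[unfolded ab], where 'k='k]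
      show ?thesis
      proof (elim disjE exE conjE)
        fix s' t' c
        assume *: "Suc s' < cw n a b" "Suc t' < cw n b a" "last r = vtx n a b s' t'"
          "cls n (single r (1::'k)) = smul n c (grid n a b s' t')"
        then have "s' = s \<and> t' = t" using that(3) st vtx_inj[OF d] by simp
        then show ?thesis using * by blast
      next
        assume "cls n (single r (1::'k)) = \<zero>\<^bsub>mesh_algebra n\<^esub>"
        then show ?thesis using smul_0[OF grid_carrier[OF d]] by metis
      qed
    qed
    then show ?thesis using that[of "grid n a b s t"] grid_carrier[OF d] True by blast
  next
    case False
    have "cls n (single r (1::'k)) = \<zero>\<^bsub>mesh_algebra n\<^esub>"
      if "is_path n r" "hd r = tau_inv n g" "last r = y" for r
      using cls_path_grid[OF d that(1), where 'k='k] that(2,3) crosses_vtx[OF ab_less] False ab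
      by metis
    then show ?thesis
      using that[of "\<zero>\<^bsub>mesh_algebra n\<^esub>"] cls_carrier[OF zero_carrier, of n, where 'a='k]
      by (simp add: cls_zero smul_zero)
  qed
  have "\<exists>c. h = smul n c m" if h: "h \<in> hom_C n {tau_inv n g} {y}" for h
  proof -
    obtain f where f: "h = cls n f" "f \<in> carrier (path_algebra n)"
      "\<And>r. f r \<noteq> 0 \<Longrightarrow> hd r \<in> {tau_inv n g} \<and> last r \<in> {y}"
      using h by (rule hom_CE) blast
    from f(2) have "\<exists>c. cls n f = smul n c m"
    proof (induction rule: carrier_induct[where Q="\<lambda>r. hd r \<in> {tau_inv n g} \<and> last r \<in> {y}"])
      case zero
      then show ?case using smul_0[OF m(1)] by (auto simp: cls_zero)
    next
      case (single f r d)
      then obtain c' where c': "cls n (single r 1) = smul n c' m" using m(3)[of r] by auto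
      obtain c where c: "cls n f = smul n c m" using single by blast
      have "single r d = (\<lambda>s. d * single r 1 s)" by (auto simp: single_def)
      then have "cls n (single r d) = smul n (d * c') m"
        using smul_cls[of "single r 1" n d] single c' m(1) by (simp add: single_carrier smul_smul)
      then have "cls n (\<lambda>s. single r d s + f s) = smul n (d * c' + c) m"
        using single c m(1) by (simp add: single_carrier flip: cls_add smul_add_left)
      then show ?case by blast
    qed (rule f(3))
    then show ?thesis using f(1) by simp
  qed
  then show ?thesis using that m(1,2) by blast
qed

text \<open>The steps of i are made before those of j. The visited vertices are recorded so that
  crossings can be verified afterwards for whichever diagonal is in question.\<close>

lemma rect_path:
  assumes "\<And>s' t'. s' \<le> s \<Longrightarrow> t' \<le> t \<Longrightarrow> {(pred_v n ^^ s') i, (pred_v n ^^ t') j} \<in> diagonals n"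
  shows "\<exists>r. is_path n r \<and> hd r = {i, j} \<and> last r = {(pred_v n ^^ s) i, (pred_v n ^^ t) j} \<and>
    (\<forall>z\<in>set r. \<exists>s'\<le>s. \<exists>t'\<le>t. z = {(pred_v n ^^ s') i, (pred_v n ^^ t') j})"
    (is "\<exists>r. is_path n r \<and> hd r = {i, j} \<and> last r = ?v s t \<and> _ r")
  using assms
proof (induction t)
  case 0
  then show ?case
  proof (induction s)
    case 0
    then show ?case using 0[of 0 0] by (intro exI[of _ "[{i, j}]"]) (simp add: is_path_def)
  next
    case (Suc s)
    obtain r where r: "is_path n r" "hd r = {i, j}" "last r = ?v s 0"
      "\<forall>z\<in>set r. \<exists>s'\<le>s. \<exists>t'\<le>0. z = ?v s' t'" using Suc.IH Suc.prems le_SucI by blast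
    have "arrow n (?v s 0) (?v (Suc s) 0)"
      using Suc.prems[of s 0] Suc.prems[of "Suc s" 0] arrow_pair by simp
    moreover have "r \<noteq> []" using r(1) by (simp add: is_path_def)
    moreover have "\<forall>z\<in>set (r @ [?v (Suc s) 0]). \<exists>s'\<le>Suc s. \<exists>t'\<le>0. z = ?v s' t'"
    proof
      fix z assume "z \<in> set (r @ [?v (Suc s) 0])"
      then consider "z \<in> set r" | "z = ?v (Suc s) 0" by auto
      then show "\<exists>s'\<le>Suc s. \<exists>t'\<le>0. z = ?v s' t'"
      proof cases
        case 1
        then show ?thesis using r(4) le_SucI by metis
      qed auto
    qed
    ultimately show ?case
      using r(1-3) by (intro exI[of _ "r @ [?v (Suc s) 0]"] conjI)
        (simp_all add: is_path_snoc del: funpow.simps)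
  qed
next
  case (Suc t)
  obtain r where r: "is_path n r" "hd r = {i, j}" "last r = ?v s t"
    "\<forall>z\<in>set r. \<exists>s'\<le>s. \<exists>t'\<le>t. z = ?v s' t'" using Suc.IH Suc.prems le_SucI by blast
  have "arrow n (?v s t) (?v s (Suc t))"
    using Suc.prems[of s t] Suc.prems[of s "Suc t"] arrow_pair[of "(pred_v n ^^ t) j"]
    by (simp add: insert_commute)
  moreover have "r \<noteq> []" using r(1) by (simp add: is_path_def)
  moreover have "\<forall>z\<in>set (r @ [?v s (Suc t)]). \<exists>s'\<le>s. \<exists>t'\<le>Suc t. z = ?v s' t'"
  proof
    fix z assume "z \<in> set (r @ [?v s (Suc t)])"
    then consider "z \<in> set r" | "z = ?v s (Suc t)" by auto
    then show "\<exists>s'\<le>s. \<exists>t'\<le>Suc t. z = ?v s' t'"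
    proof cases
      case 1
      then show ?thesis using r(4) le_SucI by metis
    next
      case 2
      then show ?thesis by (intro exI[of _ s] exI[of _ "Suc t"] conjI order_refl)
    qed
  qed
  ultimately show ?case
    using r(1-3) by (intro exI[of _ "r @ [?v s (Suc t)]"] conjI)
      (simp_all add: is_path_snoc del: funpow.simps)
qed

section \<open>Composition of morphisms\<close>

lemma hom_C_carrier: "u \<in> hom_C n X Y \<Longrightarrow> u \<in> carrier (mesh_algebra n)"
  by (erule hom_CE) (simp add: cls_carrier)

lemma hom_C_mono: "u \<in> hom_C n X Y \<Longrightarrow> X \<subseteq> X' \<Longrightarrow> Y \<subseteq> Y' \<Longrightarrow> u \<in> hom_C n X' Y'"
  by (erule hom_CE) (auto intro!: hom_CI)

lemma hom_C_zero: "\<zero>\<^bsub>mesh_algebra n\<^esub> \<in> hom_C n X Y"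
  using hom_CI[OF zero_carrier, of X Y n] by (simp add: cls_zero)

lemma hom_C_add:
  assumes "u \<in> hom_C n X Y" "v \<in> hom_C n X Y"
  shows "u \<oplus>\<^bsub>mesh_algebra n\<^esub> v \<in> hom_C n X Y"
proof -
  obtain f where f: "u = cls n f" "f \<in> carrier (path_algebra n)"
    "\<And>r. f r \<noteq> 0 \<Longrightarrow> hd r \<in> X \<and> last r \<in> Y" using assms(1) by (rule hom_CE) blast
  obtain g where g: "v = cls n g" "g \<in> carrier (path_algebra n)"
    "\<And>r. g r \<noteq> 0 \<Longrightarrow> hd r \<in> X \<and> last r \<in> Y" using assms(2) by (rule hom_CE) blast
  have "cls n (\<lambda>r. f r + g r) \<in> hom_C n X Y"
  proof (rule hom_CI)
    fix r assume "f r + g r \<noteq> 0"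
    then have "f r \<noteq> 0 \<or> g r \<noteq> 0" by auto
    then show "hd r \<in> X \<and> last r \<in> Y" using f(3) g(3) by blast
  qed (intro add_carrier f g)
  then show ?thesis using f g by (simp add: cls_add)
qed

lemma hom_C_smul:
  assumes "u \<in> hom_C n X Y"
  shows "smul n c u \<in> hom_C n X Y"
  using assms
proof (rule hom_CE)
  fix f assume f: "u = cls n f" "f \<in> carrier (path_algebra n)"
    "\<And>r. f r \<noteq> 0 \<Longrightarrow> hd r \<in> X \<and> last r \<in> Y"
  have "cls n (\<lambda>r. c * f r) \<in> hom_C n X Y"
    by (rule hom_CI) (use f scale_carrier in auto)
  then show ?thesis using f by (simp add: smul_cls)
qed

lemma hom_C_mult:
  assumes "u \<in> hom_C n X Y" "v \<in> hom_C n Y' Z"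
  shows "u \<otimes>\<^bsub>mesh_algebra n\<^esub> v \<in> hom_C n X Z"
proof -
  obtain f where f: "u = cls n f" "f \<in> carrier (path_algebra n)"
    "\<And>r. f r \<noteq> 0 \<Longrightarrow> hd r \<in> X \<and> last r \<in> Y" using assms(1) by (rule hom_CE) blast
  obtain g where g: "v = cls n g" "g \<in> carrier (path_algebra n)"
    "\<And>r. g r \<noteq> 0 \<Longrightarrow> hd r \<in> Y' \<and> last r \<in> Z" using assms(2) by (rule hom_CE) blast
  have "cls n (path_mult f g) \<in> hom_C n X Z"
  proof (rule hom_CI)
    fix r assume "path_mult f g r \<noteq> 0"
    then obtain m where m: "m < length r" "f (take (Suc m) r) \<noteq> 0" "g (drop m r) \<noteq> 0"
      by (rule path_mult_nonzeroE)
    then show "hd r \<in> X \<and> last r \<in> Z"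
      using f(3)[OF m(2)] g(3)[OF m(3)] by (cases r) auto
  qed (intro path_mult_carrier f g)
  then show ?thesis using f g by (simp add: cls_mult)
qed

lemma idem_hom_C: "x \<in> diagonals n \<Longrightarrow> idem n x \<in> hom_C n {x} {x}"
  unfolding idem_def
  by (rule hom_CI) (auto simp: single_def intro: single_carrier[unfolded single_def] is_path_singleton
      split: if_splits)

section \<open>Decomposition by idempotents\<close>

lemma path_mult_single_vertex:
  assumes "f \<in> carrier (path_algebra n)"
  shows "path_mult (single [x] 1) f = (\<lambda>r. if hd r = x then f r else 0)"
proof
  fix r
  show "path_mult (single [x] 1) f r = (if hd r = x then f r else 0)"
  proof (cases r)
    case Nil
    then show ?thesis using assms by (auto simp: path_mult_def path_algebra_def is_path_def)
  next
    case (Cons y ys)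
    have "path_mult (single [x] 1) f r = (\<Sum>m<length r. if m = 0 then (if y = x then f r else 0) else 0)"
      unfolding path_mult_def by (intro sum.cong) (auto simp: single_def Cons)
    then show ?thesis using Cons by simp
  qed
qed

lemma path_mult_vertex_single:
  assumes "f \<in> carrier (path_algebra n)"
  shows "path_mult f (single [x] 1) = (\<lambda>r. if last r = x then f r else 0)"
proof
  fix r
  show "path_mult f (single [x] 1) r = (if last r = x then f r else 0)"
  proof (cases r rule: rev_cases)
    case Nil
    then show ?thesis using assms by (auto simp: path_mult_def path_algebra_def is_path_def)
  next
    case (snoc ys y)
    have "path_mult f (single [x] 1) r =
        (\<Sum>m<length r. if m = length ys then (if y = x then f r else 0) else 0)"
      unfolding path_mult_def by (intro sum.cong) (auto simp: single_def snoc append_eq_Cons_conv)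
    then show ?thesis using snoc by simp
  qed
qed

lemma idem_mult:
  assumes "x \<in> diagonals n" "f \<in> carrier (path_algebra n)"
  shows "idem n x \<otimes>\<^bsub>mesh_algebra n\<^esub> cls n f = cls n (\<lambda>r. if hd r = x then f r else 0)"
    and "cls n f \<otimes>\<^bsub>mesh_algebra n\<^esub> idem n x = cls n (\<lambda>r. if last r = x then f r else 0)"
  unfolding idem_def using assms
  by (simp_all add: cls_mult single_carrier is_path_singleton path_mult_single_vertex
      path_mult_vertex_single)

lemma idem_mult_left:
  assumes "x \<in> diagonals n" "u \<in> hom_C n {y} Y"
  shows "idem n x \<otimes>\<^bsub>mesh_algebra n\<^esub> u = (if x = y then u else \<zero>\<^bsub>mesh_algebra n\<^esub>)"
  using assms(2)
proof (rule hom_CE)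
  fix f assume f: "u = cls n f" "f \<in> carrier (path_algebra n)"
    "\<And>r. f r \<noteq> 0 \<Longrightarrow> hd r \<in> {y} \<and> last r \<in> Y"
  have "(\<lambda>r. if hd r = x then f r else 0) = (if x = y then f else (\<lambda>_. 0))"
    using f(3) by (auto simp: fun_eq_iff)
  then show ?thesis using idem_mult(1)[OF assms(1) f(2)] f(1) by (simp add: cls_zero)
qed

lemma idem_mult_right:
  assumes "x \<in> diagonals n" "u \<in> hom_C n X {x}"
  shows "u \<otimes>\<^bsub>mesh_algebra n\<^esub> idem n x = u"
  using assms(2)
proof (rule hom_CE)
  fix f assume f: "u = cls n f" "f \<in> carrier (path_algebra n)"
    "\<And>r. f r \<noteq> 0 \<Longrightarrow> hd r \<in> X \<and> last r \<in> {x}"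
  have "(\<lambda>r. if last r = x then f r else 0) = f"
    using f(3) by (auto simp: fun_eq_iff)
  then show ?thesis using idem_mult(2)[OF assms(1) f(2)] f(1) by simp
qed

lemma restrict_carrier:
  assumes "f \<in> carrier (path_algebra n)"
  shows "(\<lambda>r. if P r then f r else 0) \<in> carrier (path_algebra n)"
proof -
  have "{r. (if P r then f r else 0) \<noteq> 0} \<subseteq> {r. f r \<noteq> 0}" by auto
  then show ?thesis using assms
    by (auto simp: path_algebra_def intro: finite_subset)
qed

text \<open>Peirce decomposition: u is the sum of its components at the starting points in X. With U
  arbitrary it serves both for submodules and for annihilators.\<close>

lemma hom_C_decompose:
  assumes "finite X" "X \<subseteq> diagonals n" "u \<in> hom_C n X Y"
    and "\<zero>\<^bsub>mesh_algebra n\<^esub> \<in> U"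
    and "\<And>v w. v \<in> U \<Longrightarrow> w \<in> U \<Longrightarrow> v \<oplus>\<^bsub>mesh_algebra n\<^esub> w \<in> U"
    and "\<And>x. x \<in> X \<Longrightarrow> idem n x \<otimes>\<^bsub>mesh_algebra n\<^esub> u \<in> U"
  shows "u \<in> U"
proof -
  obtain f where f: "u = cls n f" "f \<in> carrier (path_algebra n)"
    "\<And>r. f r \<noteq> 0 \<Longrightarrow> hd r \<in> X \<and> last r \<in> Y" using assms(3) by (rule hom_CE) blast
  have "cls n (\<lambda>r. if hd r \<in> X' then f r else 0) \<in> U" if "finite X'" "X' \<subseteq> X" for X'
    using that
  proof (induction X' rule: finite_induct)
    case (insert x X')
    have "(\<lambda>r. if hd r \<in> insert x X' then f r else 0) =
        (\<lambda>r. (if hd r = x then f r else 0) + (if hd r \<in> X' then f r else 0))"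
      using insert.hyps by auto
    then have "cls n (\<lambda>r. if hd r \<in> insert x X' then f r else 0) =
        idem n x \<otimes>\<^bsub>mesh_algebra n\<^esub> u \<oplus>\<^bsub>mesh_algebra n\<^esub> cls n (\<lambda>r. if hd r \<in> X' then f r else 0)"
      using idem_mult(1)[of x n f] insert.prems assms(2) f(1,2)
      by (simp add: cls_add restrict_carrier subset_iff)
    then show ?case using assms(5,6) insert by simp
  qed (simp add: cls_zero assms(4))
  moreover have "(\<lambda>r. if hd r \<in> X then f r else 0) = f" using f(3) by (auto simp: fun_eq_iff)
  ultimately show ?thesis using assms(1) f(1) by fastforce
qed

lemma additive_subgroup_mesh_algebraI:
  fixes U :: "(seg list \<Rightarrow> 'k::field) set set"
  assumes "U \<subseteq> carrier (mesh_algebra n)" "\<zero>\<^bsub>mesh_algebra n\<^esub> \<in> U"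
    and "\<And>v w. v \<in> U \<Longrightarrow> w \<in> U \<Longrightarrow> v \<oplus>\<^bsub>mesh_algebra n\<^esub> w \<in> U"
    and "\<And>v. v \<in> U \<Longrightarrow> smul n (-1) v \<in> U"
  shows "additive_subgroup U (mesh_algebra n)"
proof
  interpret ring "mesh_algebra n :: (seg list \<Rightarrow> 'k) set ring" by (rule ring_mesh_algebra)
  fix v assume v: "v \<in> U"
  then have c: "v \<in> carrier (mesh_algebra n)" using assms(1) by blast
  have "smul n (-1) v \<oplus>\<^bsub>mesh_algebra n\<^esub> smul n 1 v = \<zero>\<^bsub>mesh_algebra n\<^esub>"
    using c by (simp only: smul_add_left smul_0 add.left_inverse)
  then have "\<ominus>\<^bsub>mesh_algebra n\<^esub> v = smul n (-1) v"
    using c by (intro minus_equality) (simp_all add: smul_1 smul_carrier)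
  then show "inv\<^bsub>add_monoid (mesh_algebra n)\<^esub> v \<in> U"
    using assms(4)[OF v] by (simp add: a_inv_def)
qed (use assms in auto)

section \<open>Nonzero morphisms and nonzero composites\<close>

lemma path_crossing:
  assumes "x \<in> diagonals n" "M \<in> segments n" "crosses x M"
  obtains r where "is_path n r" "hd r = tau_inv n x" "last r = M" "\<forall>z\<in>set r. crosses x z"
proof -
  obtain a b where ab: "x = {a, b}" using assms(1) by (rule diagonalE)
  note d = assms(1)[unfolded ab]
  have ab_less: "a < n + 3" "b < n + 3" using d by (auto simp: diagonals_pair)
  obtain s t where st: "Suc s < cw n a b" "Suc t < cw n b a" "M = vtx n a b s t"
    using crosses_vtxE[OF d assms(2)] assms(3) ab by auto
  have v: "vtx n a b s' t' = {(pred_v n ^^ s') (pred_v n b), (pred_v n ^^ t') (pred_v n a)}" for s' t'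
    by (simp add: vtx_def funpow_swap1)
  have "{(pred_v n ^^ s') (pred_v n b), (pred_v n ^^ t') (pred_v n a)} \<in> diagonals n"
    if "s' \<le> s" "t' \<le> t" for s' t'
    using that st vtx_diagonal[OF d, of s' t'] by (simp flip: v)
  from rect_path[OF this, folded v]
  obtain r where "is_path n r \<and> hd r = {pred_v n b, pred_v n a} \<and> last r = vtx n a b s t \<and>
    (\<forall>z\<in>set r. \<exists>s'\<le>s. \<exists>t'\<le>t. z = vtx n a b s' t')" ..
  then have r: "is_path n r" "hd r = {pred_v n b, pred_v n a}" "last r = vtx n a b s t"
    "\<forall>z\<in>set r. \<exists>s'\<le>s. \<exists>t'\<le>t. z = vtx n a b s' t'" by simp_all
  have "\<forall>z\<in>set r. crosses x z"
  proof
    fix z assume "z \<in> set r"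
    then obtain s' t' where "s' \<le> s" "t' \<le> t" "z = vtx n a b s' t'" using r(4) by blast
    then show "crosses x z" using crosses_vtx[OF ab_less, of s' t'] st ab by simp
  qed
  then show ?thesis using that[OF r(1) _ _] r(2,3) st(3) ab by (simp add: insert_commute)
qed

lemma cls_path_hom_C:
  assumes "is_path n r" "hd r = x" "last r = y"
  shows "cls n (single r c) \<in> hom_C n {x} {y}"
  using assms by (intro hom_CI single_carrier) (auto simp: single_def split: if_splits)

lemma cls_path_nonzero:
  assumes "x \<in> diagonals n" "is_path n r" "\<forall>z\<in>set r. crosses x z"
  shows "cls n (single r (1::'k::field)) \<noteq> \<zero>\<^bsub>mesh_algebra n\<^esub>"
proof -
  have "x \<in> segments n" using assms(1) by (simp add: diagonals_def)
  moreover have "r \<noteq> []" using assms(2) by (simp add: is_path_def)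
  ultimately show ?thesis
    using path_not_in_mesh_ideal[of x n r, where 'k='k] assms by (simp add: cls_eq_zero single_carrier)
qed

lemma hom_basis:
  assumes "x \<in> diagonals n" "M \<in> diagonals n" "crosses x M"
  obtains m :: "(seg list \<Rightarrow> 'k::field) set" where "m \<in> hom_C n {tau_inv n x} {M}"
    "m \<noteq> \<zero>\<^bsub>mesh_algebra n\<^esub>" "\<And>h. h \<in> hom_C n {tau_inv n x} {M} \<Longrightarrow> \<exists>c. h = smul n c m"
proof -
  obtain m0 :: "(seg list \<Rightarrow> 'k) set" where m0: "m0 \<in> carrier (mesh_algebra n)"
    "\<And>h. h \<in> hom_C n {tau_inv n x} {M} \<Longrightarrow> \<exists>c. h = smul n c m0"
    using hom_spanned[OF assms(1,2)] by metis
  have "M \<in> segments n" using assms(2) by (simp add: diagonals_def)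
  then obtain r where r: "is_path n r" "hd r = tau_inv n x" "last r = M" "\<forall>z\<in>set r. crosses x z"
    using path_crossing assms(1,3) by blast
  let ?m = "cls n (single r (1::'k))"
  have m: "?m \<in> hom_C n {tau_inv n x} {M}" "?m \<noteq> \<zero>\<^bsub>mesh_algebra n\<^esub>"
    using r cls_path_hom_C cls_path_nonzero[OF assms(1)] by blast+
  \<comment> \<open>The spanning element \<open>m0\<close> is not known to be nonzero, but the class
    of the path r is. Being a nonzero multiple of \<open>m0\<close>, it spans as well.\<close>
  then obtain c where c: "?m = smul n c m0" using m0 by blast
  then have "c \<noteq> 0" using m m0 smul_0 by metis
  then have "m0 = smul n (inverse c) ?m" using c m0(1) by (simp add: smul_smul smul_1)
  then have "\<exists>d. h = smul n d ?m" if "h \<in> hom_C n {tau_inv n x} {M}" for h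
    using m0(2)[OF that] smul_smul[OF hom_C_carrier[OF m(1)]] by metis
  then show ?thesis using that m by blast
qed

lemma hom_C_eq_zero:
  assumes "x \<in> diagonals n" "M \<in> diagonals n" "\<not> crosses x M" "h \<in> hom_C n {tau_inv n x} {M}"
  shows "h = \<zero>\<^bsub>mesh_algebra n\<^esub>"
  using hom_spanned[OF assms(1,2)] assms(3,4) smul_zero by metis

text \<open>For distinct noncrossing \<open>x\<close> and \<open>y\<close> this says that there is a nonzero map \<open>P_x \<rightarrow> P_y\<close>, so that
  a submodule living on \<open>y\<close> also lives on \<open>x\<close>.\<close>

definition below :: "seg \<Rightarrow> seg \<Rightarrow> bool" where
  "below x y \<longleftrightarrow> (\<exists>v w u. x = {v, u} \<and> y = {v, w} \<and> cyc v w u)"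

text \<open>If the shifted endpoints of y lie strictly on the two sides of x, then each endpoint of
  y is inside its arc or at the clockwise end of it. Both inside would be a crossing and both at the
  end would be equality, so exactly one endpoint is shared.\<close>

lemma crosses_tau_inv_imp_below:
  assumes "x \<in> diagonals n" "y \<in> diagonals n" "\<not> crosses x y" "crosses x (tau_inv n y)" "x \<noteq> y"
  shows "below x y"
proof -
  obtain a b where x: "x = {a, b}" "a < n + 3" "b < n + 3" using assms(1) by (rule diagonalE)
  obtain c d where y: "y = {c, d}" "c < n + 3" "d < n + 3" "c \<noteq> d" using assms(2) by (rule diagonalE)
  have pred: "cyc a i b \<or> i = b" if "cyc a (pred_v n i) b" "i < n + 3" "b < n + 3" for i a b
    using that by (cases "i = 0") (auto simp: cyc_def pred_v_eq)
  have *: "below x y"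
    if "cyc a (pred_v n c) b" "cyc b (pred_v n d) a" "y = {c, d}" "c < n + 3" "d < n + 3" for c d
  proof -
    have "cyc a c b \<or> c = b" "cyc b d a \<or> d = a" using pred that x(2,3) by blast+
    moreover have "\<not> (cyc a c b \<and> cyc b d a)"
      using assms(3) x that(3) crosses_pair by blast
    moreover have "\<not> (c = b \<and> d = a)" using assms(5) x(1) that(3) by (auto simp: insert_commute)
    ultimately have "c = b \<and> cyc b d a \<or> d = a \<and> cyc a c b" by blast
    then show ?thesis unfolding below_def x(1) that(3) by (auto simp: insert_commute)
  qed
  show ?thesis
    using assms(4) *[of c d] *[of d c] y(2,3) insert_commute[of c d "{}"]
    unfolding x(1) y(1) tau_inv_pair crosses_pair by blast
qed

text \<open>A path to the projective at y and on to M can be chosen with all its vertices crossing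
  x, so the representation belonging to x detects the composite.\<close>

lemma below_composite:
  assumes "x \<in> diagonals n" "y \<in> diagonals n" "M \<in> diagonals n"
    "below x y" "crosses x M" "crosses y M"
  obtains b m :: "(seg list \<Rightarrow> 'k::field) set" where "b \<in> hom_C n {tau_inv n x} {tau_inv n y}"
    "m \<in> hom_C n {tau_inv n y} {M}" "b \<otimes>\<^bsub>mesh_algebra n\<^esub> m \<noteq> \<zero>\<^bsub>mesh_algebra n\<^esub>"
proof -
  obtain v w u where x: "x = {v, u}" and y: "y = {v, w}" and vwu: "cyc v w u"
    using assms(4) by (auto simp: below_def)
  have less: "v < n + 3" "u < n + 3" "w < n + 3"
    using assms(1,2) by (auto simp: x y diagonals_pair)
  have "crosses x (tau_inv n y)"
  proof -
    have pred: "cyc a (pred_v n b) b" if "{a, b} \<in> diagonals n" for a b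
      using that by (cases "b = 0") (auto simp: cyc_def diagonals_pair pred_v_eq[of b] pred_v_eq[of 0])
    have "cyc v (pred_v n w) w" "cyc u (pred_v n v) v"
      using pred assms(1,2) by (simp_all add: x y insert_commute)
    moreover from this(1) have "cyc v (pred_v n w) u" using vwu by (auto simp: cyc_def)
    ultimately show ?thesis unfolding x y tau_inv_pair crosses_pair by blast
  qed
  then obtain r where r: "is_path n r" "hd r = tau_inv n x" "last r = tau_inv n y"
      "\<forall>z\<in>set r. crosses x z"
    using path_crossing[OF assms(1)] tau_inv_diagonal[OF assms(2)] by (auto simp: diagonals_def)
  have wu: "cyc v c w \<Longrightarrow> cyc v c u" and excl: "\<not> (cyc v c u \<and> cyc u c v)" for c
    using vwu by (auto simp: cyc_def)
  have Mseg: "M \<in> segments n" using assms(3) by (simp add: diagonals_def)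
  \<comment> \<open>Since the arc from v to w is part of the arc from v to u, crossing both x and y
    puts one endpoint of M into the smaller arc on each side. Paths staying in these two arcs cross
    x throughout.\<close>
  obtain i j where M: "M = {i, j}" "cyc v i w" "cyc u j v" "i < n + 3" "j < n + 3"
  proof -
    obtain i j where ij: "M = {i, j}" "i < n + 3" "j < n + 3" using Mseg by (rule segmentE)
    have "cyc v i w \<and> cyc u j v \<or> cyc v j w \<and> cyc u i v"
      using assms(5,6) wu excl unfolding x y ij crosses_pair by blast
    then show ?thesis using that ij by (auto simp: insert_commute)
  qed
  obtain s where s: "Suc s < cw n v w" "i = (pred_v n ^^ Suc s) w"
    using cyc_funpow_pred_vE[OF M(2) less(1,3) M(4)] .
  obtain t where t: "Suc t < cw n u v" "j = (pred_v n ^^ Suc t) v"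
    using cyc_funpow_pred_vE[OF M(3) less(2,1) M(5)] .
  let ?z = "\<lambda>s' t'. {(pred_v n ^^ Suc s') w, (pred_v n ^^ Suc t') v}"
  have z: "crosses x (?z s' t')" "?z s' t' \<in> diagonals n" if "s' \<le> s" "t' \<le> t" for s' t'
  proof -
    have ends: "cyc v ((pred_v n ^^ Suc s') w) w" "cyc u ((pred_v n ^^ Suc t') v) v"
      using cyc_funpow_pred_v[OF less(1,3), of s'] cyc_funpow_pred_v[OF less(2,1), of t'] that s t by auto
    with wu show *: "crosses x (?z s' t')" unfolding x crosses_pair by blast
    have "?z s' t' \<in> segments n"
      using wu[OF ends(1)] excl ends(2) less unfolding segments_pair by auto
    then show "?z s' t' \<in> diagonals n"
      using crosses_imp_diagonal[OF *] assms(1) by (auto simp: diagonals_def)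
  qed
  have sw: "?z s' t' = {(pred_v n ^^ s') (pred_v n w), (pred_v n ^^ t') (pred_v n v)}" for s' t'
    by (simp add: funpow_swap1)
  from rect_path[OF z(2)[unfolded sw], folded sw]
  obtain r' where "is_path n r' \<and> hd r' = {pred_v n w, pred_v n v} \<and> last r' = ?z s t \<and>
    (\<forall>z\<in>set r'. \<exists>s'\<le>s. \<exists>t'\<le>t. z = ?z s' t')" ..
  then have r': "is_path n r'" "hd r' = {pred_v n w, pred_v n v}" "last r' = ?z s t"
    "\<forall>z\<in>set r'. \<exists>s'\<le>s. \<exists>t'\<le>t. z = ?z s' t'" by (simp_all del: funpow.simps)
  have r'x: "\<forall>z\<in>set r'. crosses x z" using r'(4) z(1) by metis
  have hl: "hd r' = tau_inv n y" "last r' = M"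
    using r'(2,3) unfolding s(2)[symmetric] t(2)[symmetric] by (simp_all add: y M(1) insert_commute)
  have ne: "r \<noteq> []" "r' \<noteq> []" using r(1) r'(1) by (auto simp: is_path_def)
  have "is_path n (r @ tl r')" using r r' hl by (intro is_path_append) auto
  moreover have "\<forall>z\<in>set (r @ tl r'). crosses x z"
    using r(4) r'x ne by (metis UnE list.set_sel(2) set_append)
  ultimately have "cls n (single (r @ tl r') (1::'k)) \<noteq> \<zero>\<^bsub>mesh_algebra n\<^esub>"
    by (rule cls_path_nonzero[OF assms(1)])
  moreover have "cls n (single r (1::'k)) \<otimes>\<^bsub>mesh_algebra n\<^esub> cls n (single r' 1) =
      cls n (single (r @ tl r') (1::'k))"
    using r r' hl ne by (simp add: cls_mult single_carrier path_mult_single)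
  ultimately show ?thesis
    using that[OF cls_path_hom_C[OF r(1-3)] cls_path_hom_C[OF r'(1) hl]] by metis
qed

lemma tau_inv_inj:
  assumes "x \<in> diagonals n" "y \<in> diagonals n" "tau_inv n x = tau_inv n y"
  shows "x = y"
proof -
  have "inj_on (pred_v n) {..<n + 3}"
    by (auto simp: inj_on_def pred_v_eq split: if_splits)
  moreover have "x \<subseteq> {..<n + 3}" "y \<subseteq> {..<n + 3}"
    using assms(1,2) by (auto elim!: diagonalE)
  ultimately show ?thesis
    using assms(3) by (simp add: tau_inv_def inj_on_image_eq_iff)
qed

section \<open>Submodules as lower sets\<close>

definition crossed :: "seg set \<Rightarrow> seg \<Rightarrow> seg set" where
  "crossed T M = {x \<in> T. crosses x M}"

definition lower_sets :: "seg set \<Rightarrow> seg \<Rightarrow> seg set set" where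
  "lower_sets T M =
     {S. S \<subseteq> crossed T M \<and> (\<forall>y\<in>S. \<forall>x\<in>crossed T M. below x y \<longrightarrow> x \<in> S)}"

lemma additive_subgroup_submodule:
  assumes "U \<in> submodules n T M"
  shows "U \<subseteq> module_at n T M" "\<zero>\<^bsub>mesh_algebra n\<^esub> \<in> U"
    "\<And>u v. u \<in> U \<Longrightarrow> v \<in> U \<Longrightarrow> u \<oplus>\<^bsub>mesh_algebra n\<^esub> v \<in> U"
    "\<And>b u. b \<in> cluster_tilted n T \<Longrightarrow> u \<in> U \<Longrightarrow> b \<otimes>\<^bsub>mesh_algebra n\<^esub> u \<in> U"
  using assms additive_subgroup.zero_closed additive_subgroup.a_closed
  by (auto simp: submodules_def)

context
  fixes K :: "'k::field itself" and n :: nat and T :: "seg set" and M :: seg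
  assumes T: "T \<subseteq> diagonals n" and noncrossing: "\<And>x y. x \<in> T \<Longrightarrow> y \<in> T \<Longrightarrow> \<not> crosses x y"
    and M: "M \<in> diagonals n"
begin

abbreviation (input) "Q \<equiv> mesh_algebra n :: (seg list \<Rightarrow> 'k) set ring"
abbreviation (input) "P \<equiv> tau_inv n"

text \<open>The submodule belonging to S is given by vanishing components and not as a span, so no
  basis vectors have to be chosen.\<close>

definition supported :: "seg set \<Rightarrow> (seg list \<Rightarrow> 'k) set set" where
  "supported S = {u \<in> module_at n T M. \<forall>x\<in>crossed T M - S. idem n (P x) \<otimes>\<^bsub>Q\<^esub> u = \<zero>\<^bsub>Q\<^esub>}"

lemma P_diagonal: "x \<in> T \<Longrightarrow> P x \<in> diagonals n"
  using T tau_inv_diagonal by blast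

lemma idem_P: "x \<in> T \<Longrightarrow> idem n (P x) \<in> carrier Q"
  using P_diagonal idem_carrier by blast

lemma module_atD: "u \<in> module_at n T M \<Longrightarrow> u \<in> hom_C n (P ` T) {M}"
  by (simp add: module_at_def pos_P_def[abs_def])

lemma module_atI: "x \<in> T \<Longrightarrow> u \<in> hom_C n {P x} {M} \<Longrightarrow> u \<in> module_at n T M"
  by (auto simp: module_at_def pos_P_def[abs_def] intro: hom_C_mono)

lemma cluster_tiltedI: "x \<in> T \<Longrightarrow> y \<in> T \<Longrightarrow> u \<in> hom_C n {P x} {P y} \<Longrightarrow> u \<in> cluster_tilted n T"
  by (auto simp: cluster_tilted_def pos_P_def[abs_def] intro: hom_C_mono)

lemma idem_module: "x \<in> T \<Longrightarrow> u \<in> module_at n T M \<Longrightarrow> idem n (P x) \<otimes>\<^bsub>Q\<^esub> u \<in> hom_C n {P x} {M}"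
  using hom_C_mult[OF idem_hom_C[OF P_diagonal] module_atD] .

lemma idem_module_eq_zero:
  "x \<in> T \<Longrightarrow> x \<notin> crossed T M \<Longrightarrow> u \<in> module_at n T M \<Longrightarrow> idem n (P x) \<otimes>\<^bsub>Q\<^esub> u = \<zero>\<^bsub>Q\<^esub>"
  using hom_C_eq_zero[OF _ M _ idem_module] T by (auto simp: crossed_def)

lemma module_decompose:
  assumes "u \<in> module_at n T M" "\<zero>\<^bsub>Q\<^esub> \<in> U" "\<And>v w. v \<in> U \<Longrightarrow> w \<in> U \<Longrightarrow> v \<oplus>\<^bsub>Q\<^esub> w \<in> U"
    and "\<And>x. x \<in> crossed T M \<Longrightarrow> idem n (P x) \<otimes>\<^bsub>Q\<^esub> u \<in> U"
  shows "u \<in> U"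
proof (rule hom_C_decompose[OF _ _ module_atD[OF assms(1)] assms(2,3)])
  show "finite (P ` T)" using T finite_diagonals finite_subset by blast
  show "P ` T \<subseteq> diagonals n" using P_diagonal by blast
  fix z assume "z \<in> P ` T"
  then show "idem n z \<otimes>\<^bsub>Q\<^esub> u \<in> U"
    using assms idem_module_eq_zero by fastforce
qed

lemma hom_P_P:
  assumes "x \<in> T" "y \<in> T" "x \<noteq> y" "\<not> below x y" "b \<in> hom_C n {P x} {P y}"
  shows "b = \<zero>\<^bsub>Q\<^esub>"
  using assms hom_C_eq_zero[of x n "P y"] crosses_tau_inv_imp_below[of x n y] T noncrossing
    tau_inv_diagonal[of y n] by blast

text \<open>A map from the projective at x to the one at y can be nonzero only for x = y or x below
  y. The action therefore never produces a component outside a lower set.\<close>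

lemma supported_submodule:
  assumes S: "S \<in> lower_sets T M"
  shows "supported S \<in> submodules n T M"
proof -
  interpret ring Q by (rule ring_mesh_algebra)
  have c: "u \<in> carrier Q" if "u \<in> module_at n T M" for u
    using module_atD[OF that] by (rule hom_C_carrier)
  have sm: "idem n (P x) \<otimes>\<^bsub>Q\<^esub> smul n a u = smul n a (idem n (P x) \<otimes>\<^bsub>Q\<^esub> u)"
    if "x \<in> T" "u \<in> module_at n T M" for x a u
    using smul_mult_right[OF idem_P c] that .
  have zero: "\<zero>\<^bsub>Q\<^esub> \<in> supported S"
    unfolding supported_def using hom_C_zero idem_P by (auto simp: module_at_def crossed_def)
  have add: "u \<oplus>\<^bsub>Q\<^esub> v \<in> supported S" if "u \<in> supported S" "v \<in> supported S" for u v
    using that hom_C_add[of u] idem_P c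
    by (auto simp: supported_def module_at_def crossed_def r_distr)
  have ideal: "b \<otimes>\<^bsub>Q\<^esub> u \<in> supported S" if b: "b \<in> cluster_tilted n T" and u: "u \<in> supported S" for b u
  proof -
    have um: "u \<in> module_at n T M" using u by (simp add: supported_def)
    have bc: "b \<in> carrier Q" using b by (auto simp: cluster_tilted_def intro: hom_C_carrier)
    have "idem n (P x) \<otimes>\<^bsub>Q\<^esub> (b \<otimes>\<^bsub>Q\<^esub> u) = \<zero>\<^bsub>Q\<^esub>" if x: "x \<in> crossed T M - S" for x
    proof -
      have xT: "x \<in> T" using x by (simp add: crossed_def)
      let ?b = "idem n (P x) \<otimes>\<^bsub>Q\<^esub> b"
      have bx: "?b \<in> hom_C n {P x} (P ` T)"
        using b hom_C_mult[OF idem_hom_C[OF P_diagonal[OF xT]]]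
        by (auto simp: cluster_tilted_def pos_P_def[abs_def])
      then have bxc: "?b \<in> carrier Q" by (rule hom_C_carrier)
      \<comment> \<open>The element u is split into its components: at y in S the block of b between
        x and y is zero, and at the other y the component of u is zero.\<close>
      have "u \<in> {v \<in> carrier Q. ?b \<otimes>\<^bsub>Q\<^esub> v = \<zero>\<^bsub>Q\<^esub>}"
      proof (rule module_decompose[OF um])
        fix y assume y: "y \<in> crossed T M"
        then have yT: "y \<in> T" by (simp add: crossed_def)
        have e: "idem n (P y) \<otimes>\<^bsub>Q\<^esub> u \<in> carrier Q" using idem_P[OF yT] c[OF um] by simp
        have "?b \<otimes>\<^bsub>Q\<^esub> (idem n (P y) \<otimes>\<^bsub>Q\<^esub> u) = \<zero>\<^bsub>Q\<^esub>"
        proof (cases "y \<in> S")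
          case True
          have "x \<noteq> y" "\<not> below x y"
            using True x S by (auto simp: lower_sets_def)
          moreover have "?b \<otimes>\<^bsub>Q\<^esub> idem n (P y) \<in> hom_C n {P x} {P y}"
            using hom_C_mult[OF bx idem_hom_C[OF P_diagonal[OF yT]]] .
          ultimately have "?b \<otimes>\<^bsub>Q\<^esub> idem n (P y) = \<zero>\<^bsub>Q\<^esub>"
            using hom_P_P xT yT by blast
          then show ?thesis using bxc idem_P[OF yT] c[OF um] by (simp flip: m_assoc)
        next
          case False
          then have "idem n (P y) \<otimes>\<^bsub>Q\<^esub> u = \<zero>\<^bsub>Q\<^esub>" using y u by (simp add: supported_def)
          then show ?thesis using bxc by simp
        qed
        then show "idem n (P y) \<otimes>\<^bsub>Q\<^esub> u \<in> {v \<in> carrier Q. ?b \<otimes>\<^bsub>Q\<^esub> v = \<zero>\<^bsub>Q\<^esub>}" using e by simp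
      qed (use bxc in \<open>auto simp: r_distr\<close>)
      then show ?thesis using idem_P[OF xT] bc c[OF um] by (simp add: m_assoc)
    qed
    moreover have "b \<otimes>\<^bsub>Q\<^esub> u \<in> module_at n T M"
      using b um hom_C_mult by (auto simp: cluster_tilted_def module_at_def)
    ultimately show ?thesis by (simp add: supported_def)
  qed
  have "additive_subgroup (supported S) Q"
  proof (rule additive_subgroup_mesh_algebraI[OF _ zero add])
    show "supported S \<subseteq> carrier Q" using c by (auto simp: supported_def)
    fix u assume "u \<in> supported S"
    then show "smul n (-1) u \<in> supported S"
      using hom_C_smul[of u n _ _ "-1"]
      by (auto simp: supported_def sm smul_zero crossed_def) (auto simp: module_at_def)
  qed
  then show ?thesis using ideal by (auto simp: submodules_def supported_def)
qed

text \<open>Each component of the module is a line, so a submodule contains all of it or nothing but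
  zero. The count is therefore the same for all fields.\<close>

lemma card_submodules:
  "card (submodules n T M :: (seg list \<Rightarrow> 'k) set set set) = card (lower_sets T M)"
proof -
  interpret ring Q by (rule ring_mesh_algebra)
  have "\<forall>x\<in>crossed T M. \<exists>m\<in>hom_C n {P x} {M}. m \<noteq> \<zero>\<^bsub>Q\<^esub> \<and>
      (\<forall>h\<in>hom_C n {P x} {M}. \<exists>a. h = smul n a m)"
  proof
    fix x assume "x \<in> crossed T M"
    then have "x \<in> diagonals n" "crosses x M" using T by (auto simp: crossed_def)
    then obtain m :: "(seg list \<Rightarrow> 'k) set" where "m \<in> hom_C n {P x} {M}" "m \<noteq> \<zero>\<^bsub>Q\<^esub>"
      "\<And>h. h \<in> hom_C n {P x} {M} \<Longrightarrow> \<exists>a. h = smul n a m"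
      using hom_basis[OF _ M] by metis
    then show "\<exists>m\<in>hom_C n {P x} {M}. m \<noteq> \<zero>\<^bsub>Q\<^esub> \<and> (\<forall>h\<in>hom_C n {P x} {M}. \<exists>a. h = smul n a m)"
      by blast
  qed
  then obtain m where m: "\<And>x. x \<in> crossed T M \<Longrightarrow> m x \<in> hom_C n {P x} {M}"
      "\<And>x. x \<in> crossed T M \<Longrightarrow> m x \<noteq> \<zero>\<^bsub>Q\<^esub>"
      "\<And>x h. x \<in> crossed T M \<Longrightarrow> h \<in> hom_C n {P x} {M} \<Longrightarrow> \<exists>a. h = smul n a (m x)"
    by metis
  have crossed_T: "x \<in> T" if "x \<in> crossed T M" for x using that by (simp add: crossed_def)
  have mc: "m x \<in> carrier Q" if "x \<in> crossed T M" for x using m(1)[OF that] by (rule hom_C_carrier)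
  have mm: "m x \<in> module_at n T M" if "x \<in> crossed T M" for x
    using that m(1) crossed_T module_atI by blast
  \<comment> \<open>The idempotents at other positions annihilate \<open>m x\<close>, so this vector
    tests x alone; injectivity of \<open>supported\<close> follows.\<close>
  have mem: "m x \<in> supported S \<longleftrightarrow> x \<in> S" if x: "x \<in> crossed T M" for x S
  proof -
    have "idem n (P y) \<otimes>\<^bsub>Q\<^esub> m x = (if y = x then m x else \<zero>\<^bsub>Q\<^esub>)" if "y \<in> crossed T M" for y
    proof -
      have "P y = P x \<longleftrightarrow> y = x" using tau_inv_inj crossed_T x that T by blast
      then show ?thesis using idem_mult_left[OF P_diagonal m(1)[OF x]] crossed_T that by simp
    qed
    then show ?thesis using m(2)[OF x] mm[OF x] x by (auto simp: supported_def)
  qed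
  have sub: "S \<subseteq> crossed T M" if "S \<in> lower_sets T M" for S
    using that by (simp add: lower_sets_def)
  have "inj_on supported (lower_sets T M)"
  proof (rule inj_onI)
    fix S S' assume "S \<in> lower_sets T M" "S' \<in> lower_sets T M" "supported S = supported S'"
    then show "S = S'" using mem sub by blast
  qed
  moreover have "supported ` lower_sets T M = (submodules n T M :: (seg list \<Rightarrow> 'k) set set set)"
  proof (intro equalityI subsetI)
    fix U :: "(seg list \<Rightarrow> 'k) set set" assume U: "U \<in> submodules n T M"
    note U' = additive_subgroup_submodule[OF U]
    define S where "S = {x \<in> crossed T M. m x \<in> U}"
    \<comment> \<open>Division by the nonzero scalar a is an action of the algebra, by a multiple of
      the idempotent at \<open>P x\<close>.\<close>
    have span: "m x \<in> U" if x: "x \<in> crossed T M" and u: "smul n a (m x) \<in> U" "smul n a (m x) \<noteq> \<zero>\<^bsub>Q\<^esub>" for x a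
    proof -
      have a: "a \<noteq> 0" using u(2) smul_0[OF mc[OF x]] by auto
      have e: "smul n (inverse a) (idem n (P x)) \<in> cluster_tilted n T"
        using x crossed_T by (intro cluster_tiltedI[of x x] hom_C_smul idem_hom_C P_diagonal)
      have "smul n (inverse a) (idem n (P x)) \<otimes>\<^bsub>Q\<^esub> smul n a (m x) =
          idem n (P x) \<otimes>\<^bsub>Q\<^esub> m x"
        using mc[OF x] idem_P[OF crossed_T[OF x]] a
        by (simp add: smul_mult_left smul_mult_right smul_smul smul_carrier smul_1)
      also have "\<dots> = m x"
        using idem_mult_left[OF P_diagonal m(1)[OF x]] x crossed_T by simp
      finally show ?thesis using U'(4)[OF e u(1)] by simp
    qed
    have idemU: "idem n (P x) \<otimes>\<^bsub>Q\<^esub> u \<in> U" if "x \<in> T" "u \<in> U" for x u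
      using that U'(4) cluster_tiltedI idem_hom_C P_diagonal by blast
    have "S \<in> lower_sets T M"
      unfolding lower_sets_def
    proof (intro CollectI conjI ballI impI)
      show "S \<subseteq> crossed T M" by (auto simp: S_def)
      fix y x assume y: "y \<in> S" and x: "x \<in> crossed T M" and xy: "below x y"
      have y': "y \<in> crossed T M" "m y \<in> U" using y by (auto simp: S_def)
      have "x \<in> diagonals n" "y \<in> diagonals n" "crosses x M" "crosses y M"
        using x y' T by (auto simp: crossed_def)
      then obtain b h :: "(seg list \<Rightarrow> 'k) set" where b: "b \<in> hom_C n {P x} {P y}"
        and h: "h \<in> hom_C n {P y} {M}" "b \<otimes>\<^bsub>Q\<^esub> h \<noteq> \<zero>\<^bsub>Q\<^esub>"
        using below_composite[OF _ _ M xy] by metis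
      obtain a where a: "h = smul n a (m y)" using m(3)[OF y'(1) h(1)] by blast
      have "b \<otimes>\<^bsub>Q\<^esub> h = smul n a b \<otimes>\<^bsub>Q\<^esub> m y"
        using mc[OF y'(1)] hom_C_carrier[OF b] by (simp add: a smul_mult_left smul_mult_right)
      moreover have "smul n a b \<in> cluster_tilted n T"
        using b crossed_T x y' by (intro cluster_tiltedI[of x y] hom_C_smul)
      ultimately have "b \<otimes>\<^bsub>Q\<^esub> h \<in> U" using U'(4) y'(2) by simp
      moreover obtain a' where "b \<otimes>\<^bsub>Q\<^esub> h = smul n a' (m x)"
        using m(3)[OF x hom_C_mult[OF b h(1)]] by blast
      ultimately have "m x \<in> U" using span[OF x] h(2) by metis
      then show "x \<in> S" using x by (simp add: S_def)
    qed
    moreover have "U = supported S"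
    proof (intro equalityI subsetI)
      fix u assume u: "u \<in> U"
      then have um: "u \<in> module_at n T M" using U'(1) by blast
      have "idem n (P x) \<otimes>\<^bsub>Q\<^esub> u = \<zero>\<^bsub>Q\<^esub>" if x: "x \<in> crossed T M - S" for x
      proof (rule ccontr)
        assume nz: "idem n (P x) \<otimes>\<^bsub>Q\<^esub> u \<noteq> \<zero>\<^bsub>Q\<^esub>"
        have xc: "x \<in> crossed T M" using x by simp
        obtain a where "idem n (P x) \<otimes>\<^bsub>Q\<^esub> u = smul n a (m x)"
          using m(3)[OF xc idem_module[OF crossed_T[OF xc] um]] by blast
        then have "m x \<in> U" using span[OF xc] nz idemU[OF crossed_T[OF xc] u] by metis
        then show False using x by (simp add: S_def)
      qed
      then show "u \<in> supported S" using um by (simp add: supported_def)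
    next
      fix u assume u: "u \<in> supported S"
      then have um: "u \<in> module_at n T M" by (simp add: supported_def)
      show "u \<in> U"
      proof (rule module_decompose[OF um U'(2,3)])
        fix x assume x: "x \<in> crossed T M"
        show "idem n (P x) \<otimes>\<^bsub>Q\<^esub> u \<in> U"
        proof (cases "x \<in> S")
          case True
          then have "m x \<in> U" by (simp add: S_def)
          moreover obtain a where "idem n (P x) \<otimes>\<^bsub>Q\<^esub> u = smul n a (m x)"
            using m(3)[OF x idem_module[OF crossed_T[OF x] um]] by blast
          moreover have "smul n a (m x) = smul n a (idem n (P x)) \<otimes>\<^bsub>Q\<^esub> m x" for a
            using idem_mult_left[OF P_diagonal m(1)[OF x]] x crossed_T mc idem_P
            by (simp add: smul_mult_left)
          moreover have "smul n a (idem n (P x)) \<in> cluster_tilted n T" for a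
            using x crossed_T by (intro cluster_tiltedI[of x x] hom_C_smul idem_hom_C P_diagonal)
          ultimately show ?thesis using U'(4) by metis
        next
          case False
          then show ?thesis using u x U'(2) by (simp add: supported_def)
        qed
      qed
    qed
    ultimately show "U \<in> supported ` lower_sets T M" by blast
  qed (use supported_submodule in auto)
  ultimately show ?thesis
    using bij_betw_same_card[of supported "lower_sets T M" "submodules n T M"]
    by (simp add: bij_betw_def)
qed

end

text \<open>As in the Yoneda lemma, a homomorphism out of the projective at x is determined by the
  image of the idempotent, which lies in a morphism space that vanishes unless x crosses M.
  Conversely, right multiplication by a nonzero morphism is such a homomorphism.\<close>

lemma region_eq:
  fixes K :: "'k::field itself"
  assumes T: "T \<subseteq> diagonals n" and x: "x \<in> T"
  shows "region K n T x = {M \<in> diagonals n - T. crosses x M}"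
proof -
  let ?Q = "mesh_algebra n :: (seg list \<Rightarrow> 'k) set ring"
  interpret ring ?Q by (rule ring_mesh_algebra)
  let ?P = "tau_inv n x" and ?A = "\<lambda>M. module_at n T M :: (seg list \<Rightarrow> 'k) set set"
  have xd: "x \<in> diagonals n" "x \<notin> boundary n" using T x by (auto simp: diagonals_def)
  have Pd: "?P \<in> diagonals n" using xd(1) by (rule tau_inv_diagonal)
  have PT: "?P \<in> pos_P n ` T" using x by (simp add: pos_P_def)
  have carr: "u \<in> carrier ?Q" if "u \<in> ?A M" for u M
    using that by (auto simp: module_at_def intro: hom_C_carrier)
  have idA: "idem n ?P \<in> ?A ?P" "idem n ?P \<in> (cluster_tilted n T :: (seg list \<Rightarrow> 'k) set set)"
    using idem_hom_C[OF Pd] PT by (auto simp: module_at_def cluster_tilted_def intro: hom_C_mono)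
  have "(\<exists>h \<in> module_homs n T ?P M. \<exists>u \<in> ?A ?P. h u \<noteq> \<zero>\<^bsub>?Q\<^esub>) \<longleftrightarrow> crosses x M"
    if M: "M \<in> diagonals n" for M
  proof
    assume "\<exists>h \<in> module_homs n T ?P M. \<exists>u \<in> ?A ?P. h u \<noteq> \<zero>\<^bsub>?Q\<^esub>"
    then obtain h u where h: "h \<in> module_homs n T ?P M" and u: "u \<in> ?A ?P" "h u \<noteq> \<zero>\<^bsub>?Q\<^esub>" by blast
    have lin: "h (b \<otimes>\<^bsub>?Q\<^esub> v) = b \<otimes>\<^bsub>?Q\<^esub> h v" if "b \<in> cluster_tilted n T" "v \<in> ?A ?P" for b v
      using h that by (simp add: module_homs_def)
    have "idem n ?P \<otimes>\<^bsub>?Q\<^esub> idem n ?P = idem n ?P"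
      using idem_mult_left[OF Pd idem_hom_C[OF Pd]] by simp
    then have "h (idem n ?P) = idem n ?P \<otimes>\<^bsub>?Q\<^esub> h (idem n ?P)" using lin[OF idA(2,1)] by simp
    moreover have "h (idem n ?P) \<in> ?A M" using h idA(1) by (auto simp: module_homs_def)
    ultimately have hP: "h (idem n ?P) \<in> hom_C n {?P} {M}"
      using hom_C_mult[OF idem_hom_C[OF Pd]] unfolding module_at_def by metis
    have "u \<in> cluster_tilted n T" using u(1) PT
      by (auto simp: module_at_def cluster_tilted_def intro: hom_C_mono)
    moreover have "u \<otimes>\<^bsub>?Q\<^esub> idem n ?P = u"
      using u(1) idem_mult_right[OF Pd] by (auto simp: module_at_def)
    ultimately have "h u = u \<otimes>\<^bsub>?Q\<^esub> h (idem n ?P)" using lin idA(1) by metis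
    then show "crosses x M"
      using u hom_C_eq_zero[OF xd(1) M _ hP] carr[OF u(1)] by auto
  next
    assume c: "crosses x M"
    obtain m :: "(seg list \<Rightarrow> 'k) set" where m: "m \<in> hom_C n {?P} {M}" "m \<noteq> \<zero>\<^bsub>?Q\<^esub>"
      using hom_basis[OF xd(1) M c] by metis
    have mc: "m \<in> carrier ?Q" using m(1) by (rule hom_C_carrier)
    let ?h = "\<lambda>u\<in>?A ?P. u \<otimes>\<^bsub>?Q\<^esub> m"
    have add: "u \<oplus>\<^bsub>?Q\<^esub> v \<in> ?A ?P" if "u \<in> ?A ?P" "v \<in> ?A ?P" for u v
      using that hom_C_add by (simp add: module_at_def)
    have act: "b \<otimes>\<^bsub>?Q\<^esub> u \<in> ?A ?P" "b \<in> carrier ?Q" if "b \<in> cluster_tilted n T" "u \<in> ?A ?P" for b u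
      using that hom_C_mult hom_C_carrier by (auto simp: module_at_def cluster_tilted_def)
    have "?h \<in> module_homs n T ?P M"
      unfolding module_homs_def
    proof (intro CollectI conjI ballI)
      show "?h \<in> ?A ?P \<rightarrow>\<^sub>E ?A M"
        using hom_C_mult[OF _ m(1)] by (auto simp: module_at_def)
    qed (simp_all add: add act carr mc l_distr m_assoc)
    moreover have "?h (idem n ?P) = m"
      using idA(1) idem_mult_left[OF Pd m(1)] by simp
    ultimately show "\<exists>h \<in> module_homs n T ?P M. \<exists>u \<in> ?A ?P. h u \<noteq> \<zero>\<^bsub>?Q\<^esub>"
      using m(2) idA(1) by metis
  qed
  then show ?thesis using xd(2) by (auto simp: region_def pos_P_def)
qed

text \<open>The value 1 prescribed for friezes on T and on the boundary is the number of lower sets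
  of an empty chain, so \<open>rho\<close> becomes uniform.\<close>

lemma lower_sets_uncrossed:
  assumes T: "T \<subseteq> diagonals n" "\<And>x y. x \<in> T \<Longrightarrow> y \<in> T \<Longrightarrow> \<not> crosses x y"
    and M: "M \<in> segments n" "M \<in> T \<union> boundary n"
  shows "lower_sets T M = {{}}"
proof -
  have "crossed T M = {}"
  proof (cases "M \<in> T")
    case False
    then have "M \<notin> diagonals n" using M(2) by (auto simp: diagonals_def)
    then show ?thesis
      using crosses_imp_diagonal[of _ M n] T(1) M(1) by (auto simp: crossed_def diagonals_def)
  qed (use T(2) in \<open>auto simp: crossed_def\<close>)
  then show ?thesis by (auto simp: lower_sets_def)
qed

lemma rho_eq:
  assumes T: "T \<subseteq> diagonals n" "\<And>x y. x \<in> T \<Longrightarrow> y \<in> T \<Longrightarrow> \<not> crosses x y"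
    and M: "M \<in> segments n"
  shows "rho K n T M = int (card (lower_sets T M))"
proof (cases "M \<in> T \<union> boundary n")
  case True
  then show ?thesis using lower_sets_uncrossed[OF T M True] by (simp add: rho_def)
next
  case False
  then have "M \<in> diagonals n" using M by (simp add: diagonals_def)
  then show ?thesis using False card_submodules[OF T, of M] by (simp add: rho_def)
qed

section \<open>The Ptolemy relation\<close>

text \<open>A lower set without z omits everything above z, and one with z contains everything below
  z. Transitivity ensures that the remaining choices are free lower sets of what is left.\<close>

lemma card_lower_sets_split:
  fixes R :: "'a \<Rightarrow> 'a \<Rightarrow> bool"
  defines "L \<equiv> \<lambda>X. {S. S \<subseteq> X \<and> (\<forall>y\<in>S. \<forall>x\<in>X. R x y \<longrightarrow> x \<in> S)}"
  assumes "finite X" "z \<in> X"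
    and trans: "\<And>x y w. x \<in> X \<Longrightarrow> y \<in> X \<Longrightarrow> w \<in> X \<Longrightarrow> R x y \<Longrightarrow> R y w \<Longrightarrow> R x w"
  shows "card (L X) = card (L {x \<in> X. x \<noteq> z \<and> \<not> R z x}) + card (L {x \<in> X. x \<noteq> z \<and> \<not> R x z})"
    (is "_ = card (L ?A) + card (L ?B)")
proof -
  have fin: "finite (L Y)" if "Y \<subseteq> X" for Y
    using finite_subset[OF that assms(2)] by (auto simp: L_def intro: finite_subset[of _ "Pow Y"])
  have "L X = L ?A \<union> (\<lambda>S. S \<union> (X - ?B)) ` L ?B"
  proof (intro equalityI subsetI)
    fix S assume S: "S \<in> L X"
    show "S \<in> L ?A \<union> (\<lambda>S. S \<union> (X - ?B)) ` L ?B"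
    proof (cases "z \<in> S")
      case True
      then have "S = (S \<inter> ?B) \<union> (X - ?B)" "S \<inter> ?B \<in> L ?B"
        using S by (auto simp: L_def)
      then show ?thesis by blast
    next
      case False
      then have "S \<in> L ?A" using S assms(3) by (auto simp: L_def)
      then show ?thesis by blast
    qed
  next
    fix S assume "S \<in> L ?A \<union> (\<lambda>S. S \<union> (X - ?B)) ` L ?B"
    then consider "S \<in> L ?A" | S' where "S' \<in> L ?B" "S = S' \<union> (X - ?B)" by blast
    then show "S \<in> L X"
    proof cases
      case 1
      then have sub: "S \<subseteq> ?A" and low: "\<And>y x. y \<in> S \<Longrightarrow> x \<in> ?A \<Longrightarrow> R x y \<Longrightarrow> x \<in> S"
        by (auto simp: L_def)
      have "x \<in> S" if "y \<in> S" "x \<in> X" "R x y" for x y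
        using that sub low[OF that(1), of x] trans[OF assms(3), of x y] by blast
      then show ?thesis using sub by (auto simp: L_def)
    next
      case 2
      then have sub: "S' \<subseteq> ?B" and low: "\<And>y x. y \<in> S' \<Longrightarrow> x \<in> ?B \<Longrightarrow> R x y \<Longrightarrow> x \<in> S'"
        by (auto simp: L_def)
      have "x \<in> S" if "y \<in> S" "x \<in> X" "R x y" for x y
        using that sub low[of y x] trans[OF that(2) _ assms(3), of y] 2(2) by blast
      then show ?thesis using sub 2(2) by (auto simp: L_def)
    qed
  qed
  moreover have "L ?A \<inter> (\<lambda>S. S \<union> (X - ?B)) ` L ?B = {}"
    using assms(3) by (auto simp: L_def)
  moreover have "inj_on (\<lambda>S. S \<union> (X - ?B)) (L ?B)"
    by (auto simp: inj_on_def L_def)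
  ultimately show ?thesis
    using fin[of ?A] fin[of ?B] by (simp add: card_Un_disjoint card_image)
qed

lemma card_lower_sets_Un:
  fixes R :: "'a \<Rightarrow> 'a \<Rightarrow> bool"
  defines "L \<equiv> \<lambda>X. {S. S \<subseteq> X \<and> (\<forall>y\<in>S. \<forall>x\<in>X. R x y \<longrightarrow> x \<in> S)}"
  assumes "A \<inter> B = {}" "\<And>x y. x \<in> A \<Longrightarrow> y \<in> B \<Longrightarrow> \<not> R x y \<and> \<not> R y x"
  shows "card (L (A \<union> B)) = card (L A) * card (L B)"
proof -
  have "bij_betw (\<lambda>(S, S'). S \<union> S') (L A \<times> L B) (L (A \<union> B))"
  proof (rule bij_betwI[where g = "\<lambda>S. (S \<inter> A, S \<inter> B)"])
    show "(\<lambda>(S, S'). S \<union> S') \<in> L A \<times> L B \<rightarrow> L (A \<union> B)"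
      using assms(3) unfolding L_def by (auto 0 3)
    show "(\<lambda>S. (S \<inter> A, S \<inter> B)) \<in> L (A \<union> B) \<rightarrow> L A \<times> L B"
      unfolding L_def by auto
  qed (use assms(2) in \<open>auto simp: L_def\<close>)
  then show ?thesis by (metis bij_betw_same_card card_cartesian_product)
qed

text \<open>With the value \<open>0\<close> for \<open>i = j\<close> the Ptolemy relation also holds in the degenerate cases.\<close>

definition count :: "seg set \<Rightarrow> nat \<Rightarrow> nat \<Rightarrow> int" where
  "count T i j = (if i = j then 0 else int (card (lower_sets T {i, j})))"

lemma count_commute: "count T i j = count T j i"
  by (simp add: count_def insert_commute)

section \<open>Relabelling by clockwise distance from a vertex\<close>

lemma cw_less_iff:
  assumes "i < n + 3" "a < n + 3" "b < n + 3"
  shows "cw n i a < cw n i b \<longleftrightarrow> i \<le> a \<and> i \<le> b \<and> a < b \<or> a < i \<and> b < i \<and> a < b \<or> i \<le> a \<and> b < i"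
  using assms by (cases "i \<le> a"; cases "i \<le> b") (simp_all add: cw_eq, linarith+)

text \<open>Measuring clockwise from i rotates the labels so that i becomes 0, and rotations
  preserve cyclic order.\<close>

lemma cyc_cw:
  assumes "i < n + 3" "a < n + 3" "b < n + 3" "c < n + 3"
  shows "cyc a b c \<longleftrightarrow> cyc (cw n i a) (cw n i b) (cw n i c)"
  unfolding cyc_def cw_less_iff[OF assms(1,2,3)] cw_less_iff[OF assms(1,3,4)] cw_less_iff[OF assms(1,4,2)]
  by (cases "i \<le> a"; cases "i \<le> b"; cases "i \<le> c") auto

lemma cw_inj: "i < n + 3 \<Longrightarrow> a < n + 3 \<Longrightarrow> b < n + 3 \<Longrightarrow> cw n i a = cw n i b \<longleftrightarrow> a = b"
  by (auto simp: cw_eq split: if_splits)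

lemma crosses_cw:
  assumes "i < n + 3" "a < n + 3" "b < n + 3" "c < n + 3" "d < n + 3"
    "cw n i a < cw n i b" "cw n i c < cw n i d"
  shows "crosses {a, b} {c, d} \<longleftrightarrow>
    cw n i a < cw n i c \<and> cw n i c < cw n i b \<and> cw n i b < cw n i d \<or>
    cw n i c < cw n i a \<and> cw n i a < cw n i d \<and> cw n i d < cw n i b"
  using assms(6,7) unfolding crosses_pair
    cyc_cw[OF assms(1,2,4,3)] cyc_cw[OF assms(1,3,5,2)] cyc_cw[OF assms(1,2,5,3)] cyc_cw[OF assms(1,3,4,2)]
  by (auto simp: cyc_def)

text \<open>Besides [k,l], each member of the chain either encloses [k,l] or is enclosed by it.
  Omitting [k,l] leaves the enclosing ones that cross [i,l] and the enclosed ones that cross [k,j];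
  including it leaves those crossing [i,k] and [j,l]. In both cases the two kinds share no endpoint,
  so their lower sets are chosen independently.\<close>

lemma ptolemy_diagonal:
  assumes T: "T \<subseteq> diagonals n" and nc: "\<And>x y. x \<in> T \<Longrightarrow> y \<in> T \<Longrightarrow> \<not> crosses x y"
    and kl: "{k, l} \<in> T" and ij: "i < n + 3" "j < n + 3" "cyc i k j" "cyc j l i"
  shows "card (lower_sets T {i, j}) =
    card (lower_sets T {i, k}) * card (lower_sets T {j, l}) +
    card (lower_sets T {i, l}) * card (lower_sets T {j, k})"
proof -
  \<comment> \<open>Counting clockwise from \<open>i\<close> makes the diagonals crossing \<open>[i,j]\<close> a chain of nested intervals.\<close>
  define p where "p = cw n i"
  have kl_less: "k < n + 3" "l < n + 3" using kl T diagonals_pair by blast+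
  have p0: "p i = 0" using ij(1) by (simp add: p_def cw_eq)
  have ord: "0 < p k" "p k < p j" "p j < p l"
    using ij(3,4) p0 unfolding cyc_cw[OF ij(1) ij(1) kl_less(1) ij(2)] cyc_cw[OF ij(1) ij(2) kl_less(2) ij(1)]
    by (auto simp: cyc_def p_def)
  have inj: "p a = p b \<longleftrightarrow> a = b" if "a < n + 3" "b < n + 3" for a b
    using cw_inj[OF ij(1) that] by (simp add: p_def)
  have cr: "crosses {a, b} {c, d} \<longleftrightarrow> p a < p c \<and> p c < p b \<and> p b < p d \<or> p c < p a \<and> p a < p d \<and> p d < p b"
    if "a < n + 3" "b < n + 3" "c < n + 3" "d < n + 3" "p a < p b" "p c < p d" for a b c d
    using crosses_cw[OF ij(1) that(1-4)] that(5,6) by (simp add: p_def)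
  have rep: "\<exists>a b. x = {a, b} \<and> a < n + 3 \<and> b < n + 3 \<and> p a < p b \<and> (p a \<ge> p k \<and> p b \<le> p l \<or> p a \<le> p k \<and> p b \<ge> p l \<or>
      p b \<le> p k \<or> p a \<ge> p l)" if x: "x \<in> T" for x
  proof -
    obtain a b where ab: "x = {a, b}" "a < n + 3" "b < n + 3" "a \<noteq> b"
      using x T by (auto elim!: diagonalE)
    then obtain a b where ab: "x = {a, b}" "a < n + 3" "b < n + 3" "p a < p b"
      using inj[of a b] by (metis insert_commute linorder_neqE_nat)
    have "\<not> crosses {a, b} {k, l}" using nc[OF x kl] ab(1) by simp
    then have "p a \<ge> p k \<and> p b \<le> p l \<or> p a \<le> p k \<and> p b \<ge> p l \<or> p b \<le> p k \<or> p a \<ge> p l"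
      using cr[OF ab(2,3) kl_less ab(4)] ord by linarith
    then show ?thesis using ab by blast
  qed
  let ?X = "crossed T {i, j}"
  define in_X where "in_X x a b \<longleftrightarrow> x \<in> T \<and> x = {a, b} \<and> a < n + 3 \<and> b < n + 3 \<and>
     0 < p a \<and> p a < p j \<and> p j < p b \<and> (p a \<le> p k \<and> p b \<ge> p l \<or> p a \<ge> p k \<and> p b \<le> p l)" for x a b
  have X: "x \<in> ?X \<longleftrightarrow> (\<exists>a b. in_X x a b)" for x
  proof
    assume "x \<in> ?X"
    then have x: "x \<in> T" "crosses x {i, j}" by (auto simp: crossed_def)
    then obtain a b where ab: "x = {a, b}" "a < n + 3" "b < n + 3" "p a < p b"
      "p a \<ge> p k \<and> p b \<le> p l \<or> p a \<le> p k \<and> p b \<ge> p l \<or> p b \<le> p k \<or> p a \<ge> p l" using rep by blast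
    then have "0 < p a \<and> p a < p j \<and> p j < p b"
      using x(2) cr[OF ab(2,3) ij(1,2) ab(4)] p0 ord by auto
    then have "in_X x a b" using x(1) ab ord by (auto simp: in_X_def)
    then show "\<exists>a b. in_X x a b" by blast
  next
    assume "\<exists>a b. in_X x a b"
    then obtain a b where "in_X x a b" by blast
    then show "x \<in> ?X" using cr[of a b i j] ij p0 ord by (auto simp: in_X_def crossed_def)
  qed
  \<comment> \<open>One criterion for [i,k], [i,l], [k,j] and [j,l], to which the last four
    hypotheses confine (u,v). As [k,l] is not crossed, whatever in T crosses one of these already
    crosses [i,j].\<close>
  have ray: "x \<in> crossed T {u, v} \<longleftrightarrow> (\<exists>a b. in_X x a b \<and> Z a b)"
    if "u < n + 3" "v < n + 3" "p u < p v"
      "\<And>a b. in_X {a, b} a b \<Longrightarrow> (p a < p u \<and> p u < p b \<and> p b < p v \<or> p u < p a \<and> p a < p v \<and> p v < p b) \<longleftrightarrow> Z a b"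
      "p u = 0 \<Longrightarrow> p v = p k \<or> p v = p l" "p u = p k \<Longrightarrow> p v = p j" "p u = p j \<Longrightarrow> p v = p l"
      "p u = 0 \<or> p u = p k \<or> p u = p j" for x u v Z
  proof
    assume "x \<in> crossed T {u, v}"
    then have x: "x \<in> T" "crosses x {u, v}" by (auto simp: crossed_def)
    then obtain a b where ab: "x = {a, b}" "a < n + 3" "b < n + 3" "p a < p b"
      "p a \<ge> p k \<and> p b \<le> p l \<or> p a \<le> p k \<and> p b \<ge> p l \<or> p b \<le> p k \<or> p a \<ge> p l" using rep by blast
    have c: "p a < p u \<and> p u < p b \<and> p b < p v \<or> p u < p a \<and> p a < p v \<and> p v < p b"
      using x(2) cr[OF ab(2,3) that(1,2) ab(4) that(3)] ab(1) by simp
    have "in_X x a b"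
      using c ab x(1) ord that(5-8) p0 by (auto simp: in_X_def)
    then show "\<exists>a b. in_X x a b \<and> Z a b" using c that(4)[of a b] ab(1) by blast
  next
    assume "\<exists>a b. in_X x a b \<and> Z a b"
    then obtain a b where "in_X x a b" "Z a b" by blast
    then show "x \<in> crossed T {u, v}"
      using that(4)[of a b] cr[of a b u v] that(1-3) ord by (auto simp: in_X_def crossed_def)
  qed
  have il: "x \<in> crossed T {i, l} \<longleftrightarrow> (\<exists>a b. in_X x a b \<and> p l < p b)" for x
    by (rule ray) (use ij kl_less ord p0 in \<open>auto simp: in_X_def\<close>)
  have ik: "x \<in> crossed T {i, k} \<longleftrightarrow> (\<exists>a b. in_X x a b \<and> p a < p k)" for x
    by (rule ray) (use ij kl_less ord p0 in \<open>auto simp: in_X_def\<close>)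
  have kj: "x \<in> crossed T {k, j} \<longleftrightarrow> (\<exists>a b. in_X x a b \<and> p k < p a)" for x
    by (rule ray) (use ij kl_less ord p0 in \<open>auto simp: in_X_def\<close>)
  have jl: "x \<in> crossed T {j, l} \<longleftrightarrow> (\<exists>a b. in_X x a b \<and> p b < p l)" for x
    by (rule ray) (use ij kl_less ord p0 in \<open>auto simp: in_X_def\<close>)
  have below: "below x y \<longleftrightarrow> p a = p c \<and> p d < p b \<or> p b = p d \<and> p c < p a"
    if xa: "in_X x a b" "in_X y c d" for x y a b c d
  proof -
    have less: "a < n + 3" "b < n + 3" "c < n + 3" "d < n + 3" using xa by (auto simp: in_X_def)
    have *: "below {a, b} {c, d} \<longleftrightarrow> a = c \<and> cyc a d b \<or> b = d \<and> cyc b c a \<or> a = d \<and> cyc a c b \<or> b = c \<and> cyc b d a"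
      unfolding below_def doubleton_eq_iff by auto
    have o: "p a < p j" "p j < p b" "p c < p j" "p j < p d" using xa by (auto simp: in_X_def)
    have cp: "cyc u v w \<longleftrightarrow> cyc (p u) (p v) (p w)" if "u < n + 3" "v < n + 3" "w < n + 3" for u v w
      using cyc_cw[OF ij(1) that] by (simp add: p_def)
    have "a \<noteq> d" "b \<noteq> c" using o by auto
    moreover have "cyc a d b \<longleftrightarrow> p d < p b" if "a = c"
      unfolding cp[OF less(1,4,2)] unfolding cyc_def using o that by auto
    moreover have "cyc b c a \<longleftrightarrow> p c < p a" if "b = d"
      unfolding cp[OF less(2,3,1)] unfolding cyc_def using o that by auto
    moreover have "x = {a, b}" "y = {c, d}" using xa by (auto simp: in_X_def)
    ultimately show ?thesis using * inj[OF less(1,3)] inj[OF less(2,4)] by blast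
  qed
  have uniq: "a = c \<and> b = d" if "in_X x a b" "in_X x c d" for x a b c d
    using that by (auto simp: in_X_def doubleton_eq_iff)
  have nested: "p a \<le> p c \<and> p d \<le> p b \<or> p c \<le> p a \<and> p b \<le> p d" if "in_X x a b" "in_X y c d" for x y a b c d
    using that nc[of x y] cr[of a b c d] unfolding in_X_def by auto
  have z: "in_X {k, l} k l" using kl kl_less ord by (auto simp: in_X_def)
  have "finite T" using T finite_diagonals finite_subset by blast
  then have fin: "finite ?X" by (simp add: crossed_def)
  \<comment> \<open>Links at the same endpoint compose. A link at one endpoint followed by a link at
    the other would make x and w overlap without nesting, which noncrossing excludes.\<close>
  have tr: "below x w" if "x \<in> ?X" "y \<in> ?X" "w \<in> ?X" "below x y" "below y w" for x y w
  proof -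
    from that(1-3) obtain a b c d e f where r: "in_X x a b" "in_X y c d" "in_X w e f"
      unfolding X by blast
    show ?thesis
      using that(4,5) nested[OF r(1,3)] unfolding below[OF r(1,2)] below[OF r(2,3)] below[OF r(1,3)]
      by auto
  qed
  have up: "{x \<in> ?X. x \<noteq> {k, l} \<and> \<not> below {k, l} x} = crossed T {i, l} \<union> crossed T {k, j}"
  proof (rule Set.set_eqI)
    fix x
    show "x \<in> {x \<in> ?X. x \<noteq> {k, l} \<and> \<not> below {k, l} x} \<longleftrightarrow> x \<in> crossed T {i, l} \<union> crossed T {k, j}"
    proof (cases "\<exists>a b. in_X x a b")
      case True
      then obtain a b where ab: "in_X x a b" by blast
      then have ex: "(\<exists>a b. in_X x a b) = True" by blast
      from ab have u: "(\<exists>a b. in_X x a b \<and> Z a b) \<longleftrightarrow> Z a b" for Z using uniq by blast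
      have ne: "x \<noteq> {k, l} \<longleftrightarrow> \<not> (p a = p k \<and> p b = p l)"
        using ab uniq[of x a b k l] z inj kl_less by (auto simp: in_X_def)
      show ?thesis
        unfolding mem_Collect_eq X Un_iff il kj u ne below[OF z ab] ex
        using ab[unfolded in_X_def] by auto
    next
      case False
      then show ?thesis unfolding mem_Collect_eq X Un_iff il kj by blast
    qed
  qed
  have down: "{x \<in> ?X. x \<noteq> {k, l} \<and> \<not> below x {k, l}} = crossed T {i, k} \<union> crossed T {j, l}"
  proof (rule Set.set_eqI)
    fix x
    show "x \<in> {x \<in> ?X. x \<noteq> {k, l} \<and> \<not> below x {k, l}} \<longleftrightarrow> x \<in> crossed T {i, k} \<union> crossed T {j, l}"
    proof (cases "\<exists>a b. in_X x a b")
      case True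
      then obtain a b where ab: "in_X x a b" by blast
      then have ex: "(\<exists>a b. in_X x a b) = True" by blast
      from ab have u: "(\<exists>a b. in_X x a b \<and> Z a b) \<longleftrightarrow> Z a b" for Z using uniq by blast
      have ne: "x \<noteq> {k, l} \<longleftrightarrow> \<not> (p a = p k \<and> p b = p l)"
        using ab uniq[of x a b k l] z inj kl_less by (auto simp: in_X_def)
      show ?thesis
        unfolding mem_Collect_eq X Un_iff ik jl u ne below[OF ab z] ex
        using ab[unfolded in_X_def] by auto
    next
      case False
      then show ?thesis unfolding mem_Collect_eq X Un_iff ik jl by blast
    qed
  qed
  have *: "p a \<le> p k \<and> p d \<le> p l" if "in_X x a b" "p l < p b" "in_X y c d" "p k < p c" for x y a b c d
    using that by (auto simp: in_X_def)
  have sep1_disjoint: "crossed T {i, l} \<inter> crossed T {k, j} = {}"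
    using uniq * unfolding disjoint_iff il kj by (metis linorder_not_le)
  have sep1: "\<not> below x y \<and> \<not> below y x" if xy: "x \<in> crossed T {i, l}" "y \<in> crossed T {k, j}" for x y
  proof -
    obtain a b c d where r: "in_X x a b" "p l < p b" "in_X y c d" "p k < p c"
      using xy unfolding il kj by blast
    show ?thesis using *[OF r] r(2,4) unfolding below[OF r(1,3)] below[OF r(3,1)] by auto
  qed
  have *: "p l \<le> p b \<and> p k \<le> p c" if "in_X x a b" "p a < p k" "in_X y c d" "p d < p l" for x y a b c d
    using that by (auto simp: in_X_def)
  have sep2_disjoint: "crossed T {i, k} \<inter> crossed T {j, l} = {}"
    using uniq * unfolding disjoint_iff ik jl by (metis linorder_not_le)
  have sep2: "\<not> below x y \<and> \<not> below y x" if xy: "x \<in> crossed T {i, k}" "y \<in> crossed T {j, l}" for x y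
  proof -
    obtain a b c d where r: "in_X x a b" "p a < p k" "in_X y c d" "p d < p l"
      using xy unfolding ik jl by blast
    show ?thesis using *[OF r] r(2,4) unfolding below[OF r(1,3)] below[OF r(3,1)] by auto
  qed
  have "{k, l} \<in> ?X" using z X by blast
  from card_lower_sets_split[of ?X "{k, l}" below, OF fin this tr] show ?thesis
    using card_lower_sets_Un[OF sep1_disjoint sep1] card_lower_sets_Un[OF sep2_disjoint sep2]
    unfolding up down by (simp add: lower_sets_def insert_commute)
qed

section \<open>The quadrilateral around the flipped diagonal\<close>

definition in_arc :: "nat \<Rightarrow> nat \<Rightarrow> nat \<Rightarrow> bool" where
  "in_arc a b i \<longleftrightarrow> i = a \<or> i = b \<or> cyc a i b"

lemma cyc_rotate: "cyc a b c \<Longrightarrow> cyc b c a"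
  by (auto simp: cyc_def)

lemma cyc_trans: "cyc a b c \<Longrightarrow> cyc a c d \<Longrightarrow> cyc a b d \<and> cyc b c d"
  by (auto simp: cyc_def)

lemma cyc_split: "cyc a i c \<Longrightarrow> cyc a b c \<Longrightarrow> i = b \<or> cyc a i b \<or> cyc b i c"
  by (auto simp: cyc_def)

lemma in_arc_not_cyc: "cyc a b c \<Longrightarrow> in_arc a b i \<or> in_arc b c i \<Longrightarrow> \<not> cyc c i a"
  by (auto simp: cyc_def in_arc_def)

lemma in_arc_extend: "cyc a b c \<Longrightarrow> in_arc a b i \<or> in_arc b c i \<Longrightarrow> in_arc a c i"
  by (auto simp: cyc_def in_arc_def)

lemma cyc_in_arc: "cyc a b c \<Longrightarrow> in_arc a c b"
  by (simp add: in_arc_def)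

lemma in_arc_disjoint:
  assumes "cyc a b c" "cyc c d a" "in_arc a b i" "in_arc c d j"
  shows "i \<noteq> j"
proof
  assume "i = j"
  then have "in_arc a c i" "in_arc c a i"
    using in_arc_extend[OF assms(1)] in_arc_extend[OF assms(2)] assms(3,4) by blast+
  then have "i = a \<or> i = c" by (auto simp: in_arc_def cyc_def)
  then show False using assms \<open>i = j\<close> by (auto simp: in_arc_def cyc_def)
qed

section \<open>Arcs and projections in terms of cyclic order\<close>

lemma mem_open_arc:
  "a < n + 3 \<Longrightarrow> b < n + 3 \<Longrightarrow> a \<noteq> b \<Longrightarrow> v \<in> open_arc n a b \<longleftrightarrow> v < n + 3 \<and> cyc a v b"
  by (auto simp: open_arc_def cw_eq cyc_def split: if_splits)

lemma mem_closed_arc: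
  "a < n + 3 \<Longrightarrow> b < n + 3 \<Longrightarrow> a \<noteq> b \<Longrightarrow> v \<in> closed_arc n a b \<longleftrightarrow> v < n + 3 \<and> in_arc a b v"
  by (auto simp: closed_arc_def in_arc_def cw_eq cyc_def split: if_splits)

lemma proj_pair: "i \<in> A \<Longrightarrow> j \<notin> A \<Longrightarrow> proj A v {i, j} = {i, v}"
proof -
  assume "i \<in> A" "j \<notin> A"
  then have "(THE i'. i' \<in> {i, j} \<and> i' \<in> A) = i" by (intro the_equality) auto
  then show ?thesis by (simp add: proj_def)
qed

lemma proj_pair': "j \<in> A \<Longrightarrow> i \<notin> A \<Longrightarrow> proj A v {i, j} = {j, v}"
  using proj_pair[of j A i v] by (simp add: insert_commute)

text \<open>One of the two sides of a boundary segment contains no vertex.\<close>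

lemma boundary_arc:
  assumes "{k, l} \<in> boundary n" "k < n + 3" "l < n + 3" "i < n + 3" "j < n + 3" "cyc l i k" "cyc k j l"
  shows False
  using assms(1) assms(4-7) unfolding boundary_pair[OF assms(2,3)]
  using assms(2,3) by (elim disjE) (auto simp: pred_v_eq cyc_def split: if_splits)

context
  fixes n :: nat and T :: "seg set"
  assumes T: "T \<subseteq> diagonals n" and nc: "\<And>x y. x \<in> T \<Longrightarrow> y \<in> T \<Longrightarrow> \<not> crosses x y"
begin

lemma rho_count: "i < n + 3 \<Longrightarrow> j < n + 3 \<Longrightarrow> i \<noteq> j \<Longrightarrow> rho K n T {i, j} = count T i j"
  using rho_eq[OF T nc, of "{i, j}" K] by (simp add: count_def segments_pair)

lemma count_side: "i < n + 3 \<Longrightarrow> j < n + 3 \<Longrightarrow> i \<noteq> j \<Longrightarrow> {i, j} \<in> T \<union> boundary n \<Longrightarrow> count T i j = 1"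
  using lower_sets_uncrossed[OF T nc, of "{i, j}"] by (simp add: count_def segments_pair)

text \<open>If i or j is an endpoint of [k,l], one product has a factor 0 from \<open>count\<close>
  at equal vertices and the other has the factor 1 of [k,l]. Otherwise there are vertices strictly
  on both sides, so [k,l] is not in the boundary and hence belongs to T.\<close>

lemma ptolemy:
  assumes "{k, l} \<in> T \<union> boundary n" "k < n + 3" "l < n + 3" "i < n + 3" "j < n + 3" "k \<noteq> l"
    "in_arc l k i" "in_arc k l j"
  shows "count T i j = count T i k * count T j l + count T i l * count T j k"
proof -
  have kl: "count T k l = 1" "count T l k = 1"
    using count_side[of k l] assms(1-3,6) by (simp_all add: count_commute)
  consider "i = k" | "i = l" | "j = k" | "j = l" | "cyc l i k" "cyc k j l"
    using assms(7,8) by (auto simp: in_arc_def)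
  then show ?thesis
  proof cases
    case 5
    then have "{k, l} \<in> T" using boundary_arc[of k l n i j] assms(1-5) by blast
    moreover have "cyc i k j" "cyc j l i" "i \<noteq> j" "i \<noteq> k" "i \<noteq> l" "j \<noteq> k" "j \<noteq> l"
      using 5 by (auto simp: cyc_def)
    ultimately show ?thesis
      using ptolemy_diagonal[OF T nc, of k l i j] assms(4,5) by (simp add: count_def)
  qed (use kl in \<open>simp_all add: count_commute count_def[of _ k k] count_def[of _ l l]\<close>)
qed

end

locale flipped_quadrilateral =
  fixes n :: nat and T :: "seg set" and k l p q :: nat
  assumes T: "T \<subseteq> diagonals n" and nc: "\<And>x y. x \<in> T \<Longrightarrow> y \<in> T \<Longrightarrow> \<not> crosses x y"
    and quad: "quadrilateral n T k l p q"
begin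

text \<open>The half turn of the quadrilateral. It exchanges b with d and c with e, which halves the
  case distinctions.\<close>

lemma swapped: "flipped_quadrilateral n T l k q p"
  using T nc quad by unfold_locales (auto simp: quadrilateral_def insert_commute)

lemma less: "k < n + 3" "l < n + 3" "p < n + 3" "q < n + 3"
  using quad by (auto simp: quadrilateral_def open_arc_def)

lemma kl: "{k, l} \<in> T" "k \<noteq> l"
proof -
  show "{k, l} \<in> T" using quad by (simp add: quadrilateral_def)
  then show "k \<noteq> l" using T diagonals_pair[of l l n] by auto
qed

lemma cyclic: "cyc k p l" "cyc l q k"
  using quad less kl by (auto simp: quadrilateral_def mem_open_arc)

lemma cyclic': "cyc p l q" "cyc q k p" "cyc l k p" "cyc l q p" "cyc k p q" "cyc k l q" "cyc p q k" "cyc p l k"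
  "cyc q p l" "cyc q k l"
  using cyc_trans[of k p l q] cyclic cyc_rotate by blast+

lemma distinct: "k \<noteq> p" "p \<noteq> l" "l \<noteq> q" "q \<noteq> k" "p \<noteq> q"
  using cyclic by (auto simp: cyc_def)

lemma sides: "{k, p} \<in> T \<union> boundary n" "{p, l} \<in> T \<union> boundary n"
  "{l, q} \<in> T \<union> boundary n" "{q, k} \<in> T \<union> boundary n"
  using quad by (simp_all add: quadrilateral_def)

abbreviation "T' \<equiv> flip T k l p q"
abbreviation "F \<equiv> count T"
abbreviation "G \<equiv> count T'"

text \<open>An endpoint strictly between p and q on the side of l is l itself, as otherwise x would
  cross [p,l] or [l,q]; likewise for k. This gives both that the flip is noncrossing and that the
  friezes agree outside the regions.\<close>

lemma crosses_pq:
  assumes x: "x \<in> segments n" "crosses x {p, q}"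
    "\<And>y. y \<in> {{k, l}, {k, p}, {p, l}, {l, q}, {q, k}} \<Longrightarrow> \<not> crosses x y"
  shows "x = {k, l}"
proof -
  have *: "a = l \<and> b = k" if "cyc p a q" "cyc q b p" "x = {a, b}" for a b
  proof -
    have "a = l \<or> cyc p a l \<or> cyc l a q" "b = k \<or> cyc q b k \<or> cyc k b p"
      using cyc_split[OF that(1) cyclic'(1)] cyc_split[OF that(2) cyclic'(2)] by blast+
    moreover have "cyc l b p" "cyc q b l" "cyc k a q" "cyc p a k"
      using cyc_trans[OF that(2) cyclic'(9)] cyc_trans[OF that(1) cyclic'(7)] cyc_rotate by blast+
    moreover have "\<not> crosses {p, l} {a, b}" "\<not> crosses {l, q} {a, b}"
        "\<not> crosses {q, k} {a, b}" "\<not> crosses {k, p} {a, b}"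
      using x(3) that(3) crosses_commute by blast+
    ultimately show ?thesis unfolding crosses_pair by blast
  qed
  obtain a b where ab: "x = {a, b}" using x(1) by (rule segmentE)
  then have "crosses {p, q} {a, b}" using x(2) by (simp add: crosses_commute)
  then show ?thesis using *[of a b] *[of b a] ab unfolding crosses_pair by (auto simp: insert_commute)
qed

lemma not_crosses_boundary: "x \<in> segments n \<Longrightarrow> y \<in> boundary n \<Longrightarrow> y \<in> segments n \<Longrightarrow> \<not> crosses x y"
  using crosses_imp_diagonal[of x y n] by (auto simp: diagonals_def)

lemma side_segments: "{k, p} \<in> segments n" "{p, l} \<in> segments n" "{l, q} \<in> segments n" "{q, k} \<in> segments n"
  "{k, l} \<in> segments n" "{p, q} \<in> segments n"
  using less distinct kl by (auto simp: segments_pair)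

lemma T_segments: "x \<in> T \<Longrightarrow> x \<in> segments n"
  using T by (auto simp: diagonals_def)

lemma T_not_crosses_pq:
  assumes "x \<in> T" "x \<noteq> {k, l}"
  shows "\<not> crosses x {p, q}"
proof
  assume "crosses x {p, q}"
  moreover have "\<not> crosses x y" if "y \<in> {{k, l}, {k, p}, {p, l}, {l, q}, {q, k}}" for y
    using that nc[OF assms(1)] kl sides side_segments not_crosses_boundary T_segments[OF assms(1)] by blast
  ultimately show False using crosses_pq T_segments assms by blast
qed

lemma flip_diagonals: "T' \<subseteq> diagonals n"
proof -
  have "crosses {k, l} {p, q}" using cyclic unfolding crosses_pair by blast
  then have "{p, q} \<in> diagonals n"
    using crosses_imp_diagonal side_segments by blast
  then show ?thesis using T by (auto simp: flip_def)
qed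

lemma flip_noncrossing: "x \<in> T' \<Longrightarrow> y \<in> T' \<Longrightarrow> \<not> crosses x y"
proof -
  have "\<not> crosses {p, q} {p, q}" unfolding crosses_pair by (auto simp: cyc_def)
  then show "x \<in> T' \<Longrightarrow> y \<in> T' \<Longrightarrow> \<not> crosses x y"
    using nc T_not_crosses_pq crosses_commute unfolding flip_def by blast
qed

lemma flip_sides: "{k, p} \<in> T' \<union> boundary n" "{p, l} \<in> T' \<union> boundary n"
  "{l, q} \<in> T' \<union> boundary n" "{q, k} \<in> T' \<union> boundary n" "{p, q} \<in> T'"
  using sides distinct by (auto simp: flip_def doubleton_eq_iff)

text \<open>The triangulations differ only in [k,l] and [p,q], so the crossed diagonals are the
  same.\<close>

lemma count_flip:
  assumes "\<not> crosses {k, l} {x, y}" "\<not> crosses {p, q} {x, y}"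
  shows "G x y = F x y"
proof -
  have "crossed T' {x, y} = crossed T {x, y}"
    using assms by (auto simp: crossed_def flip_def)
  then show ?thesis by (simp add: count_def lower_sets_def)
qed

lemma count_flip_arc:
  assumes "in_arc l q x \<and> in_arc l q y \<or> in_arc q k x \<and> in_arc q k y \<or>
    in_arc k p x \<and> in_arc k p y \<or> in_arc p l x \<and> in_arc p l y"
  shows "G x y = F x y"
proof (rule count_flip)
  note arcs = in_arc_not_cyc[OF cyclic(1)] in_arc_not_cyc[OF cyclic(2)]
    in_arc_not_cyc[OF cyclic'(1)] in_arc_not_cyc[OF cyclic'(2)]
  show "\<not> crosses {k, l} {x, y}" "\<not> crosses {p, q} {x, y}"
    using assms arcs unfolding crosses_pair by blast+
qed

lemma count_values:
  "F k l = 1" "F l k = 1" "F k p = 1" "F p k = 1" "F p l = 1" "F l p = 1" "F l q = 1" "F q l = 1"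
  "F q k = 1" "F k q = 1" "G p q = 1" "G q p = 1" "G k p = 1" "G p k = 1" "G p l = 1" "G l p = 1"
  "G l q = 1" "G q l = 1" "G q k = 1" "G k q = 1"
  using count_side[OF T nc] count_side[OF flip_diagonals flip_noncrossing]
    sides flip_sides kl less distinct
  by (simp_all add: insert_commute)

text \<open>Repeated Ptolemy relations with sides of count 1 reach k or p through one or two
  triangles. Everything becomes linear in the counts to l and q, on which the two friezes
  agree.\<close>

lemma arcs_lq:
  assumes "in_arc l q i" "i < n + 3"
  shows "F i k = F i l + F i q" "F i p = 2 * F i l + F i q" "G i p = F i l + F i q"
    "G i l = F i l" "G i q = F i q" "G i k = F i l + 2 * F i q"
proof -
  have arcs: "in_arc q l k" "in_arc q l p" "in_arc l k i" "in_arc k l p" "in_arc p q i" "in_arc q p k"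
    using assms(1) in_arc_extend[OF cyclic(2)] in_arc_extend[OF cyclic'(1)] cyc_in_arc[OF cyclic(1)]
      cyc_in_arc[OF cyclic'(2)] cyc_in_arc[OF cyclic'(9)] cyc_in_arc[OF cyclic'(10)] by blast+
  note P = ptolemy[OF T nc] and P' = ptolemy[OF flip_diagonals flip_noncrossing]
  show 1: "F i k = F i l + F i q"
    using P[of q l i k] arcs less assms sides distinct by (simp add: insert_commute count_values)
  show "F i p = 2 * F i l + F i q"
    using P[of k l i p] arcs less assms kl 1 by (simp add: count_values)
  show l: "G i l = F i l" and q: "G i q = F i q"
    using assms(1) by (auto intro!: count_flip_arc simp: in_arc_def)
  show 2: "G i p = F i l + F i q"
    using P'[of q l i p] arcs less assms flip_sides distinct l q by (simp add: insert_commute count_values)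
  show "G i k = F i l + 2 * F i q"
    using P'[of q p i k] arcs less assms flip_sides distinct 2 q by (simp add: insert_commute count_values)
qed

text \<open>This is the mirror image of the previous arc; a half turn preserves orientation and does
  not provide it.\<close>

lemma arcs_qk:
  assumes "in_arc q k i" "i < n + 3"
  shows "F i l = F i q + F i k" "F i p = F i q + 2 * F i k" "G i p = F i q + F i k"
    "G i q = F i q" "G i k = F i k" "G i l = 2 * F i q + F i k"
proof -
  have arcs: "in_arc k q l" "in_arc k q p" "in_arc l k i" "in_arc k l p" "in_arc q p i" "in_arc p q l"
    using assms(1) in_arc_extend[OF cyclic(2)] in_arc_extend[OF cyclic'(2)] cyc_in_arc[OF cyclic(1)]
      cyc_in_arc[OF cyclic'(1)] cyc_in_arc[OF cyclic'(5)] cyc_in_arc[OF cyclic'(6)] by blast+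
  note P = ptolemy[OF T nc] and P' = ptolemy[OF flip_diagonals flip_noncrossing]
  show 1: "F i l = F i q + F i k"
    using P[of k q i l] arcs less assms sides distinct by (simp add: insert_commute count_values)
  show "F i p = F i q + 2 * F i k"
    using P[of k l i p] arcs less assms kl 1 by (simp add: count_values)
  show q: "G i q = F i q" and k: "G i k = F i k"
    using assms(1) by (auto intro!: count_flip_arc simp: in_arc_def)
  show 2: "G i p = F i q + F i k"
    using P'[of k q i p] arcs less assms flip_sides distinct k q by (simp add: insert_commute count_values)
  show "G i l = 2 * F i q + F i k"
    using P'[of p q i l] arcs less assms flip_sides distinct 2 q by (simp add: insert_commute count_values)
qed

lemma opposite_arcs:
  "in_arc l q i \<Longrightarrow> in_arc k p j \<Longrightarrow> i \<noteq> j" "in_arc p l i \<Longrightarrow> in_arc q k j \<Longrightarrow> i \<noteq> j"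
  using in_arc_disjoint[OF cyclic(2,1)] in_arc_disjoint[OF cyclic'(1,2)] by blast+

lemma arc_ends: "in_arc a b a" "in_arc a b b"
  by (simp_all add: in_arc_def)

lemma region_side:
  assumes "{x, y} \<in> T \<union> boundary n" "M \<in> region K n T {x, y}"
  shows "crosses {x, y} M"
  using assms region_eq[OF T, of "{x, y}" K] by (cases "{x, y} \<in> T") (auto simp: region_def)

lemma frieze_difference_count:
  assumes "i < n + 3" "j < n + 3" "i \<noteq> j"
  shows "frieze_difference K n T k l p q {i, j} = F i j - G i j"
  using rho_count[OF T nc assms, of K] rho_count[OF flip_diagonals flip_noncrossing assms, of K]
  by (simp add: frieze_difference_def)

text \<open>Crossing [a,b] and [b,c] requires endpoints in two disjoint open arcs, so both endpoints
  of M are accounted for.\<close>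

lemma crosses_adjacent:
  assumes "crosses {a, b} M" "crosses {b, c} M" "cyc a b c" "M \<in> segments n"
  obtains i j where "M = {i, j}" "i < n + 3" "j < n + 3" "cyc a i b" "cyc b j c"
proof -
  obtain i j where M: "M = {i, j}" "i < n + 3" "j < n + 3" using assms(4) by (rule segmentE)
  have "\<not> (cyc a h b \<and> cyc b h c)" "cyc a h b \<Longrightarrow> \<not> cyc b h a" for h
    using assms(3) by (auto simp: cyc_def)
  then have "cyc a i b \<and> cyc b j c \<or> cyc a j b \<and> cyc b i c"
    using assms(1,2) unfolding M crosses_pair by blast
  then show ?thesis using that M by (auto simp: insert_commute)
qed

lemma cyc_outside: "cyc a i b \<Longrightarrow> cyc b j c \<Longrightarrow> cyc a b c \<Longrightarrow> \<not> cyc a j b \<and> \<not> cyc b i c \<and> i \<noteq> j"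
  by (auto simp: cyc_def)

lemma flip_swap: "flip T l k q p = T'"
  by (simp add: flip_def insert_commute)

lemma arcs_kp:
  assumes "in_arc k p i" "i < n + 3"
  shows "F i l = F i k + F i p" "F i q = 2 * F i k + F i p" "G i q = F i k + F i p"
    "G i k = F i k" "G i p = F i p" "G i l = F i k + 2 * F i p"
  using flipped_quadrilateral.arcs_lq[OF swapped assms] by (simp_all add: flip_swap)

lemma arcs_pl:
  assumes "in_arc p l i" "i < n + 3"
  shows "F i k = F i p + F i l" "F i q = F i p + 2 * F i l" "G i q = F i p + F i l"
    "G i p = F i p" "G i l = F i l" "G i k = 2 * F i p + F i l"
  using flipped_quadrilateral.arcs_qk[OF swapped assms] by (simp_all add: flip_swap)

section \<open>The frieze difference, region by region\<close>

lemmas ptolemy_T = ptolemy[OF T nc]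
lemmas ptolemy_T' = ptolemy[OF flip_diagonals flip_noncrossing]

lemma difference_BC:
  assumes M: "M \<in> segments n" "M \<in> overlap_region K n T k l p q BC"
  shows "frieze_difference K n T k l p q M =
    (rho K n T (pi1_plus n k l p q BC M) - rho K n T (pi2_plus n k l p q BC M)) *
    (rho K n T (pi1_minus n k l p q BC M) - rho K n T (pi2_minus n k l p q BC M))"
proof -
  have "crosses {p, l} M" "crosses {l, q} M"
    using M(2) sides region_side by auto
  then obtain j i where ij: "M = {j, i}" "j < n + 3" "i < n + 3" "cyc p j l" "cyc l i q"
    using crosses_adjacent[OF _ _ cyclic'(1) M(1)] by blast
  have arcs: "in_arc l q i" "in_arc p l j" using ij by (simp_all add: in_arc_def)
  then have arcs': "in_arc q l j" using in_arc_extend[OF cyclic'(9)] by blast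
  have ne: "i \<noteq> j" "i \<noteq> p" "i \<noteq> k" "j \<noteq> q" "j \<noteq> k" and out: "\<not> cyc p i l" "\<not> cyc l j q"
    using arcs arc_ends cyc_outside[OF ij(4,5) cyclic'(1)] opposite_arcs by blast+
  have "i \<in> open_arc n l q" "j \<notin> open_arc n l q" "j \<in> open_arc n p l" "i \<notin> open_arc n p l"
    using ij out less distinct by (simp_all add: mem_open_arc)
  then have pi: "pi1_plus n k l p q BC M = {i, p}" "pi2_plus n k l p q BC M = {i, k}"
    "pi1_minus n k l p q BC M = {j, q}" "pi2_minus n k l p q BC M = {j, k}"
    by (simp_all add: ij(1) proj_pair proj_pair')
  \<comment> \<open>Only the count of [j,q] changes under the flip, and by \<open>F j l\<close>. So
    the difference is \<open>F i l * F j l\<close>, and these two factors are exactly the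
    differences of the projections.\<close>
  have "F j i = F j l * F i q + F j q * F i l" "G j i = G j l * G i q + G j q * G i l"
    using ptolemy_T[of q l i j] ptolemy_T'[of q l i j] sides flip_sides less ij distinct arcs arcs'
    by (simp_all add: insert_commute count_commute mult.commute)
  then show ?thesis
    unfolding pi unfolding ij(1)
    using ij(2,3) less ne arcs_lq[OF arcs(1) ij(3)] arcs_pl[OF arcs(2) ij(2)]
    by (simp add: frieze_difference_count rho_count[OF T nc] algebra_simps)
qed

lemma difference_BE:
  assumes M: "M \<in> segments n" "M \<in> overlap_region K n T k l p q BE"
  shows "frieze_difference K n T k l p q M =
    - ((rho K n T (pi2_plus n k l p q BE M) - 2 * rho K n T (pi1_plus n k l p q BE M)) *
       (rho K n T (pi2_minus n k l p q BE M) - 2 * rho K n T (pi1_minus n k l p q BE M)))"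
proof -
  have "crosses {l, q} M" "crosses {q, k} M"
    using M(2) sides region_side by auto
  then obtain i j where ij: "M = {i, j}" "i < n + 3" "j < n + 3" "cyc l i q" "cyc q j k"
    using crosses_adjacent[OF _ _ cyclic(2) M(1)] by blast
  have arcs: "in_arc l q i" "in_arc q k j" using ij by (simp_all add: in_arc_def)
  then have arcs': "in_arc q l j" using in_arc_extend[OF cyclic'(10)] by blast
  have ne: "i \<noteq> j" "i \<noteq> p" "i \<noteq> k" "j \<noteq> p" "j \<noteq> l" and out: "\<not> cyc q i k" "\<not> cyc l j q"
    using arcs arc_ends cyc_outside[OF ij(4,5) cyclic(2)] opposite_arcs by blast+
  have "i \<in> open_arc n l q" "j \<notin> open_arc n l q" "j \<in> open_arc n q k" "i \<notin> open_arc n q k"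
    using ij out less distinct by (simp_all add: mem_open_arc)
  then have pi: "pi1_plus n k l p q BE M = {j, l}" "pi2_plus n k l p q BE M = {j, p}"
    "pi1_minus n k l p q BE M = {i, k}" "pi2_minus n k l p q BE M = {i, p}"
    by (simp_all add: ij(1) proj_pair proj_pair')
  \<comment> \<open>Only the count of [j,l] changes, growing by \<open>F j q\<close>, so the
    difference is \<open>- (F i q * F j q)\<close>. The two parentheses of the formula evaluate to
    \<open>- F j q\<close> and \<open>- F i q\<close>.\<close>
  have "F i j = F i q * F j l + F i l * F j q" "G i j = G i q * G j l + G i l * G j q"
    using ptolemy_T[of q l i j] ptolemy_T'[of q l i j] sides flip_sides less ij distinct arcs arcs'
    by (simp_all add: insert_commute)
  then show ?thesis
    unfolding pi unfolding ij(1)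
    using ij(2,3) less ne arcs_lq[OF arcs(1) ij(2)] arcs_qk[OF arcs(2) ij(3)]
    by (simp add: frieze_difference_count rho_count[OF T nc] algebra_simps)
qed

lemma difference_CE:
  assumes "M \<in> rect_closure n k l p q CE"
  shows "frieze_difference K n T k l p q M =
    rho K n T (pis_down n k l p q CE M) * rho K n T (pip_down n k l p q CE M) +
    rho K n T (pis_up n k l p q CE M) * rho K n T (pip_up n k l p q CE M) -
    3 * rho K n T (pip_down n k l p q CE M) * rho K n T (pip_up n k l p q CE M)"
proof -
  obtain i j where ij: "M = {i, j}" "i < n + 3" "j < n + 3" and arcs: "in_arc p l i" "in_arc q k j"
    using assms less distinct by (auto simp: mem_closed_arc)
  \<comment> \<open>Opposite arcs are disjoint even with their ends included, so all projections are
    proper segments and their values of \<open>rho\<close> are given by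
    \<open>count\<close>.\<close>
  have ne: "i \<noteq> j" "i \<noteq> k" "i \<noteq> q" "j \<noteq> l" "j \<noteq> p" and out: "\<not> in_arc p l j" "\<not> in_arc q k i"
    using opposite_arcs arcs arc_ends by blast+
  have "i \<in> closed_arc n p l" "j \<notin> closed_arc n p l" "j \<in> closed_arc n q k" "i \<notin> closed_arc n q k"
    using ij arcs out less distinct by (simp_all add: mem_closed_arc)
  then have pi: "pip_up n k l p q CE M = {j, l}" "pis_up n k l p q CE M = {i, q}"
    "pip_down n k l p q CE M = {i, k}" "pis_down n k l p q CE M = {j, p}"
    by (simp_all add: ij(1) proj_pair proj_pair')
  have arcs': "in_arc k l i" "in_arc l k j" "in_arc p q i" "in_arc q p j"
    using in_arc_extend[OF cyclic(1)] in_arc_extend[OF cyclic(2)] in_arc_extend[OF cyclic'(1)]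
      in_arc_extend[OF cyclic'(2)] arcs by blast+
  \<comment> \<open>F is expanded along the old diagonal and G along the new one. The products
    \<open>F i k * F j l\<close> and \<open>G i q * G j p\<close> coincide, leaving
    \<open>F i l * F j k - F i p * F j q\<close>; in terms of the projections this has the
    coefficient -3.\<close>
  have "F i j = F i l * F j k + F i k * F j l" "G i j = G i q * G j p + G i p * G j q"
    using ptolemy_T[of l k i j] ptolemy_T'[of q p i j] kl flip_sides less ij distinct arcs'
    by (simp_all add: insert_commute)
  then show ?thesis
    unfolding pi unfolding ij(1)
    using ij(2,3) less ne arcs_pl[OF arcs(1) ij(2)] arcs_qk[OF arcs(2) ij(3)]
    by (simp add: frieze_difference_count rho_count[OF T nc] algebra_simps)
qed

lemma difference_BD:
  assumes "M \<in> rect_closure n k l p q BD"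
  shows "frieze_difference K n T k l p q M =
    rho K n T (pis_down n k l p q BD M) * rho K n T (pip_down n k l p q BD M) +
    rho K n T (pis_up n k l p q BD M) * rho K n T (pip_up n k l p q BD M) -
    3 * rho K n T (pip_down n k l p q BD M) * rho K n T (pip_up n k l p q BD M)"
proof -
  obtain i j where ij: "M = {i, j}" "i < n + 3" "j < n + 3" and arcs: "in_arc l q i" "in_arc k p j"
    using assms less distinct by (auto simp: mem_closed_arc)
  have ne: "i \<noteq> j" "i \<noteq> k" "i \<noteq> p" "j \<noteq> l" "j \<noteq> q" and out: "\<not> in_arc l q j" "\<not> in_arc k p i"
    using opposite_arcs arcs arc_ends by blast+
  have "i \<in> closed_arc n l q" "j \<notin> closed_arc n l q" "j \<in> closed_arc n k p" "i \<notin> closed_arc n k p"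
    using ij arcs out less distinct by (simp_all add: mem_closed_arc)
  then have pi: "pip_up n k l p q BD M = {j, l}" "pis_up n k l p q BD M = {i, p}"
    "pip_down n k l p q BD M = {i, k}" "pis_down n k l p q BD M = {j, q}"
    by (simp_all add: ij(1) proj_pair proj_pair')
  have arcs': "in_arc l k i" "in_arc k l j" "in_arc p q i" "in_arc q p j"
    using in_arc_extend[OF cyclic(1)] in_arc_extend[OF cyclic(2)] in_arc_extend[OF cyclic'(1)]
      in_arc_extend[OF cyclic'(2)] arcs by blast+
  \<comment> \<open>Here the coinciding products are \<open>F i k * F j l\<close> and
    \<open>G i p * G j q\<close>, which leaves \<open>F i l * F j k - F i q * F j p\<close>.\<close>
  have "F i j = F i k * F j l + F i l * F j k" "G i j = G i q * G j p + G i p * G j q"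
    using ptolemy_T[of k l i j] ptolemy_T'[of q p i j] kl flip_sides less ij distinct arcs'
    by (simp_all add: insert_commute)
  then show ?thesis
    unfolding pi unfolding ij(1)
    using ij(2,3) less ne arcs_lq[OF arcs(1) ij(2)] arcs_kp[OF arcs(2) ij(3)]
    by (simp add: frieze_difference_count rho_count[OF T nc] algebra_simps)
qed

text \<open>Outside all regions M crosses neither [k,l] nor a side of the quadrilateral. It then
  cannot cross [p,q] either, as it would have to be [k,l].\<close>

lemma difference_F:
  assumes M: "M \<in> region_F K n T k l p q"
  shows "frieze_difference K n T k l p q M = 0"
proof -
  have Ms: "M \<in> segments n" "M \<noteq> {k, l}" using M by (auto simp: region_F_def)
  have "\<not> crosses M y" if y: "y \<in> {{k, l}, {k, p}, {p, l}, {l, q}, {q, k}}" for y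
  proof
    assume c: "crosses M y"
    then have "crosses y M" by (simp add: crosses_commute)
    have "y \<in> T" using c y sides kl side_segments not_crosses_boundary[OF Ms(1)] by blast
    then have "M \<in> diagonals n" "M \<notin> T"
      using \<open>crosses y M\<close> crosses_imp_diagonal T_segments Ms(1) nc by blast+
    then have "M \<in> region K n T y"
      using region_eq[OF T \<open>y \<in> T\<close>, of K] \<open>crosses y M\<close> by simp
    then show False using M y by (auto simp: region_F_def)
  qed
  then have nc': "\<not> crosses M {p, q}" "\<not> crosses M {k, l}"
    using crosses_pq[OF Ms(1)] Ms(2) by blast+
  obtain i j where ij: "M = {i, j}" "i < n + 3" "j < n + 3" "i \<noteq> j" using Ms(1) by (rule segmentE)
  then have "G i j = F i j" using nc' crosses_commute by (intro count_flip) blast+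
  then show ?thesis using ij by (simp add: frieze_difference_count)
qed

end

theorem theorem6p12:
  fixes K :: "'k::field itself"
    and n k l p q :: nat and T :: "seg set" and M :: seg
  assumes "triangulation n T"
    and "quadrilateral n T k l p q"
    and "M \<in> segments n"
  defines "s \<equiv> rho K n T"
    and "\<delta> \<equiv> frieze_difference K n T k l p q"
  shows "(\<forall>R \<in> {BC, DE}. M \<in> overlap_region K n T k l p q R \<longrightarrow>
            \<delta> M = (s (pi1_plus n k l p q R M) - s (pi2_plus n k l p q R M)) *
                  (s (pi1_minus n k l p q R M) - s (pi2_minus n k l p q R M)))
       \<and> (\<forall>R \<in> {BE, CD}. M \<in> overlap_region K n T k l p q R \<longrightarrow>
            \<delta> M = - ((s (pi2_plus n k l p q R M) - 2 * s (pi1_plus n k l p q R M)) *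
                     (s (pi2_minus n k l p q R M) - 2 * s (pi1_minus n k l p q R M))))
       \<and> (\<forall>R \<in> {CE, BD}. M \<in> rect_closure n k l p q R \<longrightarrow>
            \<delta> M = s (pis_down n k l p q R M) * s (pip_down n k l p q R M)
                + s (pis_up n k l p q R M) * s (pip_up n k l p q R M)
                - 3 * s (pip_down n k l p q R M) * s (pip_up n k l p q R M))
       \<and> (M \<in> region_F K n T k l p q \<longrightarrow> \<delta> M = 0)"
proof -
  interpret flipped_quadrilateral n T k l p q
    using assms(1,2) by unfold_locales (auto simp: triangulation_def)
  interpret swapped: flipped_quadrilateral n T l k q p
    by (rule swapped)
  have \<delta>: "\<delta> = frieze_difference K n T l k q p"
    by (simp add: \<delta>_def frieze_difference_def[abs_def] flip_swap)
  \<comment> \<open>The half turn carries these two overlaps to those of b with c and of b with e,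
    and the projections correspond by their defining equations.\<close>
  have DE: "overlap_region K n T k l p q DE = overlap_region K n T l k q p BC"
    and CD: "overlap_region K n T k l p q CD = overlap_region K n T l k q p BE"
    by (simp_all add: insert_commute Int_commute)
  show ?thesis
    using difference_BC[OF assms(3), of K] difference_BE[OF assms(3), of K]
      difference_CE[of M K] difference_BD[of M K] difference_F[of M K]
      swapped.difference_BC[OF assms(3), of K, folded \<delta> DE]
      swapped.difference_BE[OF assms(3), of K, folded \<delta> CD]
    by (simp add: s_def \<delta>_def[symmetric] del: overlap_region.simps rect_closure.simps)
qed

end
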